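(* If $X$ is a dual complex Banach space (i.e. $X$ is isometrically the dual of a complex Banach space), then the Kobayashi infinitesimal metric $k_X=k_{B_X}$ on the open unit ball $B_X$ has constant holomorphic sectional curvature $-4$; that is, $\kappa_k(x,v)=-4$ for all $x\in B_X$ and $0\neq v\in X$.
   Context: $\mathbb{D}$ is the open unit disc in $\mathbb{C}$; $H(\mathcal{D}_1,\mathcal{D}_2)$ is the set of holomorphic maps from $\mathcal{D}_1$ to $\mathcal{D}_2$. The Kobayashi infinitesimal metric of a domain $\mathcal{D}\subset X$ is, for $p\in\mathcal{D}$, $v\in X$, $$k_{\mathcal{D}}(p,v)=\inf\{\eta>0:\exists f\in H(\mathbb{D},\mathcal{D}),\ f(0)=p,\ f'(0)\eta=v\}.$$ For a bounded domain $\mathcal{D}$, the holomorphic sectional curvature of $k_{\mathcal{D}}$ at $x\in\mathcal{D}$ in the nonzero direction $v\in X$ is $$\kappa_k(x,v)=\sup\left\{\frac{\triangle\log k_{\mathcal{D}}^2(f(z),f'(z))\big|_{z=0}}{-2k_{\mathcal{D}}^2(f(0),f'(0))}: f\in H(r\mathbb{D},\mathcal{D}),\ r>0,\ f(0)=x,\ f'(0)=v\right\}.$$ Here $\triangle$ is the generalised Laplacian, defined for upper semicontinuous functions $u$ with values in $[-\infty,\infty)$ (not identically $-\infty$) at points $z$ with $u(z)\neq-\infty$ by $$\triangle u(z)=4\liminf_{r\to0^+}\frac1{r^2}\left\{\frac1{2\pi}\int_0^{2\pi}u(z+re^{i\theta})\,d\theta-u(z)\right\}.$$ *)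

theory Defs
  imports "HOL-Analysis.Analysis"
begin

class complex_normed_vector = real_normed_vector +
  fixes scaleC :: "complex \<Rightarrow> 'a \<Rightarrow> 'a"  (infixr \<open>*\<^sub>C\<close> 75)
  assumes scaleC_add_right: "a *\<^sub>C (x + y) = a *\<^sub>C x + a *\<^sub>C y"
    and scaleC_add_left: "(a + b) *\<^sub>C x = a *\<^sub>C x + b *\<^sub>C x"
    and scaleC_scaleC: "a *\<^sub>C (b *\<^sub>C x) = (a * b) *\<^sub>C x"
    and scaleC_of_real: "complex_of_real r *\<^sub>C x = r *\<^sub>R x"
    and norm_scaleC: "norm (a *\<^sub>C x) = cmod a * norm x"

class complex_banach = complex_normed_vector + banach

instantiation complex :: complex_banach
begin

definition scaleC_complex_def [simp]: "scaleC a (x::complex) = a * x"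

instance
  by standard (simp_all add: algebra_simps scaleR_conv_of_real norm_mult)

end

definition dual_space :: "('b::complex_normed_vector \<Rightarrow> complex) set" where
  "dual_space = {\<phi>. bounded_linear \<phi> \<and> (\<forall>c y. \<phi> (c *\<^sub>C y) = c * \<phi> y)}"

text \<open>\<open>J\<close> exhibits \<open>'a\<close> isometrically as the dual of \<open>'b\<close>: it is a complex-linear
  isometry onto \<open>dual_space\<close>, which carries the operator norm \<open>onorm\<close>.\<close>

definition dual_isometry :: "('a::complex_banach \<Rightarrow> 'b::complex_banach \<Rightarrow> complex) \<Rightarrow> bool" where
  "dual_isometry J \<longleftrightarrow>
     (\<forall>x x' y. J (x + x') y = J x y + J x' y) \<and>
     (\<forall>c x y. J (c *\<^sub>C x) y = c * J x y) \<and>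
     (\<forall>x. onorm (J x) = norm x) \<and>
     range J = dual_space"

definition has_complex_derivative ::
    "(complex \<Rightarrow> 'a::complex_normed_vector) \<Rightarrow> 'a \<Rightarrow> complex \<Rightarrow> bool" where
  "has_complex_derivative f v z \<longleftrightarrow> (f has_derivative (\<lambda>h. h *\<^sub>C v)) (at z)"

definition complex_deriv :: "(complex \<Rightarrow> 'a::complex_normed_vector) \<Rightarrow> complex \<Rightarrow> 'a" where
  "complex_deriv f z = (THE v. has_complex_derivative f v z)"

text \<open>The set \<open>H(S, D)\<close>, for open \<open>S\<close>; the values of its members outside \<open>S\<close> are
  irrelevant.\<close>

definition holomorphic_maps ::
    "complex set \<Rightarrow> 'a::complex_normed_vector set \<Rightarrow> (complex \<Rightarrow> 'a) set" where
  "holomorphic_maps S D =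
     {f. (\<forall>z\<in>S. \<exists>v. has_complex_derivative f v z) \<and> f ` S \<subseteq> D}"

text \<open>For \<open>D\<close> open and \<open>p \<in> D\<close> the infimum is over a nonempty set, because
  \<open>z \<mapsto> p + (z / \<eta>) v\<close> is admissible for large \<open>\<eta>\<close>.\<close>

definition kobayashi_metric :: "'a::complex_normed_vector set \<Rightarrow> 'a \<Rightarrow> 'a \<Rightarrow> real" where
  "kobayashi_metric D p v =
     Inf {\<eta>. \<eta> > 0 \<and>
       (\<exists>f\<in>holomorphic_maps (ball 0 1) D. f 0 = p \<and> \<eta> *\<^sub>R complex_deriv f 0 = v)}"

text \<open>Logarithm on \<open>[0, \<infinity>)\<close> with \<open>log 0 = -\<infinity>\<close> (the library has \<open>ln 0 = 0\<close>).\<close>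

definition log_ext :: "real \<Rightarrow> ereal" where
  "log_ext t = (if t = 0 then -\<infinity> else ereal (ln t))"

text \<open>Lebesgue integral of an extended-real function as the integral of the positive part
  minus that of the negative part (\<open>e2ennreal\<close> sends negative arguments to 0); the value
  may be \<open>-\<infinity>\<close>. It is only meaningful if one of the two integrals is finite, as for upper
  semicontinuous functions below \<open>\<infinity>\<close> on a circle.\<close>

definition ereal_integral :: "'b measure \<Rightarrow> ('b \<Rightarrow> ereal) \<Rightarrow> ereal" where
  "ereal_integral M u =
     enn2ereal (\<integral>\<^sup>+ t. e2ennreal (u t) \<partial>M) - enn2ereal (\<integral>\<^sup>+ t. e2ennreal (- u t) \<partial>M)"

definition gen_laplacian :: "(complex \<Rightarrow> ereal) \<Rightarrow> complex \<Rightarrow> ereal" where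
  "gen_laplacian u z =
     4 * Liminf (at_right (0::real)) (\<lambda>r. ereal (1 / r\<^sup>2) *
       (ereal (1 / (2 * pi)) *
          ereal_integral (restrict_space lborel {0..2 * pi})
            (\<lambda>\<theta>. u (z + complex_of_real r * cis \<theta>))
        - u z))"

definition kobayashi_curvature :: "'a::complex_normed_vector set \<Rightarrow> 'a \<Rightarrow> 'a \<Rightarrow> ereal" where
  "kobayashi_curvature D x v =
     Sup {gen_laplacian (\<lambda>z. log_ext ((kobayashi_metric D (f z) (complex_deriv f z))\<^sup>2)) 0
            / ereal (- 2 * (kobayashi_metric D (f 0) (complex_deriv f 0))\<^sup>2)
          | f r. r > 0 \<and> f \<in> holomorphic_maps (ball 0 r) D \<and> f 0 = x \<and> complex_deriv f 0 = v}"

end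

theory Submission
  imports Defs "HOL-Complex_Analysis.Complex_Analysis"
begin

text \<open>Write \<open>k\<close> for the Kobayashi metric of the unit ball. Since the ball is weak-* compact, the
  infimum defining \<open>k x v\<close> is attained by a disc \<open>\<phi>\<close>. Along \<open>\<phi>\<close> the metric is dominated by the
  Poincare metric, with equality at the centre, so \<open>\<phi>\<close> witnesses curvature at least \<open>-4\<close>.

  For the opposite inequality let \<open>F\<close> be holomorphic into the ball with \<open>k (F 0) (F' 0) = 1\<close>, and take
  discs \<open>\<phi>\<^sub>z\<close> through \<open>F z\<close> in direction \<open>F' z\<close>, for \<open>z\<close> on the circle of radius \<open>r\<close>. Move them by disc
  automorphisms so that \<open>\<phi>\<^sub>z\<close> touches \<open>F\<close> at the parameter \<open>z\<close>, and average them at each \<open>\<zeta>\<close> with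
  \<open>|\<zeta>| = 1\<close> with the weights \<open>|1 - cnj z * \<zeta>|\<^sup>-\<^sup>4\<close>. These are positive, so by convexity the average stays in
  the ball; they continue meromorphically to the disc with a double pole at \<open>z\<close>, where the 1-jet of
  \<open>\<phi>\<^sub>z\<close> is known, and a double zero at 0, where it is not. The principal parts cancel in the mean, and
  the average is a disc through \<open>F 0\<close> in direction \<open>F' 0\<close>. Comparing its speed with the
  extremal one gives the strict sub-mean value property \<open>mean (ln k) \<ge> r\<^sup>2 + O (r\<^sup>3)\<close>, i.e. curvature at
  most \<open>-4\<close>. Averaging over the orbit of \<open>z\<close> under the cube roots of unity instead of the whole circle only
  costs \<open>O (r\<^sup>3)\<close> and avoids choosing \<open>\<phi>\<^sub>z\<close> measurably in \<open>z\<close>.\<close>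

section \<open>Vector-valued holomorphic maps and duality\<close>

text \<open>The principal parts cancel in the mean only if the directions of the touching discs
  depend holomorphically on z, while the metric prescribes just the modulus of the factor in front
  of the derivative of F. On three points this is no obstacle: three real numbers with their mean
  removed form a two-dimensional space, exactly the values of \<open>Re (a * z)\<close> on an orbit
  of the cube roots of unity. So the factor can be \<open>\<beta> * exp (- a * z)\<close>, where
  \<beta> carries the mean of \<open>ln k\<close>. For an error of order r^3 uniform in r, the
  exponent a must stay bounded as r tends to 0; the local Lipschitz estimate for \<open>ln k\<close>
  serves this purpose. The averaged disc has speed (2 r^2 + \<beta>) / (1 + r^2) at its centre, and
  extremality bounds this by 1 + O(r^3), hence \<beta> \<le> 1 - r^2 + O(r^3). All estimates are
  made for the scalar functions \<open>J (f z) y\<close>, with constants proportional to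
  \<open>norm y\<close>, and so hold in norm; derivatives and limits that are found weakly are
  vectors because \<open>J\<close> maps onto the dual.\<close>

lemma scaleC_one [simp]: "1 *\<^sub>C (x::'a::complex_normed_vector) = x"
  using scaleC_of_real[of 1 x] by simp

lemma scaleC_zero_left [simp]: "0 *\<^sub>C (x::'a::complex_normed_vector) = 0"
  using scaleC_of_real[of 0 x] by simp

lemma bounded_linear_scaleC_left: "bounded_linear (\<lambda>c. c *\<^sub>C (x::'a::complex_normed_vector))"
proof (rule bounded_linear_intro[where K = "norm x"])
  fix r :: real and c :: complex
  show "(r *\<^sub>R c) *\<^sub>C x = r *\<^sub>R c *\<^sub>C x"
    by (metis scaleC_of_real scaleC_scaleC scaleR_conv_of_real)
qed (simp_all add: scaleC_add_left norm_scaleC)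

lemma bounded_linear_scaleC_right: "bounded_linear (\<lambda>x::'a::complex_normed_vector. c *\<^sub>C x)"
proof (rule bounded_linear_intro[where K = "cmod c"])
  fix r :: real and x :: 'a
  show "c *\<^sub>C r *\<^sub>R x = r *\<^sub>R c *\<^sub>C x"
    by (metis mult.commute scaleC_of_real scaleC_scaleC)
qed (simp_all add: scaleC_add_right norm_scaleC mult.commute)

lemma has_complex_derivative_unique:
  assumes "has_complex_derivative f v z" "has_complex_derivative f w z"
  shows "v = w"
proof -
  have "(\<lambda>h. h *\<^sub>C v) = (\<lambda>h. h *\<^sub>C w)"
    using assms has_derivative_unique unfolding has_complex_derivative_def by blast
  from fun_cong[OF this, of 1] show ?thesis by simp
qed

lemma complex_deriv_eqI: "has_complex_derivative f v z \<Longrightarrow> complex_deriv f z = v"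
  unfolding complex_deriv_def using has_complex_derivative_unique by blast

lemma holomorphic_mapsD:
  assumes "f \<in> holomorphic_maps S D" "z \<in> S"
  shows "has_complex_derivative f (complex_deriv f z) z" "f z \<in> D"
proof -
  obtain v where "has_complex_derivative f v z"
    using assms unfolding holomorphic_maps_def by auto
  thus "has_complex_derivative f (complex_deriv f z) z"
    using complex_deriv_eqI by metis
  show "f z \<in> D" using assms unfolding holomorphic_maps_def by auto
qed

lemma has_complex_derivative_chain:
  assumes "(g has_field_derivative d) (at z)" "has_complex_derivative f v (g z)"
  shows "has_complex_derivative (\<lambda>w. f (g w)) (d *\<^sub>C v) z"
proof -
  have "(f \<circ> g has_derivative (\<lambda>h. h *\<^sub>C v) \<circ> (*) d) (at z)"
    using assms unfolding has_complex_derivative_def has_field_derivative_def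
    by (intro diff_chain_at) auto
  thus ?thesis
    unfolding has_complex_derivative_def o_def by (simp add: scaleC_scaleC mult.commute[of d])
qed

lemma has_complex_derivative_add:
  assumes "has_complex_derivative f v z" "has_complex_derivative g w z"
  shows "has_complex_derivative (\<lambda>x. f x + g x) (v + w) z"
  using assms has_derivative_add unfolding has_complex_derivative_def
  by (fastforce simp: scaleC_add_right)

lemma has_complex_derivative_scaleC:
  assumes "has_complex_derivative f v z"
  shows "has_complex_derivative (\<lambda>x. c *\<^sub>C f x) (c *\<^sub>C v) z"
proof -
  have "((\<lambda>x. c *\<^sub>C f x) has_derivative (\<lambda>h. c *\<^sub>C (h *\<^sub>C v))) (at z)"
    using assms unfolding has_complex_derivative_def
    by (rule bounded_linear.has_derivative[OF bounded_linear_scaleC_right])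
  moreover have "(\<lambda>h. c *\<^sub>C (h *\<^sub>C v)) = (\<lambda>h. h *\<^sub>C (c *\<^sub>C v))"
    by (simp add: scaleC_scaleC mult.commute)
  ultimately show ?thesis unfolding has_complex_derivative_def by simp
qed

lemma scaleC_zero_right [simp]: "c *\<^sub>C (0::'a::complex_normed_vector) = 0"
  using linear_0[OF bounded_linear.linear[OF bounded_linear_scaleC_right]] .

lemma has_complex_derivative_const: "has_complex_derivative (\<lambda>x. c) 0 z"
  unfolding has_complex_derivative_def by simp

lemma has_complex_derivative_ident_scaleC: "has_complex_derivative (\<lambda>x. x *\<^sub>C v) v z"
  unfolding has_complex_derivative_def
  using bounded_linear.has_derivative[OF bounded_linear_scaleC_left[of v] has_derivative_ident] .

text \<open>A quadratic remainder with an explicit constant is asked for, rather than o(h), because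
  such a bound can be checked functional by functional and survives weak-* limits.\<close>

lemma has_complex_derivative_quadraticI:
  assumes d: "0 < d"
    and C: "\<And>w. cmod (w - z) < d \<Longrightarrow>
      norm (f w - f z - (w - z) *\<^sub>C v) \<le> C * (cmod (w - z))\<^sup>2"
  shows "has_complex_derivative f v z"
  unfolding has_complex_derivative_def has_derivative_at_alt
proof (intro conjI allI impI bounded_linear_scaleC_left)
  fix e :: real assume e: "0 < e"
  let ?d = "min d (e / (\<bar>C\<bar> + 1))"
  have "norm (f w - f z - (w - z) *\<^sub>C v) \<le> e * cmod (w - z)" if w: "cmod (w - z) < ?d" for w
  proof -
    have "norm (f w - f z - (w - z) *\<^sub>C v) \<le> C * (cmod (w - z))\<^sup>2"
      using C w by simp
    also have "\<dots> \<le> ((\<bar>C\<bar> + 1) * cmod (w - z)) * cmod (w - z)"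
      by (simp add: power2_eq_square mult.assoc mult_right_mono)
    also have "\<dots> \<le> e * cmod (w - z)"
      using w by (intro mult_right_mono) (simp_all add: field_simps add_pos_nonneg)
    finally show ?thesis .
  qed
  thus "\<exists>d>0. \<forall>w. cmod (w - z) < d \<longrightarrow>
      norm (f w - f z - (w - z) *\<^sub>C v) \<le> e * cmod (w - z)"
    using d e by (intro exI[of _ ?d]) (auto simp: add_nonneg_pos)
qed

section \<open>Cauchy and Taylor estimates with explicit constants\<close>

text \<open>Cauchy's inequality on circles of radius R/4 around points of the half ball bounds the
  derivative of order n + 1 by (n + 1)! M (4/R)^(n + 1). The remainder formula divides only by n!,
  which leaves the factor n + 1.\<close>

lemma holomorphic_taylor_bound:
  fixes f :: "complex \<Rightarrow> complex"
  assumes f: "f holomorphic_on ball z R" and R: "0 < R"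
    and M: "\<And>w. w \<in> ball z R \<Longrightarrow> cmod (f w) \<le> M"
    and w: "cmod (w - z) < R / 2"
  shows "cmod (f w - (\<Sum>i\<le>n. (deriv ^^ i) f z * (w - z) ^ i / fact i))
    \<le> real (Suc n) * M * (4 / R) ^ Suc n * cmod (w - z) ^ Suc n"
proof -
  have B: "cmod ((deriv ^^ Suc n) f x) \<le> (fact (Suc n) :: real) * M / (R / 4) ^ Suc n"
    if x: "x \<in> ball z (R / 2)" for x
  proof (rule Cauchy_inequality)
    have sub: "cball x (R / 4) \<subseteq> ball z R"
    proof
      fix y assume "y \<in> cball x (R / 4)"
      with x R dist_triangle[of z y x] show "y \<in> ball z R" by auto
    qed
    show "f holomorphic_on ball x (R / 4)"
      by (rule holomorphic_on_subset[OF f]) (use sub ball_subset_cball in blast)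
    show "continuous_on (cball x (R / 4)) f"
      using f sub holomorphic_on_imp_continuous_on holomorphic_on_subset by blast
    show "0 < R / 4" using R by simp
    show "cmod (f y) \<le> M" if "cmod (x - y) = R / 4" for y
      using M[of y] sub that by (auto simp: dist_norm)
  qed
  have "cmod ((deriv ^^ 0) f w - (\<Sum>i\<le>n. (deriv ^^ i) f z * (w - z) ^ i / fact i))
      \<le> (fact (Suc n) * M / (R / 4) ^ Suc n) * cmod (w - z) ^ Suc n / fact n"
  proof (rule complex_Taylor[where S = "ball z (R / 2)"])
    fix i and x assume x: "x \<in> ball z (R / 2)"
    have "((deriv ^^ i) f has_field_derivative (deriv ^^ Suc i) f x) (at x)"
      using has_field_derivative_higher_deriv[OF f] x R by simp
    thus "((deriv ^^ i) f has_field_derivative (deriv ^^ Suc i) f x) (at x within ball z (R / 2))"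
      by (rule has_field_derivative_at_within)
  qed (use B w R in \<open>auto simp: dist_norm norm_minus_commute\<close>)
  also have "\<dots> = (Suc n) * M * (4 / R) ^ Suc n * cmod (w - z) ^ Suc n"
  proof -
    have "(fact n :: real) \<noteq> 0" by simp
    thus ?thesis by (simp add: fact_Suc divide_simps power_divide del: power_Suc)
  qed
  finally show ?thesis by simp
qed

text \<open>The factor 2 pays for using the circle of radius R/2, as f is not assumed to extend to
  the closed ball.\<close>

lemma holomorphic_deriv_bound:
  assumes f: "f holomorphic_on ball z R" and R: "0 < R"
    and M: "\<And>w. w \<in> ball z R \<Longrightarrow> cmod (f w) \<le> M"
  shows "cmod (deriv f z) \<le> 2 * M / R"
proof -
  have "cmod ((deriv ^^ 1) f z) \<le> fact 1 * M / (R / 2) ^ 1"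
  proof (rule Cauchy_inequality)
    have sub: "cball z (R / 2) \<subseteq> ball z R" using R by auto
    show "f holomorphic_on ball z (R / 2)"
      by (rule holomorphic_on_subset[OF f]) (use R in auto)
    show "continuous_on (cball z (R / 2)) f"
      using f sub holomorphic_on_imp_continuous_on holomorphic_on_subset by blast
    show "0 < R / 2" using R by simp
    show "cmod (f y) \<le> M" if "cmod (z - y) = R / 2" for y
      using M[of y] R that by (auto simp: dist_norm)
  qed
  thus ?thesis by (simp add: mult.commute)
qed

section \<open>The pairing with the predual\<close>

locale dual_banach =
  fixes J :: "'a::complex_banach \<Rightarrow> 'b::complex_banach \<Rightarrow> complex"
  assumes dual: "dual_isometry J"
begin

lemma J_add: "J (x + x') y = J x y + J x' y"
  and J_scaleC: "J (c *\<^sub>C x) y = c * J x y"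
  and onorm_J: "onorm (J x) = norm x"
  and range_J: "range J = dual_space"
  using dual unfolding dual_isometry_def by auto

lemma J_bounded_linear: "bounded_linear (J x)" and J_scaleC_right: "J x (c *\<^sub>C y) = c * J x y"
  using range_J unfolding dual_space_def by auto

lemma J_scaleR: "J (r *\<^sub>R x) y = of_real r * J x y"
  by (metis J_scaleC scaleC_of_real)

lemma J_zero [simp]: "J 0 y = 0"
  using J_scaleR[of 0 0] by simp

lemma J_minus: "J (- x) y = - J x y"
  using J_scaleR[of "-1" x] by simp

lemma J_diff: "J (x - x') y = J x y - J x' y"
  using J_add[of x "- x'"] by (simp add: J_minus)

lemma J_add_right: "J x (y + y') = J x y + J x y'"
  using J_bounded_linear by (simp add: linear_simps)

lemmas J_simps = J_add J_diff J_scaleC J_scaleR J_minus J_zero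

lemma J_le: "cmod (J x y) \<le> norm x * norm y"
  using onorm[OF J_bounded_linear, of x y] by (simp add: onorm_J)

lemma norm_le_J:
  assumes "\<And>y. cmod (J x y) \<le> K * norm y" "0 \<le> K"
  shows "norm x \<le> K"
  using onorm_bound[OF assms(2,1)] by (simp add: onorm_J)

lemma bounded_linear_J: "bounded_linear (\<lambda>x. J x y)"
  by (rule bounded_linear_intro[where K = "norm y"]) (simp_all add: J_simps J_le scaleR_conv_of_real)

lemma J_inject: "(\<And>y. J x y = J x' y) \<Longrightarrow> x = x'"
  using norm_le_J[of "x - x'" 0] by (simp add: J_diff)

lemma has_field_derivative_J:
  assumes "has_complex_derivative f v z"
  shows "((\<lambda>w. J (f w) y) has_field_derivative J v y) (at z)"
proof -
  have "((\<lambda>w. J (f w) y) has_derivative (\<lambda>h. J (h *\<^sub>C v) y)) (at z)"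
    using assms unfolding has_complex_derivative_def
    by (rule bounded_linear.has_derivative[OF bounded_linear_J])
  moreover have "(\<lambda>h. J (h *\<^sub>C v) y) = (*) (J v y)"
    by (auto simp: J_scaleC mult.commute)
  ultimately show ?thesis unfolding has_field_derivative_def by simp
qed

text \<open>Surjectivity of \<open>J\<close>: a functional obtained as a derivative or as a limit
  becomes a vector.\<close>

lemma functional_ex:
  assumes add: "\<And>y y'. l (y + y') = l y + l y'" and sc: "\<And>c y. l (c *\<^sub>C y) = c * l y"
    and bd: "\<And>y. cmod (l y) \<le> K * norm y"
  obtains x where "\<And>y. J x y = l y"
proof -
  have "bounded_linear l"
  proof (rule bounded_linear_intro[where K = K])
    show "l (r *\<^sub>R y) = r *\<^sub>R l y" for r y
      by (metis sc scaleC_of_real scaleR_conv_of_real)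
  qed (use add bd in \<open>simp_all add: mult.commute\<close>)
  hence "l \<in> range J" unfolding range_J dual_space_def using sc by auto
  thus ?thesis using that by auto
qed

text \<open>The scalar derivatives at z form a linear functional of y, bounded by Cauchy's estimate,
  hence a vector v. The scalar Taylor remainders are bounded by a constant times
  \<open>norm y\<close>, which bounds the norm of the vector remainder. This remainder is kept in
  the conclusion because limits of discs need it uniformly; 32 is 2 * 4^2, from the Taylor bound
  with n = 1.\<close>

lemma has_complex_derivative_weakI:
  assumes R: "0 < R" and M: "\<And>w. w \<in> ball z R \<Longrightarrow> norm (f w) \<le> M"
    and hol: "\<And>y. (\<lambda>w. J (f w) y) holomorphic_on ball z R"
  shows "\<exists>v. has_complex_derivative f v z \<and>
    (\<forall>w. cmod (w - z) < R / 2 \<longrightarrow>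
      norm (f w - f z - (w - z) *\<^sub>C v) \<le> 32 * M / R\<^sup>2 * (cmod (w - z))\<^sup>2)"
proof -
  let ?h = "\<lambda>y w. J (f w) y"
  let ?l = "\<lambda>y. deriv (?h y) z"
  have z: "z \<in> ball z R" using R by simp
  have bd: "cmod (?h y w) \<le> M * norm y" if "w \<in> ball z R" for w y
    using J_le[of "f w" y] M[OF that] by (meson mult_right_mono norm_ge_zero order_trans)
  have D: "(?h y has_field_derivative ?l y) (at z)" for y
    using holomorphic_derivI[OF hol _ z] by simp
  obtain v where v: "\<And>y. J v y = ?l y"
  proof (rule functional_ex[where l = ?l and K = "2 * M / R"])
    show "?l (y + y') = ?l y + ?l y'" for y y'
      unfolding J_add_right by (intro DERIV_imp_deriv DERIV_add D)
    show "?l (c *\<^sub>C y) = c * ?l y" for c y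
      unfolding J_scaleC_right by (intro DERIV_imp_deriv DERIV_cmult D)
    show "cmod (?l y) \<le> 2 * M / R * norm y" for y
      using holomorphic_deriv_bound[OF hol R bd, of y] by simp
  qed blast
  have est: "norm (f w - f z - (w - z) *\<^sub>C v) \<le> 32 * M / R\<^sup>2 * (cmod (w - z))\<^sup>2"
    if w: "cmod (w - z) < R / 2" for w
  proof (rule norm_le_J)
    have "0 \<le> M" using M[OF z] norm_ge_zero order_trans by blast
    thus "0 \<le> 32 * M / R\<^sup>2 * (cmod (w - z))\<^sup>2" by simp
    fix y
    have "cmod (?h y w - (\<Sum>i\<le>1. (deriv ^^ i) (?h y) z * (w - z) ^ i / fact i))
        \<le> real (Suc 1) * (M * norm y) * (4 / R) ^ Suc 1 * cmod (w - z) ^ Suc 1"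
      by (rule holomorphic_taylor_bound[OF hol R bd w])
    also have "\<dots> = 32 * M / R\<^sup>2 * (cmod (w - z))\<^sup>2 * norm y"
      by (simp add: power2_eq_square)
    also have "?h y w - (\<Sum>i\<le>1. (deriv ^^ i) (?h y) z * (w - z) ^ i / fact i)
        = J (f w - f z - (w - z) *\<^sub>C v) y"
      by (simp add: J_simps v mult.commute)
    finally show "cmod (J (f w - f z - (w - z) *\<^sub>C v) y)
      \<le> 32 * M / R\<^sup>2 * (cmod (w - z))\<^sup>2 * norm y" .
  qed
  have "has_complex_derivative f v z"
    by (rule has_complex_derivative_quadraticI[where d = "R / 2", OF _ est]) (use R in auto)
  with est show ?thesis by blast
qed

end

section \<open>Extremal discs\<close>

lemma ball_subset_unit_disc: "ball z (1 - cmod z) \<subseteq> ball 0 1"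
proof
  fix w assume "w \<in> ball z (1 - cmod z)"
  thus "w \<in> ball 0 1" using norm_triangle_sub[of w z] by (simp add: dist_norm norm_minus_commute)
qed

text \<open>Schwarz's lemma for \<open>g\<close>, which is h followed by the disc automorphism
  taking \<open>h 0\<close> to 0. The estimate is weaker than that of Schwarz and Pick, but involves
  \<open>h 0\<close> only through s and stays below 1 as long as s < 1.\<close>

lemma schwarz_pick_bound:
  assumes h: "h holomorphic_on ball 0 1" and le: "\<And>z. cmod z < 1 \<Longrightarrow> cmod (h z) < 1"
    and s: "cmod (h 0) \<le> s" and z: "cmod z < 1"
  shows "(cmod (h z))\<^sup>2 \<le> 1 - (1 - (cmod z)\<^sup>2) * (1 - s) / 2"
proof -
  define a where "a = h 0"
  have a: "cmod a < 1" unfolding a_def using le by simp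
  have id: "(cmod (1 - cnj a * w))\<^sup>2 - (cmod (w - a))\<^sup>2 = (1 - (cmod a)\<^sup>2) * (1 - (cmod w)\<^sup>2)" for w
    unfolding cmod_power2 by (simp add: algebra_simps power2_eq_square)
  have nz: "1 - cmod a \<le> cmod (1 - cnj a * h w)" if "cmod w < 1" for w
  proof -
    have "cmod (cnj a * h w) \<le> cmod a * 1"
      unfolding norm_mult using le[OF that] by (simp add: mult_left_le)
    thus ?thesis using norm_triangle_ineq2[of 1 "cnj a * h w"] by simp
  qed
  have pos: "0 < cmod (1 - cnj a * h w)" if "cmod w < 1" for w
    using nz[OF that] a by linarith
  define g where "g w = (h w - a) / (1 - cnj a * h w)" for w
  have "cmod (g z) \<le> cmod z"
  proof (rule Schwarz_Lemma)
    show "g holomorphic_on ball 0 1"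
      unfolding g_def using nz a by (intro holomorphic_intros h) force
    show "g 0 = 0" by (simp add: g_def a_def)
    show "cmod (g w) < 1" if w: "cmod w < 1" for w
    proof -
      have "0 < (1 - (cmod a)\<^sup>2) * (1 - (cmod (h w))\<^sup>2)"
        using a le[OF w] by (simp add: power_less_one_iff abs_square_less_1)
      hence "(cmod (h w - a))\<^sup>2 < (cmod (1 - cnj a * h w))\<^sup>2" using id[of "h w"] by simp
      hence "cmod (h w - a) < cmod (1 - cnj a * h w)" by (simp add: power2_less_imp_less)
      thus ?thesis unfolding g_def norm_divide using pos[OF w] by (subst pos_divide_less_eq) simp_all
    qed
  qed (use z in auto)
  hence "cmod (h z - a) \<le> cmod z * cmod (1 - cnj a * h z)"
    unfolding g_def norm_divide using pos[OF z] by (simp only: pos_divide_le_eq)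
  hence "(cmod (h z - a))\<^sup>2 \<le> (cmod z)\<^sup>2 * (cmod (1 - cnj a * h z))\<^sup>2"
    by (metis norm_ge_zero power_mono power_mult_distrib)
  hence "(1 - (cmod z)\<^sup>2) * (cmod (1 - cnj a * h z))\<^sup>2 \<le> (1 - (cmod a)\<^sup>2) * (1 - (cmod (h z))\<^sup>2)"
    using id[of "h z"] by (simp add: algebra_simps)
  moreover have "(1 - (cmod z)\<^sup>2) * (1 - cmod a)\<^sup>2 \<le> (1 - (cmod z)\<^sup>2) * (cmod (1 - cnj a * h z))\<^sup>2"
    using nz[OF z] a z by (intro mult_left_mono power_mono) (auto simp: abs_square_le_1)
  ultimately have "(1 - cmod a) * ((1 - (cmod z)\<^sup>2) * (1 - cmod a))
      \<le> (1 - cmod a) * ((1 + cmod a) * (1 - (cmod (h z))\<^sup>2))"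
    by (simp add: power2_eq_square algebra_simps)
  hence "(1 - (cmod z)\<^sup>2) * (1 - cmod a) \<le> (1 + cmod a) * (1 - (cmod (h z))\<^sup>2)"
    using a by simp
  also have "\<dots> \<le> 2 * (1 - (cmod (h z))\<^sup>2)"
    using a le[OF z] by (intro mult_right_mono) (auto simp: abs_square_le_1)
  finally have "(1 - (cmod z)\<^sup>2) * (1 - cmod a) \<le> 2 * (1 - (cmod (h z))\<^sup>2)" .
  moreover have "(1 - (cmod z)\<^sup>2) * (1 - s) \<le> (1 - (cmod z)\<^sup>2) * (1 - cmod a)"
    using s z unfolding a_def by (intro mult_left_mono) (auto simp: abs_square_le_1)
  ultimately show ?thesis by (simp add: field_simps)
qed

lemma kobayashi_metric_le:
  assumes "\<phi> \<in> holomorphic_maps (ball 0 1) D" "\<phi> 0 = p" "\<eta> *\<^sub>R complex_deriv \<phi> 0 = v" "0 < \<eta>"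
  shows "kobayashi_metric D p v \<le> \<eta>"
  unfolding kobayashi_metric_def
  by (rule cInf_lower) (use assms in \<open>auto intro!: bdd_belowI[where m = 0]\<close>)

lemma compact_funcset_cball:
  "compact {f :: 'i \<Rightarrow> complex. \<forall>i. cmod (f i) \<le> B i}"
proof -
  have "compactin (product_topology (\<lambda>i. euclidean) UNIV) (PiE UNIV (\<lambda>i. cball (0::complex) (B i)))"
    unfolding compactin_PiE by auto
  moreover have "PiE UNIV (\<lambda>i. cball (0::complex) (B i)) = {f. \<forall>i. cmod (f i) \<le> B i}"
    by (auto simp: PiE_def Pi_def)
  ultimately show ?thesis by (simp add: euclidean_product_topology)
qed

context dual_banach
begin

text \<open>Bounds of Schwarz-Pick type are not homogeneous in y, so they have to be tested on the
  unit ball of the predual.\<close>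

lemma norm_le_J_unit:
  assumes K: "0 \<le> K" and le: "\<And>y. norm y \<le> 1 \<Longrightarrow> cmod (J x y) \<le> K"
  shows "norm x \<le> K"
proof (rule norm_le_J)
  fix y
  show "cmod (J x y) \<le> K * norm y"
  proof (cases "y = 0")
    case True
    thus ?thesis using J_le[of x y] by simp
  next
    case False
    have "J x (y /\<^sub>R norm y) = J x y /\<^sub>R norm y"
      using J_bounded_linear by (simp add: linear_simps)
    hence "cmod (J x y) / norm y \<le> K"
      using le[of "y /\<^sub>R norm y"] False by (simp add: divide_inverse mult.commute)
    thus ?thesis using False by (simp add: pos_divide_le_eq)
  qed
qed (rule K)

lemma holomorphic_maps_J:
  fixes f :: "complex \<Rightarrow> 'a"
  assumes "f \<in> holomorphic_maps S D"
  shows "(\<lambda>z. J (f z) y) holomorphic_on S"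
  unfolding holomorphic_on_def field_differentiable_def
  using has_field_derivative_J[OF holomorphic_mapsD(1)[OF assms]]
  by (blast intro: has_field_derivative_at_within)

lemma deriv_J:
  fixes f :: "complex \<Rightarrow> 'a"
  assumes "f \<in> holomorphic_maps S D" "z \<in> S"
  shows "deriv (\<lambda>z. J (f z) y) z = J (complex_deriv f z) y"
  using has_field_derivative_J[OF holomorphic_mapsD(1)[OF assms]] DERIV_imp_deriv by blast

lemma holomorphic_maps_estimates:
  fixes f :: "complex \<Rightarrow> 'a"
  assumes f: "f \<in> holomorphic_maps S D" and R: "0 < R" "ball z R \<subseteq> S"
    and M: "\<And>w. w \<in> ball z R \<Longrightarrow> norm (f w) \<le> M"
  shows "norm (complex_deriv f z) \<le> 2 * M / R"
    and "cmod (w - z) < R / 2 \<Longrightarrow> norm (f w - f z - (w - z) *\<^sub>C complex_deriv f z)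
      \<le> 32 * M / R\<^sup>2 * (cmod (w - z))\<^sup>2"
proof -
  have z: "z \<in> S" using R by auto
  have hol: "(\<lambda>z. J (f z) y) holomorphic_on ball z R" for y
    using holomorphic_maps_J[OF f] R(2) holomorphic_on_subset by blast
  obtain v where v: "has_complex_derivative f v z" and
    est: "\<And>w. cmod (w - z) < R / 2 \<Longrightarrow> norm (f w - f z - (w - z) *\<^sub>C v)
      \<le> 32 * M / R\<^sup>2 * (cmod (w - z))\<^sup>2"
    using has_complex_derivative_weakI[OF R(1) M hol] by blast
  show "cmod (w - z) < R / 2 \<Longrightarrow> norm (f w - f z - (w - z) *\<^sub>C complex_deriv f z)
      \<le> 32 * M / R\<^sup>2 * (cmod (w - z))\<^sup>2"
    using est complex_deriv_eqI[OF v] by simp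
  have M0: "0 \<le> M" using M[of z] R norm_ge_zero order_trans by (metis centre_in_ball)
  show "norm (complex_deriv f z) \<le> 2 * M / R"
  proof (rule norm_le_J)
    fix y
    have "cmod (deriv (\<lambda>z. J (f z) y) z) \<le> 2 * (M * norm y) / R"
    proof (rule holomorphic_deriv_bound[OF hol R(1)])
      show "cmod (J (f w) y) \<le> M * norm y" if "w \<in> ball z R" for w
        using J_le[of "f w" y] M[OF that] by (meson mult_right_mono norm_ge_zero order_trans)
    qed
    thus "cmod (J (complex_deriv f z) y) \<le> 2 * M / R * norm y"
      using deriv_J[OF f z] by simp
  qed (use M0 R in simp)
qed

text \<open>The bound depends on f only through \<open>norm (f 0)\<close> and is therefore uniform
  over all discs with a common centre. This keeps a weak-* limit of such discs in the open ball,
  where mere passage to the limit would give the closed one.\<close>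

lemma norm_disc_bound:
  fixes f :: "complex \<Rightarrow> 'a"
  assumes f: "f \<in> holomorphic_maps (ball 0 1) (ball 0 1)" and z: "cmod z < 1"
  shows "norm (f z) \<le> sqrt (1 - (1 - (cmod z)\<^sup>2) * (1 - norm (f 0)) / 2)"
proof (rule norm_le_J_unit)
  have lt: "norm (f w) < 1" if "cmod w < 1" for w
    using holomorphic_mapsD(2)[OF f, of w] that by simp
  have bd: "cmod (J (f w) y) \<le> norm (f w)" if "norm y \<le> 1" for w y
    using J_le[of "f w" y] that by (meson mult_left_le norm_ge_zero order_trans)
  show "cmod (J (f z) y) \<le> sqrt (1 - (1 - (cmod z)\<^sup>2) * (1 - norm (f 0)) / 2)"
    if y: "norm y \<le> 1" for y
  proof (rule real_le_rsqrt, rule schwarz_pick_bound[OF holomorphic_maps_J[OF f] _ _ z])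
    show "cmod (J (f w) y) < 1" if "cmod w < 1" for w
      using bd[OF y, of w] lt[OF that] by simp
    show "cmod (J (f 0) y) \<le> norm (f 0)" using bd[OF y] .
  qed
  have "(1 - (cmod z)\<^sup>2) * (1 - norm (f 0)) \<le> 1 * 1"
    using z lt[of 0] by (intro mult_mono) (auto simp: abs_square_le_1)
  thus "0 \<le> sqrt (1 - (1 - (cmod z)\<^sup>2) * (1 - norm (f 0)) / 2)" by simp
qed

lemma norm_disc_deriv_bound:
  fixes f :: "complex \<Rightarrow> 'a"
  assumes f: "f \<in> holomorphic_maps (ball 0 1) (ball 0 1)" and z: "cmod z < 1"
  shows "norm (complex_deriv f z) \<le> 2 / (1 - cmod z)"
proof -
  have sub: "ball z (1 - cmod z) \<subseteq> ball 0 1"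
    by (rule ball_subset_unit_disc)
  have "norm (complex_deriv f z) \<le> 2 * 1 / (1 - cmod z)"
  proof (rule holomorphic_maps_estimates(1)[OF f _ sub])
    show "norm (f w) \<le> 1" if "w \<in> ball z (1 - cmod z)" for w
      using holomorphic_mapsD(2)[OF f, of w] sub that by auto
  qed (use z in simp)
  thus ?thesis by simp
qed

text \<open>Banach-Alaoglu for a whole family at once: the numbers \<open>J (\<Psi> m i) y\<close>
  lie in a product of closed discs, compact by Tychonoff. For a nonseparable predual no subsequence
  need converge, so the limit is taken along one filter finer than \<open>sequentially\<close>,
  common to all i and y.\<close>

lemma weak_star_cluster:
  fixes \<Psi> :: "nat \<Rightarrow> 'i \<Rightarrow> 'a"
  assumes B: "\<And>m i. norm (\<Psi> m i) \<le> B i"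
  obtains G \<Phi> where "G \<noteq> bot" "G \<le> sequentially"
    "\<And>i y. ((\<lambda>m. J (\<Psi> m i) y) \<longlongrightarrow> J (\<Phi> i) y) G"
proof -
  define K where "K = {f :: 'i \<times> 'b \<Rightarrow> complex. \<forall>p. cmod (f p) \<le> B (fst p) * norm (snd p)}"
  define X where "X m = (\<lambda>p. J (\<Psi> m (fst p)) (snd p))" for m
  have "X m \<in> K" for m
    unfolding K_def X_def using order_trans[OF J_le mult_right_mono[OF B norm_ge_zero]] by blast
  hence "eventually (\<lambda>x. x \<in> K) (filtermap X sequentially)" by (simp add: eventually_filtermap)
  moreover have "compact K" unfolding K_def by (rule compact_funcset_cball)
  moreover have "filtermap X sequentially \<noteq> bot" by (simp add: filtermap_bot_iff)
  ultimately obtain l where l: "l \<in> K" "inf (nhds l) (filtermap X sequentially) \<noteq> bot"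
    unfolding compact_filter by blast
  \<comment> \<open>The cluster point lives on the image filter under \<open>X\<close>; pulling back
    its neighbourhoods yields a filter on the indices m.\<close>
  define G where "G = inf (filtercomap X (nhds l)) sequentially"
  have G: "G \<noteq> bot"
  proof
    assume "G = bot"
    hence "eventually (\<lambda>_. False) G" by simp
    then obtain P Q where P: "eventually P (filtercomap X (nhds l))" and Q: "eventually Q sequentially"
      and PQ: "\<And>m. P m \<Longrightarrow> Q m \<Longrightarrow> False"
      unfolding G_def eventually_inf by blast
    from P obtain P' where P': "eventually P' (nhds l)" "\<And>m. P' (X m) \<Longrightarrow> P m"
      unfolding eventually_filtercomap by blast
    have "eventually (\<lambda>x. \<not> P' x) (filtermap X sequentially)"
      unfolding eventually_filtermap using Q by eventually_elim (use PQ P' in blast)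
    hence "eventually (\<lambda>_. False) (inf (nhds l) (filtermap X sequentially))"
      using P'(1) unfolding eventually_inf by blast
    thus False using l(2) by (simp add: eventually_False)
  qed
  have "filterlim X (nhds l) (filtercomap X (nhds l))" by (rule filterlim_filtercomap)
  hence lim: "(X \<longlongrightarrow> l) G" unfolding G_def by (rule filterlim_mono) auto
  have lim_i: "((\<lambda>m. J (\<Psi> m i) y) \<longlongrightarrow> l (i, y)) G" for i y
  proof -
    have "((\<lambda>m. X m (i, y)) \<longlongrightarrow> l (i, y)) G"
      by (rule continuous_on_tendsto_compose[OF continuous_on_product_coordinates lim]) auto
    thus ?thesis by (simp add: X_def)
  qed
  have "\<exists>x. \<forall>y. J x y = l (i, y)" for i
  proof -
    obtain x where "\<And>y. J x y = l (i, y)"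
    proof (rule functional_ex[where l = "\<lambda>y. l (i, y)" and K = "B i"])
      show "l (i, y + y') = l (i, y) + l (i, y')" for y y'
        using tendsto_add[OF lim_i lim_i, of i y i y'] lim_i[of i "y + y'"] G
        unfolding J_add_right[symmetric] using tendsto_unique by blast
      show "l (i, c *\<^sub>C y) = c * l (i, y)" for c y
        using tendsto_mult_left[OF lim_i, of c i y] lim_i[of i "c *\<^sub>C y"] G
        unfolding J_scaleC_right[symmetric] using tendsto_unique by blast
      show "cmod (l (i, y)) \<le> B i * norm y" for y
        using l(1) unfolding K_def by auto
    qed blast
    thus ?thesis by blast
  qed
  then obtain \<Phi> where "\<And>i y. J (\<Phi> i) y = l (i, y)" by metis
  with lim_i have "\<And>i y. ((\<lambda>m. J (\<Psi> m i) y) \<longlongrightarrow> J (\<Phi> i) y) G" by simp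
  moreover have "G \<le> sequentially" unfolding G_def by simp
  ultimately show thesis using that G by blast
qed

lemma weak_star_norm_le:
  fixes a :: "nat \<Rightarrow> 'a"
  assumes G: "G \<noteq> bot" and lim: "\<And>y. ((\<lambda>m. J (a m) y) \<longlongrightarrow> J b y) G"
    and le: "\<And>m::nat. norm (a m) \<le> K"
  shows "norm b \<le> K"
proof (rule norm_le_J)
  fix y
  have "cmod (J (a m) y) \<le> K * norm y" for m
    using J_le[of "a m" y] le[of m] by (meson mult_right_mono norm_ge_zero order_trans)
  thus "cmod (J b y) \<le> K * norm y"
    by (intro tendsto_upperbound[OF tendsto_norm[OF lim] _ G]) auto
  show "0 \<le> K" using le[of 0] norm_ge_zero order_trans by blast
qed

text \<open>This is where duality enters: the unit ball is weak-* compact, so a minimising sequence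
  of discs has a cluster point.\<close>

lemma extremal_disc_ex:
  fixes x v :: 'a
  assumes x: "norm x < 1" and v: "v \<noteq> 0"
  obtains \<phi> where "0 < kobayashi_metric (ball 0 1) x v"
    "\<phi> \<in> holomorphic_maps (ball 0 1) (ball 0 1)" "\<phi> 0 = x"
    "kobayashi_metric (ball 0 1) x v *\<^sub>R complex_deriv \<phi> 0 = v"
proof -
  let ?D = "ball (0::'a) 1"
  define k where "k = kobayashi_metric ?D x v"
  define E where "E = {\<eta>. \<eta> > 0 \<and>
       (\<exists>f\<in>holomorphic_maps (ball 0 1) ?D. f 0 = x \<and> \<eta> *\<^sub>R complex_deriv f 0 = v)}"
  have k: "k = Inf E" unfolding k_def E_def kobayashi_metric_def ..
  have E_ge: "norm v / 2 \<le> \<eta>" if "\<eta> \<in> E" for \<eta>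
  proof -
    from that obtain f where "\<eta> > 0" "f \<in> holomorphic_maps (ball 0 1) ?D" "\<eta> *\<^sub>R complex_deriv f 0 = v"
      unfolding E_def by auto
    moreover have "norm v = \<eta> * norm (complex_deriv f 0)" using calculation by auto
    ultimately show ?thesis using norm_disc_deriv_bound[of f 0] by simp
  qed
  have "E \<noteq> {}"
  proof -
    \<comment> \<open>With this value the affine disc through x in direction v moves away from x by
      less than \<open>1 - norm x\<close>.\<close>
    define \<eta> where "\<eta> = norm v / (1 - norm x)"
    have \<eta>: "0 < \<eta>" unfolding \<eta>_def using x v by simp
    let ?f = "\<lambda>z. x + z *\<^sub>C (v /\<^sub>R \<eta>)"
    have d: "has_complex_derivative ?f (v /\<^sub>R \<eta>) z" for z
      using has_complex_derivative_add[OF has_complex_derivative_const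
        has_complex_derivative_ident_scaleC, of x "v /\<^sub>R \<eta>"] by simp
    have "?f \<in> holomorphic_maps (ball 0 1) ?D"
      unfolding holomorphic_maps_def
    proof (intro CollectI conjI ballI image_subsetI)
      fix z :: complex assume z: "z \<in> ball 0 1"
      show "\<exists>w. has_complex_derivative ?f w z" using d by blast
      have "norm (?f z) \<le> norm x + cmod z * (norm v / \<eta>)"
        using norm_triangle_ineq[of x "z *\<^sub>C (v /\<^sub>R \<eta>)"] \<eta> by (simp add: norm_scaleC divide_inverse mult.commute)
      also have "norm v / \<eta> = 1 - norm x" unfolding \<eta>_def using x v by simp
      also have "norm x + cmod z * (1 - norm x) < norm x + 1 * (1 - norm x)"
        using z x by (intro add_strict_left_mono mult_strict_right_mono) auto
      finally show "?f z \<in> ?D" by simp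
    qed
    hence "\<eta> \<in> E" unfolding E_def using \<eta> complex_deriv_eqI[OF d] by (auto intro!: bexI[of _ ?f])
    thus ?thesis by auto
  qed
  have "norm v / 2 \<le> k" unfolding k using E_ge \<open>E \<noteq> {}\<close> by (intro cInf_greatest) auto
  hence k0: "0 < k" using v by (smt (verit) zero_less_norm_iff half_gt_zero)
  have "\<exists>\<eta>\<in>E. \<eta> < k + 1 / real (Suc m)" for m
    unfolding k using \<open>E \<noteq> {}\<close> by (intro cInf_lessD) auto
  then obtain \<eta> where \<eta>: "\<And>m. \<eta> m \<in> E" "\<And>m. \<eta> m < k + 1 / real (Suc m)" by metis
  have ge: "k \<le> \<eta> m" for m
    unfolding k using \<eta>(1) bdd_belowI[OF E_ge] by (rule cInf_lower)
  have \<eta>_lim: "\<eta> \<longlonglongrightarrow> k"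
  proof (rule tendsto_sandwich[where f = "\<lambda>_. k" and h = "\<lambda>m. k + 1 / real (Suc m)"])
    show "(\<lambda>m. k + 1 / real (Suc m)) \<longlonglongrightarrow> k"
      using tendsto_add[OF tendsto_const LIMSEQ_inverse_real_of_nat, of k] by (simp add: inverse_eq_divide)
  qed (use ge \<eta>(2) in \<open>auto intro!: always_eventually less_imp_le\<close>)
  have "\<forall>m. \<exists>f. f \<in> holomorphic_maps (ball 0 1) ?D \<and> f 0 = x \<and> \<eta> m *\<^sub>R complex_deriv f 0 = v"
    using \<eta>(1) unfolding E_def by auto
  then obtain F where F: "\<And>m. F m \<in> holomorphic_maps (ball 0 1) ?D" "\<And>m. F m 0 = x"
    "\<And>m. \<eta> m *\<^sub>R complex_deriv (F m) 0 = v" by metis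
  \<comment> \<open>Derivatives are indexed together with values, so that both converge along the
    same filter. The value 0 off the disc is a default that provides a bound independent of m at
    every index.\<close>
  define \<Psi> where "\<Psi> m p = (if cmod (fst p) < 1 then if snd p then complex_deriv (F m) (fst p)
    else F m (fst p) else 0)" for m p
  have F1: "norm (F m z) < 1" if "cmod z < 1" for m z
    using holomorphic_mapsD(2)[OF F(1)] that by fastforce
  have \<Psi>_le: "norm (\<Psi> m p) \<le> max 1 (2 / (1 - cmod (fst p)))" for m p
    using norm_disc_deriv_bound[OF F(1), of "fst p" m] F1[of "fst p" m] unfolding \<Psi>_def
    by (auto simp: le_max_iff_disj less_imp_le)
  obtain G \<Phi> where G: "G \<noteq> bot" "G \<le> sequentially"
    and lim: "\<And>i y. ((\<lambda>m. J (\<Psi> m i) y) \<longlongrightarrow> J (\<Phi> i) y) G"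
    by (rule weak_star_cluster[of \<Psi>, OF \<Psi>_le]) blast
  define \<phi> where "\<phi> z = \<Phi> (z, False)" for z
  define d where "d z = \<Phi> (z, True)" for z
  have lim_F: "((\<lambda>m. J (F m z) y) \<longlongrightarrow> J (\<phi> z) y) G"
    and lim_d: "((\<lambda>m. J (complex_deriv (F m) z) y) \<longlongrightarrow> J (d z) y) G" if "cmod z < 1" for z y
    using lim[of "(z, False)" y] lim[of "(z, True)" y] that unfolding \<phi>_def d_def \<Psi>_def by simp_all
  have \<phi>0: "\<phi> 0 = x"
  proof (rule J_inject)
    show "J (\<phi> 0) y = J x y" for y
      using lim_F[of 0 y] F(2) G(1) by (simp add: tendsto_const_iff)
  qed
  have deriv: "has_complex_derivative \<phi> (d z) z" if z: "cmod z < 1" for z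
  proof -
    define R where "R = 1 - cmod z"
    have R: "0 < R" using z unfolding R_def by simp
    have sub: "ball z R \<subseteq> ball 0 1"
      unfolding R_def by (rule ball_subset_unit_disc)
    \<comment> \<open>The remainder estimate for \<open>F m\<close> does not depend on m and passes
      to weak-* limits, so \<open>\<phi>\<close> is differentiable in norm, with derivative the
      limit \<open>d z\<close> of the derivatives.\<close>
    show ?thesis
    proof (rule has_complex_derivative_quadraticI[where d = "R / 2" and C = "32 * 1 / R\<^sup>2"])
      fix w assume w: "cmod (w - z) < R / 2"
      have w1: "cmod w < 1" using w sub R by (auto simp: dist_norm norm_minus_commute subset_iff)
      show "norm (\<phi> w - \<phi> z - (w - z) *\<^sub>C d z) \<le> 32 * 1 / R\<^sup>2 * (cmod (w - z))\<^sup>2"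
      proof (rule weak_star_norm_le[OF G(1)])
        show "((\<lambda>m. J (F m w - F m z - (w - z) *\<^sub>C complex_deriv (F m) z) y)
          \<longlongrightarrow> J (\<phi> w - \<phi> z - (w - z) *\<^sub>C d z) y) G" for y
          unfolding J_simps by (intro tendsto_intros lim_F lim_d z w1)
        show "norm (F m w - F m z - (w - z) *\<^sub>C complex_deriv (F m) z) \<le> 32 * 1 / R\<^sup>2 * (cmod (w - z))\<^sup>2" for m
          by (rule holomorphic_maps_estimates(2)[OF F(1) R sub _ w])
            (use F1 sub in \<open>auto intro!: less_imp_le\<close>)
      qed
    qed (use R in simp)
  qed
  have lt1: "norm (\<phi> z) < 1" if z: "cmod z < 1" for z
  proof -
    have "norm (\<phi> z) \<le> sqrt (1 - (1 - (cmod z)\<^sup>2) * (1 - norm x) / 2)"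
      using norm_disc_bound[OF F(1) z] F(2) by (intro weak_star_norm_le[OF G(1) lim_F[OF z]]) simp
    also have "\<dots> < 1" using z x by (simp add: abs_square_less_1)
    finally show ?thesis .
  qed
  have "\<phi> \<in> holomorphic_maps (ball 0 1) ?D"
    unfolding holomorphic_maps_def using deriv lt1 by fastforce
  moreover have "k *\<^sub>R complex_deriv \<phi> 0 = v"
  proof (rule J_inject)
    fix y
    have "((\<lambda>m. of_real (\<eta> m) * J (complex_deriv (F m) 0) y) \<longlongrightarrow> of_real k * J (d 0) y) G"
      using \<eta>_lim G(2) by (intro tendsto_mult tendsto_of_real lim_d) (auto intro: tendsto_mono)
    moreover have "of_real (\<eta> m) * J (complex_deriv (F m) 0) y = J v y" for m
      using F(3)[of m] by (metis J_scaleR)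
    ultimately have "of_real k * J (d 0) y = J v y"
      using G(1) by (simp add: tendsto_const_iff)
    thus "J (k *\<^sub>R complex_deriv \<phi> 0) y = J v y"
      using complex_deriv_eqI[OF deriv[of 0]] by (simp add: J_scaleR)
  qed
  ultimately show thesis using that k0 \<phi>0 unfolding k_def by blast
qed

end

section \<open>Regularity of the Kobayashi metric\<close>

lemma holomorphic_lipschitz:
  assumes h: "h holomorphic_on ball 0 R" and M: "\<And>z. z \<in> ball 0 R \<Longrightarrow> cmod (h z) \<le> M"
    and z: "cmod z < R / 2" "cmod w < R / 2"
  shows "cmod (h z - h w) \<le> 4 * M / R * cmod (z - w)"
proof -
  have R: "0 < R" using z norm_ge_zero[of z] by linarith
  show ?thesis
  proof (rule field_differentiable_bound[where S = "ball 0 (R / 2)" and f' = "deriv h"])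
    fix x :: complex assume x: "x \<in> ball 0 (R / 2)"
    show "(h has_field_derivative deriv h x) (at x within ball 0 (R / 2))"
      using holomorphic_derivI[OF h, of x] x R by (auto intro: has_field_derivative_at_within)
    have sub: "ball x (R / 2) \<subseteq> ball 0 R"
    proof
      fix w assume "w \<in> ball x (R / 2)"
      thus "w \<in> ball 0 R" using x norm_triangle_sub[of w x] by (simp add: dist_norm norm_minus_commute)
    qed
    have "cmod (deriv h x) \<le> 2 * M / (R / 2)"
      using h M sub R by (intro holomorphic_deriv_bound holomorphic_on_subset[OF h sub]) auto
    thus "cmod (deriv h x) \<le> 4 * M / R" by simp
  qed (use z R in auto)
qed

context dual_banach
begin

lemma kobayashi_metric_ge:
  fixes x v :: 'a
  assumes "norm x < 1" "v \<noteq> 0"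
  shows "norm v / 2 \<le> kobayashi_metric (ball 0 1) x v"
proof -
  obtain \<phi> where k: "0 < kobayashi_metric (ball 0 1) x v"
    and \<phi>: "\<phi> \<in> holomorphic_maps (ball 0 1) (ball 0 1)" "\<phi> 0 = x"
    "kobayashi_metric (ball 0 1) x v *\<^sub>R complex_deriv \<phi> 0 = v"
    using extremal_disc_ex[OF assms] .
  have "norm v = kobayashi_metric (ball 0 1) x v * norm (complex_deriv \<phi> 0)"
    using \<phi>(3) k by (metis abs_of_pos norm_scaleR)
  also have "\<dots> \<le> kobayashi_metric (ball 0 1) x v * 2"
    using norm_disc_deriv_bound[OF \<phi>(1), of 0] k by (intro mult_left_mono) auto
  finally show ?thesis by simp
qed

lemma kobayashi_metric_scaleR:
  fixes x v :: 'a
  assumes x: "norm x < 1" and v: "v \<noteq> 0" and c: "0 < c"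
  shows "kobayashi_metric (ball 0 1) x (c *\<^sub>R v) = c * kobayashi_metric (ball 0 1) x v"
proof -
  have le: "kobayashi_metric (ball 0 1) x (c *\<^sub>R v) \<le> c * kobayashi_metric (ball 0 1) x v"
    if v: "v \<noteq> 0" and c: "0 < c" for v :: 'a and c
  proof -
    obtain \<phi> where "0 < kobayashi_metric (ball 0 1) x v"
      and "\<phi> \<in> holomorphic_maps (ball 0 1) (ball 0 1)" "\<phi> 0 = x"
      "kobayashi_metric (ball 0 1) x v *\<^sub>R complex_deriv \<phi> 0 = v"
      using extremal_disc_ex[OF x v] .
    thus ?thesis
      using c by (intro kobayashi_metric_le) (auto simp flip: scaleR_scaleR)
  qed
  have "kobayashi_metric (ball 0 1) x (inverse c *\<^sub>R (c *\<^sub>R v))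
      \<le> inverse c * kobayashi_metric (ball 0 1) x (c *\<^sub>R v)"
    using v c by (intro le) auto
  hence "c * kobayashi_metric (ball 0 1) x v \<le> kobayashi_metric (ball 0 1) x (c *\<^sub>R v)"
    using c by (simp add: field_simps)
  with le[OF v c] show ?thesis by simp
qed

text \<open>An approximate disc is turned into a true one. Correcting its 1-jet at 0 by an affine
  term costs 2 \<epsilon> in norm; the result, of size below 1 + 3 \<epsilon>, is shrunk towards x
  by the factor s with (1 - s) * norm x + s * (1 + 3 \<epsilon>) = 1. The speed drops from \<mu> to
  s \<mu>, whence the bound 1 / (s \<mu>).\<close>

lemma kobayashi_metric_perturb:
  fixes \<Phi> :: "complex \<Rightarrow> 'a"
  assumes \<Phi>: "\<Phi> \<in> holomorphic_maps (ball 0 1) (ball 0 (1 + \<epsilon>))" and \<epsilon>: "0 \<le> \<epsilon>"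
    and x: "norm x < 1" "norm (\<Phi> 0 - x) \<le> \<epsilon>"
    and v: "norm (complex_deriv \<Phi> 0 - \<mu> *\<^sub>R v) \<le> \<epsilon>" and \<mu>: "0 < \<mu>"
  shows "kobayashi_metric (ball 0 1) x v \<le> (1 + 3 * \<epsilon> / (1 - norm x)) / \<mu>"
proof -
  define d where "d = 1 - norm x"
  define s where "s = d / (d + 3 * \<epsilon>)"
  have d: "0 < d" using x(1) unfolding d_def by simp
  have s: "0 < s" "s \<le> 1" "s * (d + 3 * \<epsilon>) = d" "1 / s = 1 + 3 * \<epsilon> / d"
    using d \<epsilon> unfolding s_def by (auto simp: field_simps)
  let ?w = "complex_deriv \<Phi> 0"
  let ?\<phi> = "\<lambda>z. x + of_real s *\<^sub>C (\<Phi> z + (- \<Phi> 0) + z *\<^sub>C (\<mu> *\<^sub>R v - ?w))"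
  have der: "has_complex_derivative ?\<phi> (0 + of_real s *\<^sub>C (complex_deriv \<Phi> z + 0 + (\<mu> *\<^sub>R v - ?w))) z"
    if "z \<in> ball 0 1" for z
    by (intro has_complex_derivative_add has_complex_derivative_scaleC has_complex_derivative_const
        has_complex_derivative_ident_scaleC holomorphic_mapsD(1)[OF \<Phi> that])
  have "?\<phi> \<in> holomorphic_maps (ball 0 1) (ball 0 1)"
    unfolding holomorphic_maps_def
  proof (intro CollectI conjI ballI image_subsetI)
    fix z :: complex assume z: "z \<in> ball 0 1"
    show "\<exists>w. has_complex_derivative ?\<phi> w z" using der[OF z] by blast
    have "?\<phi> z = (1 - s) *\<^sub>R x + s *\<^sub>R (\<Phi> z + (x - \<Phi> 0) + z *\<^sub>C (\<mu> *\<^sub>R v - ?w))"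
      by (simp add: scaleC_of_real algebra_simps)
    also have "norm \<dots> \<le> (1 - s) * norm x + s * (norm (\<Phi> z) + norm (x - \<Phi> 0) + cmod z * norm (\<mu> *\<^sub>R v - ?w))"
    proof (intro order_trans[OF norm_triangle_ineq] add_mono)
      show "norm ((1 - s) *\<^sub>R x) \<le> (1 - s) * norm x" using s by simp
      have "norm (\<Phi> z + (x - \<Phi> 0) + z *\<^sub>C (\<mu> *\<^sub>R v - ?w))
          \<le> norm (\<Phi> z) + norm (x - \<Phi> 0) + cmod z * norm (\<mu> *\<^sub>R v - ?w)"
        by (smt (verit) norm_triangle_ineq norm_scaleC)
      thus "norm (s *\<^sub>R (\<Phi> z + (x - \<Phi> 0) + z *\<^sub>C (\<mu> *\<^sub>R v - ?w)))
          \<le> s * (norm (\<Phi> z) + norm (x - \<Phi> 0) + cmod z * norm (\<mu> *\<^sub>R v - ?w))"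
        using s by simp
    qed
    also have "\<dots> < (1 - s) * norm x + s * ((1 + \<epsilon>) + \<epsilon> + 1 * \<epsilon>)"
    proof (intro add_strict_left_mono mult_strict_left_mono add_less_le_mono mult_mono)
      show "norm (\<Phi> z) < 1 + \<epsilon>" using holomorphic_mapsD(2)[OF \<Phi> z] by simp
    qed (use x v z s \<epsilon> in \<open>auto simp: norm_minus_commute\<close>)
    also have "\<dots> = norm x + s * (d + 3 * \<epsilon>)" unfolding d_def by (simp add: algebra_simps)
    also have "\<dots> = 1" using s(3) unfolding d_def by simp
    finally show "?\<phi> z \<in> ball 0 1" by simp
  qed
  moreover have "complex_deriv ?\<phi> 0 = (s * \<mu>) *\<^sub>R v"
    using complex_deriv_eqI[OF der[of 0]] by (simp add: scaleC_of_real)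
  ultimately have "kobayashi_metric (ball 0 1) x v \<le> 1 / (s * \<mu>)"
    using s \<mu> by (intro kobayashi_metric_le[where \<phi> = ?\<phi>]) auto
  also have "\<dots> = (1 + 3 * \<epsilon> / (1 - norm x)) / \<mu>"
    using s(4) unfolding d_def by (metis divide_divide_eq_left)
  finally show ?thesis .
qed

text \<open>The extremal disc of (x, v) serves as an approximate disc for (x', v'), with \<mu> = 1 /
  k. The error in the direction is measured relative to k because the disc has derivative v /
  k.\<close>

lemma kobayashi_metric_near:
  fixes x x' v v' :: 'a
  assumes x: "norm x < 1" "norm x' < 1" "v \<noteq> 0" and "norm (x - x') \<le> \<epsilon>"
    and v: "norm (v - v') \<le> \<epsilon> * kobayashi_metric (ball 0 1) x v"
  shows "kobayashi_metric (ball 0 1) x' v' \<le> (1 + 3 * \<epsilon> / (1 - norm x')) * kobayashi_metric (ball 0 1) x v"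
proof -
  let ?k = "kobayashi_metric (ball 0 1) x v"
  obtain \<phi> where k: "0 < ?k" and \<phi>: "\<phi> \<in> holomorphic_maps (ball 0 1) (ball 0 1)" "\<phi> 0 = x"
    "?k *\<^sub>R complex_deriv \<phi> 0 = v"
    using extremal_disc_ex[OF x(1,3)] .
  have \<epsilon>: "0 \<le> \<epsilon>" using assms(4) norm_ge_zero order_trans by blast
  have "(1 / ?k) *\<^sub>R v = (1 / ?k) *\<^sub>R (?k *\<^sub>R complex_deriv \<phi> 0)" by (simp only: \<phi>(3))
  hence "complex_deriv \<phi> 0 = (1 / ?k) *\<^sub>R v" using k by simp
  hence "norm (complex_deriv \<phi> 0 - (1 / ?k) *\<^sub>R v') = norm (v - v') / ?k"
    using k by (simp flip: scaleR_diff_right)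
  also have "\<dots> \<le> \<epsilon>" using v k by (simp add: pos_divide_le_eq)
  finally have "kobayashi_metric (ball 0 1) x' v' \<le> (1 + 3 * \<epsilon> / (1 - norm x')) / (1 / ?k)"
    using \<phi> \<epsilon> x assms(4) k
    by (intro kobayashi_metric_perturb[where \<Phi> = \<phi>]) (auto simp: holomorphic_maps_def)
  thus ?thesis by simp
qed

text \<open>The disc automorphism \<open>g\<close> takes 0 to w with derivative
  \<open>1 - (cmod w)\<^sup>2\<close>, so \<phi> re-centred at w is a competitor.\<close>

lemma kobayashi_metric_moebius:
  fixes \<phi> :: "complex \<Rightarrow> 'a"
  assumes \<phi>: "\<phi> \<in> holomorphic_maps (ball 0 1) D" and w: "cmod w < 1"
  shows "kobayashi_metric D (\<phi> w) (complex_deriv \<phi> w) \<le> 1 / (1 - (cmod w)\<^sup>2)"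
proof -
  define g where "g z = (z + w) / (1 + cnj w * z)" for z
  have w2: "(cmod w)\<^sup>2 < 1" using w by (simp add: abs_square_less_1)
  have nz: "1 + cnj w * z \<noteq> 0" if z: "cmod z < 1" for z
  proof
    assume "1 + cnj w * z = 0"
    hence "cmod (cnj w * z) = 1" by (metis add_eq_0_iff norm_minus_cancel norm_one)
    moreover have "cmod w * cmod z < 1 * 1" using w z by (intro mult_strict_mono') auto
    ultimately show False by (simp add: norm_mult)
  qed
  have g1: "cmod (g z) < 1" if z: "cmod z < 1" for z
  proof -
    have "(cmod (1 + cnj w * z))\<^sup>2 - (cmod (z + w))\<^sup>2 = (1 - (cmod w)\<^sup>2) * (1 - (cmod z)\<^sup>2)"
      unfolding cmod_power2 by (simp add: algebra_simps power2_eq_square)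
    moreover have "0 < (1 - (cmod w)\<^sup>2) * (1 - (cmod z)\<^sup>2)"
      using w z by (simp add: abs_square_less_1)
    ultimately have "(cmod (z + w))\<^sup>2 < (cmod (1 + cnj w * z))\<^sup>2" by simp
    hence "cmod (z + w) < cmod (1 + cnj w * z)" by (simp add: power2_less_imp_less)
    thus ?thesis unfolding g_def norm_divide using nz[OF z] by (subst pos_divide_less_eq) simp_all
  qed
  have dg: "\<exists>e. (g has_field_derivative e) (at z)" if "cmod z < 1" for z
    unfolding g_def using nz[OF that] by (auto intro!: exI derivative_eq_intros)
  have dg0: "(g has_field_derivative of_real (1 - (cmod w)\<^sup>2)) (at 0)"
    unfolding g_def
    by (auto intro!: derivative_eq_intros simp: complex_norm_square[symmetric] mult.commute[of "cnj w"] simp del: of_real_power)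
  have der: "has_complex_derivative (\<lambda>z. \<phi> (g z)) (e *\<^sub>C complex_deriv \<phi> (g z)) z"
    if "cmod z < 1" "(g has_field_derivative e) (at z)" for z e
    using that g1 by (intro has_complex_derivative_chain holomorphic_mapsD(1)[OF \<phi>]) auto
  have "(\<lambda>z. \<phi> (g z)) \<in> holomorphic_maps (ball 0 1) D"
    unfolding holomorphic_maps_def
  proof (intro CollectI conjI ballI image_subsetI)
    fix z :: complex assume "z \<in> ball 0 1"
    hence z: "cmod z < 1" by simp
    show "\<exists>v. has_complex_derivative (\<lambda>z. \<phi> (g z)) v z" using der[OF z] dg[OF z] by blast
    show "\<phi> (g z) \<in> D" using holomorphic_mapsD(2)[OF \<phi>, of "g z"] g1[OF z] by simp
  qed
  moreover have "complex_deriv (\<lambda>z. \<phi> (g z)) 0 = (1 - (cmod w)\<^sup>2) *\<^sub>R complex_deriv \<phi> w"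
    using complex_deriv_eqI[OF der[OF _ dg0]] by (simp add: scaleC_of_real g_def del: of_real_diff)
  ultimately show ?thesis
    using w2 by (intro kobayashi_metric_le[where \<phi> = "\<lambda>z. \<phi> (g z)"]) (auto simp: g_def)
qed

text \<open>Comparing nearby points gives a multiplicative Lipschitz bound as long as
  \<open>f z\<close> stays away from the unit sphere and its derivative away from 0. Continuity
  makes the circle integrals ordinary ones; the linear rate is what later bounds the interpolation
  exponent a independently of the radius.\<close>

lemma kobayashi_metric_log_lipschitz:
  fixes f :: "complex \<Rightarrow> 'a"
  assumes f: "f \<in> holomorphic_maps (ball 0 R) (ball 0 1)" and R: "0 < R" and v: "complex_deriv f 0 \<noteq> 0"
  obtains \<rho> L where "0 < \<rho>" "\<rho> \<le> R" "0 \<le> L" "\<And>z. cmod z < \<rho> \<Longrightarrow> complex_deriv f z \<noteq> 0"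
    "\<And>z w. cmod z < \<rho> \<Longrightarrow> cmod w < \<rho> \<Longrightarrow>
      \<bar>ln (kobayashi_metric (ball 0 1) (f z) (complex_deriv f z)) -
       ln (kobayashi_metric (ball 0 1) (f w) (complex_deriv f w))\<bar> \<le> L * cmod (z - w)"
proof -
  let ?k = "\<lambda>z. kobayashi_metric (ball 0 1) (f z) (complex_deriv f z)"
  let ?h = "\<lambda>y z. J (f z) y"
  define n where "n = norm (complex_deriv f 0)"
  define d where "d = 1 - norm (f 0)"
  have f1: "norm (f z) < 1" if "cmod z < R" for z
    using holomorphic_mapsD(2)[OF f, of z] that by simp
  have n: "0 < n" and d: "0 < d" using v f1[of 0] R unfolding n_def d_def by auto
  have hol: "?h y holomorphic_on ball 0 R" for y by (rule holomorphic_maps_J[OF f])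
  have hb: "cmod (?h y z) \<le> norm y" if "z \<in> ball 0 R" for y z
    using J_le[of "f z" y] f1[of z] that
    by (smt (verit) mem_ball_0 mult_left_le_one_le norm_ge_zero)
  have hdb: "cmod (deriv (?h y) z) \<le> 4 * norm y / R" if z: "z \<in> ball 0 (R / 2)" for y z
  proof -
    have sub: "ball z (R / 2) \<subseteq> ball 0 R"
    proof
      fix w assume "w \<in> ball z (R / 2)"
      thus "w \<in> ball 0 R" using z norm_triangle_sub[of w z] by (simp add: dist_norm norm_minus_commute)
    qed
    have "cmod (deriv (?h y) z) \<le> 2 * norm y / (R / 2)"
      using hb sub R by (intro holomorphic_deriv_bound holomorphic_on_subset[OF hol sub]) auto
    thus ?thesis by simp
  qed
  have lip: "norm (f z - f w) \<le> 4 / R * cmod (z - w)"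
    if "cmod z < R / 2" "cmod w < R / 2" for z w
  proof (rule norm_le_J)
    show "cmod (J (f z - f w) y) \<le> 4 / R * cmod (z - w) * norm y" for y
      using holomorphic_lipschitz[OF hol hb that, of y] by (simp add: J_diff mult_ac)
  qed (use R in simp)
  have lipd: "norm (complex_deriv f z - complex_deriv f w) \<le> 32 / R\<^sup>2 * cmod (z - w)"
    if "cmod z < R / 4" "cmod w < R / 4" for z w
  proof (rule norm_le_J)
    fix y
    have "cmod (deriv (?h y) z - deriv (?h y) w) \<le> 4 * (4 * norm y / R) / (R / 2) * cmod (z - w)"
      using that hdb R
      by (intro holomorphic_lipschitz holomorphic_deriv holomorphic_on_subset[OF hol]) auto
    also have "\<dots> = 32 / R\<^sup>2 * cmod (z - w) * norm y" by (simp add: power2_eq_square)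
    also have "deriv (?h y) z - deriv (?h y) w = J (complex_deriv f z - complex_deriv f w) y"
      using that R by (subst (1 2) deriv_J[OF f]) (auto simp: J_diff)
    finally show "cmod (J (complex_deriv f z - complex_deriv f w) y) \<le> 32 / R\<^sup>2 * cmod (z - w) * norm y" .
  qed simp
  \<comment> \<open>\<open>lipd\<close> is available up to R/4; the second bound keeps the norm of
    the derivative at least n/2, and the third keeps \<open>1 - norm (f z)\<close> at least
    d/2.\<close>
  define \<rho> where "\<rho> = min (R / 4) (min (n * R\<^sup>2 / 64) (d * R / 8))"
  \<comment> \<open>The second entry is 32/R^2 divided by n/4, the lower bound for the metric in
    \<open>kge\<close>.\<close>
  define A where "A = max (4 / R) (128 / (R\<^sup>2 * n))"
  have \<rho>: "0 < \<rho>" unfolding \<rho>_def using R n d by simp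
  have A: "0 \<le> A" unfolding A_def by (rule max.coboundedI1) (use R in simp)
  have big: "n / 2 \<le> norm (complex_deriv f z)" if z: "cmod z < \<rho>" for z
  proof -
    have "norm (complex_deriv f 0 - complex_deriv f z) \<le> 32 / R\<^sup>2 * cmod (0 - z)"
      using z R unfolding \<rho>_def by (intro lipd) auto
    also have "\<dots> \<le> 32 / R\<^sup>2 * (n * R\<^sup>2 / 64)"
      using z unfolding \<rho>_def by (intro mult_left_mono) auto
    also have "\<dots> = n / 2" using R by simp
    finally show ?thesis unfolding n_def using norm_triangle_ineq2[of "complex_deriv f 0" "complex_deriv f z"] by linarith
  qed
  have nz: "complex_deriv f z \<noteq> 0" if z: "cmod z < \<rho>" for z
    using big[OF z] n by auto
  have small: "d / 2 \<le> 1 - norm (f z)" if z: "cmod z < \<rho>" for z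
  proof -
    have "norm (f z - f 0) \<le> 4 / R * cmod (z - 0)"
      using z R unfolding \<rho>_def by (intro lip) auto
    also have "\<dots> \<le> 4 / R * (d * R / 8)"
      using z R unfolding \<rho>_def by (intro mult_left_mono) auto
    also have "\<dots> = d / 2" using R by simp
    finally show ?thesis unfolding d_def using norm_triangle_ineq2[of "f z" "f 0"] by (simp add: field_simps)
  qed
  have fz: "norm (f z) < 1" if "cmod z < \<rho>" for z
    using small[OF that] d by linarith
  have kge: "n / 4 \<le> ?k z" if z: "cmod z < \<rho>" for z
    using kobayashi_metric_ge[OF fz[OF z] nz[OF z]] big[OF z] by linarith
  have one: "ln (?k w) \<le> ln (?k z) + 6 * A / d * cmod (z - w)"
    if z: "cmod z < \<rho>" and w: "cmod w < \<rho>" for z w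
  proof -
    define \<epsilon> where "\<epsilon> = A * cmod (z - w)"
    have \<epsilon>: "0 \<le> \<epsilon>" unfolding \<epsilon>_def using A by simp
    have "norm (f z - f w) \<le> 4 / R * cmod (z - w)"
      using z w R unfolding \<rho>_def by (intro lip) auto
    also have "\<dots> \<le> \<epsilon>" unfolding \<epsilon>_def A_def by (intro mult_right_mono) auto
    finally have 1: "norm (f z - f w) \<le> \<epsilon>" .
    have "norm (complex_deriv f z - complex_deriv f w) \<le> 32 / R\<^sup>2 * cmod (z - w)"
      using z w R unfolding \<rho>_def by (intro lipd) auto
    also have "\<dots> = 128 / (R\<^sup>2 * n) * cmod (z - w) * (n / 4)" using n by simp
    also have "\<dots> \<le> \<epsilon> * ?k z"
      unfolding \<epsilon>_def A_def by (intro mult_mono mult_right_mono kge[OF z]) (use n R in \<open>auto simp: max_def\<close>)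
    finally have 2: "norm (complex_deriv f z - complex_deriv f w) \<le> \<epsilon> * ?k z" .
    have kz: "0 < ?k z" "0 < ?k w" using kge[OF z] kge[OF w] n by linarith+
    have "?k w \<le> (1 + 3 * \<epsilon> / (1 - norm (f w))) * ?k z"
      by (rule kobayashi_metric_near[OF fz[OF z] fz[OF w] nz[OF z] 1 2])
    also have "\<dots> \<le> (1 + 3 * \<epsilon> / (d / 2)) * ?k z"
      using small[OF w] d \<epsilon> kz by (intro mult_right_mono add_left_mono divide_left_mono) auto
    finally have "?k w \<le> (1 + 6 * \<epsilon> / d) * ?k z" by simp
    moreover have pos: "0 < 1 + 6 * \<epsilon> / d" using \<epsilon> d by (simp add: add_pos_nonneg)
    ultimately have "ln (?k w) \<le> ln ((1 + 6 * \<epsilon> / d) * ?k z)" using kz by simp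
    also have "\<dots> = ln (1 + 6 * \<epsilon> / d) + ln (?k z)" using pos kz by (simp add: ln_mult)
    also have "ln (1 + 6 * \<epsilon> / d) \<le> 6 * \<epsilon> / d" using \<epsilon> d by (intro ln_add_one_self_le_self) simp
    finally show ?thesis unfolding \<epsilon>_def by simp
  qed
  show thesis
  proof (rule that[of \<rho> "6 * A / d"])
    show "\<rho> \<le> R" unfolding \<rho>_def using R by auto
    fix z w assume zw: "cmod z < \<rho>" "cmod w < \<rho>"
    show "\<bar>ln (?k z) - ln (?k w)\<bar> \<le> 6 * A / d * cmod (z - w)"
      using one[OF zw] one[OF zw(2,1)] by (simp add: abs_le_iff norm_minus_commute)
  qed (use \<rho> A d nz in auto)
qed

end

section \<open>Averaging over three points\<close>

definition root3 :: complex where "root3 = cis (2 * pi / 3)"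

definition mean3 :: "(complex \<Rightarrow> complex) \<Rightarrow> complex \<Rightarrow> complex" where
  "mean3 g c = (g c + g (root3 * c) + g (root3\<^sup>2 * c)) / 3"

definition orbit3 :: "complex \<Rightarrow> complex set" where
  "orbit3 c = {c, root3 * c, root3\<^sup>2 * c}"

lemma norm_root3 [simp]: "cmod root3 = 1"
  by (simp add: root3_def)

lemma orbit3_norm: "z \<in> orbit3 c \<Longrightarrow> cmod z = cmod c"
  unfolding orbit3_def by (auto simp: norm_mult norm_power)

lemma root3_eq: "root3 = Complex (- 1 / 2) (sqrt 3 / 2)"
  unfolding root3_def by (simp add: cis.ctr cos_120 sin_120 complex_eq_iff)

lemma root3_sum: "1 + root3 + root3\<^sup>2 = 0"
  unfolding root3_eq by (simp add: complex_eq_iff power2_eq_square)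

lemma root3_cubed: "root3 ^ 3 = 1"
  using root3_sum by algebra

lemma mean3_add: "mean3 (\<lambda>z. f z + g z) c = mean3 f c + mean3 g c"
  and mean3_diff: "mean3 (\<lambda>z. f z - g z) c = mean3 f c - mean3 g c"
  and mean3_cmult: "mean3 (\<lambda>z. a * f z) c = a * mean3 f c"
  unfolding mean3_def by (simp_all add: field_simps)

lemma mean3_cong: "(\<And>z. z \<in> orbit3 c \<Longrightarrow> f z = g z) \<Longrightarrow> mean3 f c = mean3 g c"
  unfolding mean3_def orbit3_def by simp

lemma mean3_const: "mean3 (\<lambda>z. a) c = a"
  and mean3_ident: "mean3 (\<lambda>z. z) c = 0"
  and mean3_square: "mean3 (\<lambda>z. z\<^sup>2) c = 0"
proof -
  show "mean3 (\<lambda>z. a) c = a" unfolding mean3_def by simp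
  have "c + root3 * c + root3\<^sup>2 * c = (1 + root3 + root3\<^sup>2) * c" by (simp add: algebra_simps)
  thus "mean3 (\<lambda>z. z) c = 0" unfolding mean3_def root3_sum by simp
  have "root3 ^ 4 = root3" using root3_cubed by (simp add: eval_nat_numeral)
  hence "c\<^sup>2 + (root3 * c)\<^sup>2 + (root3\<^sup>2 * c)\<^sup>2 = (1 + root3 + root3\<^sup>2) * c\<^sup>2"
    by (simp add: algebra_simps power_mult_distrib flip: power_mult)
  thus "mean3 (\<lambda>z. z\<^sup>2) c = 0" unfolding mean3_def root3_sum by simp
qed

lemma norm_mean3_le:
  assumes "\<And>z. z \<in> orbit3 c \<Longrightarrow> cmod (g z) \<le> B"
  shows "cmod (mean3 g c) \<le> B"
proof -
  have "cmod (g c + g (root3 * c) + g (root3\<^sup>2 * c)) \<le> B + B + B"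
    by (intro order_trans[OF norm_triangle_ineq] add_mono assms) (simp_all add: orbit3_def)
  thus ?thesis unfolding mean3_def by (simp add: norm_divide)
qed

text \<open>The orbit means of z and z^2 vanish, so the Taylor polynomial of degree 2 contributes
  only \<open>H 0\<close>, and the remainder is cubic with constant 192 = 3 * 4^3. An orbit of two
  points would leave a term in z^2, which is of the order to be measured.\<close>

lemma mean3_holomorphic:
  assumes H: "H holomorphic_on ball 0 R" and M: "\<And>z. z \<in> ball 0 R \<Longrightarrow> cmod (H z) \<le> M"
    and c: "cmod c < R / 2"
  shows "cmod (mean3 H c - H 0) \<le> 192 * M / R ^ 3 * cmod c ^ 3"
proof -
  have R: "0 < R" using c norm_ge_zero[of c] by linarith
  let ?P = "\<lambda>z. \<Sum>i\<le>2. (deriv ^^ i) H 0 * (z - 0) ^ i / fact i"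
  have P: "?P z = H 0 + (deriv H 0 * z + (deriv ^^ 2) H 0 / 2 * z\<^sup>2)" for z
    by (simp add: numeral_2_eq_2)
  have "mean3 ?P c = H 0"
    unfolding P mean3_add mean3_cmult mean3_const mean3_ident mean3_square by simp
  hence "mean3 H c - H 0 = mean3 (\<lambda>z. H z - ?P z) c" by (simp add: mean3_diff)
  also have "cmod \<dots> \<le> 192 * M / R ^ 3 * cmod c ^ 3"
  proof (rule norm_mean3_le)
    fix z assume zo: "z \<in> orbit3 c"
    note z = orbit3_norm[OF zo]
    have "cmod (H z - ?P z) \<le> real (Suc 2) * M * (4 / R) ^ Suc 2 * cmod (z - 0) ^ Suc 2"
      by (rule holomorphic_taylor_bound[OF H R M]) (use c z in auto)
    also have "\<dots> = 192 * M / R ^ 3 * cmod c ^ 3"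
      using z by (simp add: power_divide eval_nat_numeral)
    finally show "cmod (H z - ?P z) \<le> 192 * M / R ^ 3 * cmod c ^ 3" .
  qed
  finally show ?thesis .
qed

text \<open>On \<open>|\<zeta>| = 1\<close> the weight of the averaging argument is \<open>|1 - cnj z * \<zeta>|\<^sup>-\<^sup>4\<close>. It is
  positive there and extends to a meromorphic function of \<open>\<zeta>\<close> with a double zero at 0 and,
  inside the disc, only a double pole at \<open>z\<close>. The kernels below are what remains of the weight times
  \<open>w\<^sup>2\<close>, \<open>1\<close>, \<open>w\<close> (where \<open>w = disc_moebius z \<zeta>\<close>) after subtracting the principal part at \<open>z\<close>.\<close>

definition disc_moebius :: "complex \<Rightarrow> complex \<Rightarrow> complex" where
  "disc_moebius z \<zeta> = (\<zeta> - z) / (1 - cnj z * \<zeta>)"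

definition ker0 :: "complex \<Rightarrow> complex \<Rightarrow> complex" where
  "ker0 z \<zeta> = (1 - z * cnj z) ^ 3 * \<zeta>\<^sup>2 / ((1 + z * cnj z) * (1 - cnj z * \<zeta>) ^ 4)"

definition ker1 :: "complex \<Rightarrow> complex \<Rightarrow> complex" where
  "ker1 z \<zeta> = ((1 - z * cnj z) / (1 - cnj z * \<zeta>)\<^sup>2 + 2 * z * cnj z / (1 - cnj z * \<zeta>)) / (1 + z * cnj z)"

definition ker2 :: "complex \<Rightarrow> complex \<Rightarrow> complex" where
  "ker2 z \<zeta> = ((1 - z * cnj z)\<^sup>2 * \<zeta> / (1 - cnj z * \<zeta>) ^ 3 + (1 - z * cnj z) * z / (1 - cnj z * \<zeta>)\<^sup>2
    + z\<^sup>2 * cnj z / (1 - cnj z * \<zeta>)) / (1 + z * cnj z)"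

text \<open>Here w has a simple zero at z, and \<open>p + w * b + w\<^sup>2 * x\<close> is the value
  at w of a disc with 1-jet (p, b). The first term on the right is this value times the weight
  normalised by (1 - |z|^2)^3 / (1 + |z|^2); the second is its principal part at z. The double pole
  is cancelled by w^2 in the coefficient of x, leaves a simple pole for b, and remains double for
  p.\<close>

lemma kernel_identity:
  assumes u: "1 - cnj z * \<zeta> \<noteq> 0" and d: "\<zeta> \<noteq> z" and e: "1 + z * cnj z \<noteq> 0"
    and w: "w = disc_moebius z \<zeta>"
  shows "ker0 z \<zeta> * x + ker1 z \<zeta> * p + ker2 z \<zeta> * b =
    (1 - z * cnj z) ^ 3 * \<zeta>\<^sup>2 / ((1 + z * cnj z) * (1 - cnj z * \<zeta>)\<^sup>2 * (\<zeta> - z)\<^sup>2) * (p + w * b + w\<^sup>2 * x)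
    - (p * ((1 - z * cnj z) * z\<^sup>2 / (\<zeta> - z)\<^sup>2 + 2 * z / (\<zeta> - z)) + b * (z\<^sup>2 / (\<zeta> - z))) / (1 + z * cnj z)"
proof -
  \<comment> \<open>Naming the conjugate turns the claim into rational identities in independent
    variables, within reach of \<open>algebra\<close>.\<close>
  define s where "s = cnj z"
  define q where "q = 1 - z * s"
  define u' where "u' = 1 - s * \<zeta>"
  define e' where "e' = 1 + z * s"
  define d' where "d' = \<zeta> - z"
  note defs = s_def[symmetric] q_def[symmetric] u'_def[symmetric] e'_def[symmetric] d'_def[symmetric]
  have nz: "u' \<noteq> 0" "e' \<noteq> 0" "d' \<noteq> 0" using assms unfolding u'_def e'_def d'_def s_def by auto
  have w': "w = d' / u'" using w unfolding disc_moebius_def u'_def d'_def s_def .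
  have 0: "q ^ 3 * \<zeta>\<^sup>2 / (e' * u' ^ 4) = q ^ 3 * \<zeta>\<^sup>2 / (e' * u'\<^sup>2 * d'\<^sup>2) * w\<^sup>2"
    unfolding w' using nz by (simp add: field_simps eval_nat_numeral)
  have "q * d'\<^sup>2 + 2 * z * s * u' * d'\<^sup>2 = q ^ 3 * \<zeta>\<^sup>2 - (q * z\<^sup>2 + 2 * z * d') * u'\<^sup>2"
    unfolding q_def u'_def d'_def by algebra
  hence 1: "(q / u'\<^sup>2 + 2 * z * s / u') / e' = q ^ 3 * \<zeta>\<^sup>2 / (e' * u'\<^sup>2 * d'\<^sup>2)
      - (q * z\<^sup>2 / d'\<^sup>2 + 2 * z / d') / e'"
    using nz by (simp add: divide_simps) algebra
  have "(q\<^sup>2 * \<zeta> + q * z * u' + z\<^sup>2 * s * u'\<^sup>2) * d' = q ^ 3 * \<zeta>\<^sup>2 - z\<^sup>2 * u' ^ 3"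
    unfolding q_def u'_def d'_def by algebra
  hence 2: "(q\<^sup>2 * \<zeta> / u' ^ 3 + q * z / u'\<^sup>2 + z\<^sup>2 * s / u') / e'
      = q ^ 3 * \<zeta>\<^sup>2 / (e' * u'\<^sup>2 * d'\<^sup>2) * w - z\<^sup>2 / d' / e'"
    unfolding w' using nz by (simp add: divide_simps) algebra
  have "(A * w\<^sup>2) * x + (A - B / e') * p + (A * w - D / e') * b
      = A * (p + w * b + w\<^sup>2 * x) - (p * B + b * D) / e'" for A B D
    by (simp add: algebra_simps add_divide_distrib)
  thus ?thesis unfolding ker0_def ker1_def ker2_def defs 0 1 2 by blast
qed

text \<open>On |t| = r the function |1 - t|^-4 is the real part of a function H holomorphic near 0,
  whose value at 0 is the mean (1 + r^2) / (1 - r^2)^3 over the circle. The orbit mean differs from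
  it by a cubic term; 92160 = 192 * 60 * 2^3 for the bound 60 on the disc of radius 1/2.\<close>

lemma mean3_weight:
  assumes c: "cmod c = r" "r < 1 / 4" and \<zeta>: "cmod \<zeta> = 1"
  shows "Re (mean3 (\<lambda>z. of_real (1 / cmod (1 - cnj z * \<zeta>) ^ 4)) c)
    \<le> (1 + r\<^sup>2) / (1 - r\<^sup>2) ^ 3 + 92160 * r ^ 3"
proof -
  have r0: "0 \<le> r" using c by auto
  define q where "q = 1 - r\<^sup>2"
  have r2: "r\<^sup>2 \<le> (1 / 4)\<^sup>2" using c r0 by (intro power_mono) auto
  have q: "3 / 4 \<le> q" unfolding q_def using r2 by (simp add: power2_eq_square)
  \<comment> \<open>With x = 1 - t and y its conjugate, |t| = r means Q / (x y) = 1/x + 1/y - 1.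
    Squaring, and using the relation again for the cross term 2 / (x y), splits 1 / (x^2 y^2) into a
    function of x plus its conjugate; \<open>H\<close> is twice the part in x.\<close>
  define H where "H t = (2 / (1 - t)\<^sup>2 + 2 / of_real q * (2 / (1 - t) - 1) + 1 - 4 / (1 - t)) / of_real (q\<^sup>2)" for t :: complex
  have ReH: "1 / cmod (1 - cnj z * \<zeta>) ^ 4 = Re (H (cnj \<zeta> * z))" if z: "cmod z = r" for z
  proof -
    define t where "t = cnj \<zeta> * z"
    have t: "cmod t = r" unfolding t_def using z \<zeta> by (simp add: norm_mult)
    have nz: "1 - t \<noteq> 0" "1 - cnj t \<noteq> 0" using t c
      by (metis complex_cnj_cancel_iff complex_cnj_one eq_iff_diff_eq_0 less_numeral_extra(4) norm_one order_less_trans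
           divide_less_eq_1_pos one_less_numeral_iff semiring_norm(76) zero_less_numeral)+
    define x y where "x = 1 - t" and "y = 1 - cnj t"
    have xy: "x \<noteq> 0" "y \<noteq> 0" "y = cnj x" using nz unfolding x_def y_def by auto
    have "t * cnj t = of_real (r\<^sup>2)" using t by (metis complex_norm_square)
    hence xyq: "x * y = x + y - of_real q" unfolding x_def y_def q_def by (simp add: algebra_simps)
    define Q where "Q = complex_of_real q"
    have Q: "Q \<noteq> 0" "x * y = x + y - Q" unfolding Q_def using q xyq by auto
    have H: "H t = (2 / x\<^sup>2 + 2 / Q * (2 / x - 1) + 1 - 4 / x) / Q\<^sup>2"
      unfolding H_def x_def Q_def by simp
    have Hc: "cnj (H t) = (2 / y\<^sup>2 + 2 / Q * (2 / y - 1) + 1 - 4 / y) / Q\<^sup>2"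
      unfolding H xy(3) Q_def by simp
    have "1 / x\<^sup>2 + 1 / y\<^sup>2 + (2 / Q * (1 / x + 1 / y - 1) + 1 - 2 / x - 2 / y) = Q\<^sup>2 / (x\<^sup>2 * y\<^sup>2)"
    proof -
      have "Q / (x * y) = 1 / x + 1 / y - 1" using xy Q by (simp add: field_simps)
      hence "Q\<^sup>2 / (x\<^sup>2 * y\<^sup>2) = (1 / x + 1 / y - 1)\<^sup>2" by (metis power_divide power_mult_distrib)
      also have "\<dots> = 1 / x\<^sup>2 + 1 / y\<^sup>2 + (2 / (x * y) + 1 - 2 / x - 2 / y)"
        using xy(1,2) by (simp add: power2_eq_square field_simps)
      also have "2 / (x * y) = 2 / Q * (1 / x + 1 / y - 1)"
        unfolding \<open>Q / (x * y) = 1 / x + 1 / y - 1\<close>[symmetric] using Q(1) by simp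
      finally show ?thesis by simp
    qed
    hence "1 / (x\<^sup>2 * y\<^sup>2) = (1 / x\<^sup>2 + 1 / y\<^sup>2 + (2 / Q * (1 / x + 1 / y - 1) + 1 - 2 / x - 2 / y)) / Q\<^sup>2"
      using Q(1) by simp
    also have "\<dots> = (H t + cnj (H t)) / 2"
      unfolding Hc unfolding H by (simp add: add_divide_distrib diff_divide_distrib algebra_simps)
    finally have "(H t + cnj (H t)) / 2 = 1 / (x\<^sup>2 * y\<^sup>2)" ..
    also have "x\<^sup>2 * y\<^sup>2 = of_real (cmod x ^ 4)"
      unfolding xy(3) by (metis complex_norm_square power_mult_distrib power_mult num_double numeral_times_numeral of_real_power mult_2_right)
    finally have "of_real (Re (H t)) = complex_of_real (1 / cmod x ^ 4)"
      by (simp add: complex_add_cnj)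
    hence "Re (H t) = 1 / cmod x ^ 4" using of_real_eq_iff by blast
    also have "cmod x = cmod (1 - cnj z * \<zeta>)"
      unfolding x_def t_def by (metis complex_cnj_cnj complex_cnj_diff complex_cnj_mult complex_cnj_one complex_mod_cnj mult.commute)
    finally show ?thesis unfolding t_def by simp
  qed
  have "Re (mean3 (\<lambda>z. of_real (1 / cmod (1 - cnj z * \<zeta>) ^ 4)) c) = Re (mean3 (\<lambda>z. of_real (Re (H (cnj \<zeta> * z)))) c)"
    using c by (intro arg_cong[where f = Re] mean3_cong arg_cong[where f = complex_of_real] ReH)
      (simp add: orbit3_norm)
  also have "\<dots> = Re (mean3 H (cnj \<zeta> * c))"
    unfolding mean3_def by (simp add: mult_ac)
  also have "\<dots> \<le> Re (H 0) + cmod (mean3 H (cnj \<zeta> * c) - H 0)"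
    using complex_Re_le_cmod[of "mean3 H (cnj \<zeta> * c) - H 0"] by simp
  also have "cmod (mean3 H (cnj \<zeta> * c) - H 0) \<le> 192 * 60 / (1 / 2) ^ 3 * cmod (cnj \<zeta> * c) ^ 3"
  proof (rule mean3_holomorphic)
    have nz: "1 - t \<noteq> 0" if "t \<in> ball 0 (1 / 2)" for t :: complex using that by auto
    show "H holomorphic_on ball 0 (1 / 2)"
      unfolding H_def using nz q by (intro holomorphic_intros) auto
    fix t :: complex assume t: "t \<in> ball 0 (1 / 2)"
    have i: "cmod (1 / (1 - t)) \<le> 2"
    proof -
      have "1 / 2 \<le> cmod (1 - t)" using t norm_triangle_ineq2[of 1 t] by simp
      thus ?thesis by (simp add: norm_divide divide_simps)
    qed
    have q1: "1 / q \<le> 4 / 3" "0 < q" using q by (auto simp: field_simps)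
    have q2: "cmod (of_real (1 / q)) \<le> 4 / 3" unfolding norm_of_real using q1 by simp
    define X where "X = 1 / (1 - t)"
    have i2: "cmod (X\<^sup>2) \<le> 4" using i power_mono[OF i, of 2] unfolding X_def norm_power by simp
    have i1: "cmod (2 * X - 1) \<le> 5" using i norm_triangle_ineq4[of "2 * X" 1] unfolding X_def[symmetric] by (simp add: norm_mult)
    have "H t = (2 * X\<^sup>2 + 2 * of_real (1 / q) * (2 * X - 1) + 1 - 4 * X) * of_real ((1 / q)\<^sup>2)"
      unfolding H_def X_def by (simp add: power_divide divide_inverse power_inverse)
    also have "cmod \<dots> \<le> (2 * 4 + 2 * (4 / 3) * 5 + 1 + 4 * 2) * (4 / 3)\<^sup>2"
      unfolding norm_mult
    proof (rule mult_mono)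
      have "cmod (2 * of_real (1 / q) * (2 * X - 1)) \<le> 2 * (4 / 3) * 5"
        unfolding norm_mult by (intro mult_mono q2 i1) auto
      thus "cmod (2 * X\<^sup>2 + 2 * of_real (1 / q) * (2 * X - 1) + 1 - 4 * X) \<le> 2 * 4 + 2 * (4 / 3) * 5 + 1 + 4 * 2"
        using i2 i unfolding X_def[symmetric]
        by (intro order_trans[OF norm_triangle_ineq4] add_mono order_trans[OF norm_triangle_ineq])
          (simp_all add: norm_mult)
      have "(1 / q)\<^sup>2 \<le> (4 / 3)\<^sup>2" using q1 by (intro power_mono) auto
      thus "cmod (of_real ((1 / q)\<^sup>2)) \<le> (4 / 3)\<^sup>2"
        unfolding norm_of_real by simp
    qed auto
    also have "\<dots> \<le> 60" by (simp add: power2_eq_square)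
    finally show "cmod (H t) \<le> 60" .
  qed (use c \<zeta> in \<open>auto simp: norm_mult\<close>)
  also have "\<dots> = 92160 * r ^ 3" using c \<zeta> by (simp add: norm_mult power_divide)
  also have "Re (H 0) = (1 + r\<^sup>2) / (1 - r\<^sup>2) ^ 3"
  proof -
    have "H 0 = of_real ((2 / q - 1) / q\<^sup>2)" unfolding H_def using q by simp
    also have "(2 / q - 1) / q\<^sup>2 = (2 - q) / q ^ 3" using q by (simp add: field_simps eval_nat_numeral)
    finally show ?thesis unfolding q_def by simp
  qed
  finally show ?thesis by simp
qed

section \<open>The averaged disc tested against one vector of the predual\<close>

text \<open>\<open>\<psi> z\<close> is the second-order quotient of the disc through
  \<open>p z\<close> in direction \<open>b z\<close>. By \<open>kernel_identity\<close> each summand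
  is the weighted disc with its pole at z removed; in this form holomorphy in \<zeta> up to the
  boundary is visible.\<close>

definition averaged_disc ::
    "(complex \<Rightarrow> complex \<Rightarrow> complex) \<Rightarrow> (complex \<Rightarrow> complex) \<Rightarrow> (complex \<Rightarrow> complex) \<Rightarrow> complex \<Rightarrow> complex \<Rightarrow> complex"
  where "averaged_disc \<psi> p b c \<zeta> =
    mean3 (\<lambda>z. ker0 z \<zeta> * \<psi> z (disc_moebius z \<zeta>) + ker1 z \<zeta> * p z + ker2 z \<zeta> * b z) c"

lemma disc_moebius_denom_nonzero:
  assumes "cmod z < 1" "cmod \<zeta> \<le> 1"
  shows "1 - cnj z * \<zeta> \<noteq> 0" "1 + z * cnj z \<noteq> 0"
proof -
  have "cmod (cnj z * \<zeta>) < 1"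
    using assms by (metis complex_mod_cnj mult_left_le norm_ge_zero norm_mult order_le_less_trans)
  thus "1 - cnj z * \<zeta> \<noteq> 0" by auto
  have "1 + z * cnj z = of_real (1 + (cmod z)\<^sup>2)"
    by (simp only: of_real_add of_real_1 complex_norm_square)
  also have "\<dots> \<noteq> 0" by (smt (verit) of_real_eq_0_iff zero_le_power2)
  finally show "1 + z * cnj z \<noteq> 0" .
qed

lemma disc_moebius_le:
  assumes z: "cmod z < 1" and \<zeta>: "cmod \<zeta> \<le> 1"
  shows "cmod (disc_moebius z \<zeta>) \<le> 1"
proof -
  have "(cmod (1 - cnj z * \<zeta>))\<^sup>2 - (cmod (\<zeta> - z))\<^sup>2 = (1 - (cmod z)\<^sup>2) * (1 - (cmod \<zeta>)\<^sup>2)"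
    unfolding cmod_power2 by (simp add: algebra_simps power2_eq_square)
  moreover have "0 \<le> (1 - (cmod z)\<^sup>2) * (1 - (cmod \<zeta>)\<^sup>2)"
    using z \<zeta> by (simp add: abs_square_le_1)
  ultimately have "(cmod (\<zeta> - z))\<^sup>2 \<le> (cmod (1 - cnj z * \<zeta>))\<^sup>2" by linarith
  hence "cmod (\<zeta> - z) \<le> cmod (1 - cnj z * \<zeta>)" by (rule power2_le_imp_le) simp
  thus ?thesis unfolding disc_moebius_def norm_divide
    using disc_moebius_denom_nonzero(1)[OF z \<zeta>] by (subst pos_divide_le_eq) simp_all
qed

text \<open>The double zero of the weight at 0 makes the 1-jet of \<open>ker0\<close> vanish there,
  so the unknown part of the discs does not enter the 1-jet of the average. What remains at 0 comes
  from the subtracted principal parts alone.\<close>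

lemma kernels_deriv_0:
  assumes z: "cmod z < 1"
  shows "ker0 z 0 = 0" "(ker0 z has_field_derivative 0) (at 0)"
    and "ker1 z 0 = 1" "(ker1 z has_field_derivative 2 * cnj z / (1 + z * cnj z)) (at 0)"
    and "ker2 z 0 = z / (1 + z * cnj z)" "(ker2 z has_field_derivative 1 / (1 + z * cnj z)) (at 0)"
proof -
  have e: "1 + z * cnj z \<noteq> 0" using disc_moebius_denom_nonzero(2)[OF z, of 0] by simp
  show "ker0 z 0 = 0" unfolding ker0_def by simp
  show "ker1 z 0 = 1" unfolding ker1_def using e by (simp add: field_simps)
  show "ker2 z 0 = z / (1 + z * cnj z)" unfolding ker2_def by (simp add: algebra_simps power2_eq_square)
  have 0: "ker0 z = (\<lambda>\<zeta>. (1 - z * cnj z) ^ 3 * \<zeta>\<^sup>2 / ((1 + z * cnj z) * (1 - cnj z * \<zeta>) ^ 4))"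
    by (simp add: fun_eq_iff ker0_def)
  show "(ker0 z has_field_derivative 0) (at 0)"
    unfolding 0 using e by (auto intro!: derivative_eq_intros)
  have 1: "ker1 z = (\<lambda>\<zeta>. ((1 - z * cnj z) / (1 - cnj z * \<zeta>)\<^sup>2 + 2 * z * cnj z / (1 - cnj z * \<zeta>)) / (1 + z * cnj z))"
    by (simp add: fun_eq_iff ker1_def)
  show "(ker1 z has_field_derivative 2 * cnj z / (1 + z * cnj z)) (at 0)"
    unfolding 1 by (rule DERIV_cdivide) (auto intro!: derivative_eq_intros simp: algebra_simps)
  have 2: "ker2 z = (\<lambda>\<zeta>. ((1 - z * cnj z)\<^sup>2 * \<zeta> / (1 - cnj z * \<zeta>) ^ 3 + (1 - z * cnj z) * z / (1 - cnj z * \<zeta>)\<^sup>2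
      + z\<^sup>2 * cnj z / (1 - cnj z * \<zeta>)) / (1 + z * cnj z))"
    by (simp add: fun_eq_iff ker2_def)
  have "((1 - z * cnj z)\<^sup>2 + 2 * (1 - z * cnj z) * z * cnj z + z\<^sup>2 * cnj z * cnj z) = 1" by algebra
  thus "(ker2 z has_field_derivative 1 / (1 + z * cnj z)) (at 0)"
    unfolding 2
    by (intro DERIV_cdivide) (auto intro!: derivative_eq_intros simp: algebra_simps power2_eq_square)
qed

lemma averaging_kernels_holomorphic:
  assumes z: "cmod z < 1"
  shows "disc_moebius z holomorphic_on cball 0 1" "ker0 z holomorphic_on cball 0 1"
    "ker1 z holomorphic_on cball 0 1" "ker2 z holomorphic_on cball 0 1"
proof -
  have nz: "1 - cnj z * \<zeta> \<noteq> 0" if "\<zeta> \<in> cball 0 1" for \<zeta>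
    using disc_moebius_denom_nonzero[OF z, of \<zeta>] that by simp
  have e: "1 + z * cnj z \<noteq> 0" using disc_moebius_denom_nonzero(2)[OF z, of 0] by simp
  show "disc_moebius z holomorphic_on cball 0 1" "ker0 z holomorphic_on cball 0 1"
    "ker1 z holomorphic_on cball 0 1" "ker2 z holomorphic_on cball 0 1"
    unfolding disc_moebius_def[abs_def] ker0_def[abs_def] ker1_def[abs_def] ker2_def[abs_def]
    using nz e by (auto intro!: holomorphic_intros)
qed

text \<open>One vector y is fixed: F and \<psi> are the tested data and M plays the role of
  \<open>norm y\<close>. The directions are values of one holomorphic function B, not just three
  numbers, so that \<open>mean3_holomorphic\<close> can evaluate their means. The radius \<tau> > 1
  makes G holomorphic up to the boundary circle.\<close>

context
  fixes R L M \<tau> :: real and a \<beta> c :: complex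
    and F B G :: "complex \<Rightarrow> complex" and \<psi> :: "complex \<Rightarrow> complex \<Rightarrow> complex"
  assumes B_eq: "B = (\<lambda>z. \<beta> * exp (- a * z) * deriv F z)" and G_eq: "G = averaged_disc \<psi> F B c"
    and R: "0 < R" "R \<le> 1" and a: "cmod a \<le> L" and \<beta>: "cmod \<beta> \<le> 2" and c: "cmod c < R / 4"
    and F: "F holomorphic_on ball 0 R" and FM: "\<And>z. z \<in> ball 0 R \<Longrightarrow> cmod (F z) \<le> M"
    and \<tau>: "1 < \<tau>" and \<psi>: "\<And>z. z \<in> orbit3 c \<Longrightarrow> \<psi> z holomorphic_on ball 0 \<tau>"
    and disc: "\<And>z w. z \<in> orbit3 c \<Longrightarrow> cmod w \<le> 1 \<Longrightarrow>
      cmod (F z + w * B z + w\<^sup>2 * \<psi> z w) \<le> M"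
begin

lemma averaged_F'_bound:
  assumes z: "z \<in> ball 0 (R / 2)"
  shows "cmod (deriv F z) \<le> 4 * M / R" "cmod (B z) \<le> 8 * exp L / R * M" "0 \<le> M"
proof -
  show M: "0 \<le> M" using FM[of 0] R norm_ge_zero order_trans by (metis centre_in_ball)
  have sub: "ball z (R / 2) \<subseteq> ball 0 R"
  proof
    fix w assume "w \<in> ball z (R / 2)"
    thus "w \<in> ball 0 R" using z norm_triangle_sub[of w z] by (simp add: dist_norm norm_minus_commute)
  qed
  have "cmod (deriv F z) \<le> 2 * M / (R / 2)"
    using FM sub R by (intro holomorphic_deriv_bound holomorphic_on_subset[OF F sub]) auto
  thus d: "cmod (deriv F z) \<le> 4 * M / R" by simp
  have "cmod (a * z) \<le> L * 1" unfolding norm_mult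
    using z R by (intro mult_mono a order_trans[OF norm_ge_zero a]) auto
  hence "cmod (exp (- a * z)) \<le> exp L"
    using complex_Re_le_cmod[of "- a * z"] by simp
  hence "cmod (B z) \<le> 2 * exp L * (4 * M / R)"
    unfolding B_eq norm_mult using \<beta> d by (intro mult_mono) auto
  thus "cmod (B z) \<le> 8 * exp L / R * M" by simp
qed

lemma averaged_B_holomorphic: "B holomorphic_on ball 0 (R / 2)"
proof -
  have "F holomorphic_on ball 0 (R / 2)" by (rule holomorphic_on_subset[OF F]) (use R in auto)
  thus ?thesis unfolding B_eq by (intro holomorphic_intros) auto
qed

lemma averaged_c: "cmod c < 1 / 4" "cmod c < (R / 2) / 2"
  using c R by linarith+

lemma averaged_term_holomorphic:
  assumes zo: "z \<in> orbit3 c"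
  shows "(\<lambda>\<zeta>. ker0 z \<zeta> * \<psi> z (disc_moebius z \<zeta>) + ker1 z \<zeta> * F z + ker2 z \<zeta> * b) holomorphic_on cball 0 1"
proof -
  have z1: "cmod z < 1" using orbit3_norm[OF zo] averaged_c by simp
  have "(\<psi> z \<circ> disc_moebius z) holomorphic_on cball 0 1"
    using disc_moebius_le[OF z1] \<tau>
    by (intro holomorphic_on_compose_gen[OF _ \<psi>[OF zo]] averaging_kernels_holomorphic z1) fastforce
  thus ?thesis unfolding o_def
    by (intro holomorphic_intros averaging_kernels_holomorphic z1)
qed

lemma averaged_disc_holomorphic: "G holomorphic_on cball 0 1"
  unfolding G_eq averaged_disc_def[abs_def] mean3_def
  by (intro holomorphic_intros averaged_term_holomorphic) (simp_all add: orbit3_def)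

text \<open>\<open>G 0\<close> is the mean of F z + z * B z / (1 + r^2) with r = |c|. Since r is
  constant on the orbit, this is a holomorphic function of z with value F 0 at 0. The constant is
  1536 = 192 * 2^3 because B is controlled on radius R/2.\<close>

lemma averaged_disc_0:
  "cmod (G 0 - F 0) \<le> 1536 * (1 + 8 * exp L / R) / R ^ 3 * M * cmod c ^ 3"
proof -
  define e where "e = complex_of_real (1 + (cmod c)\<^sup>2)"
  have e: "1 \<le> cmod e" unfolding e_def norm_of_real by simp
  define H where "H z = F z + z * B z / e" for z
  have "G 0 = mean3 H c"
    unfolding G_eq averaged_disc_def
  proof (rule mean3_cong)
    fix z assume zo: "z \<in> orbit3 c"
    note z = orbit3_norm[OF zo]
    hence "cmod z < 1" "e = 1 + z * cnj z"
      using z averaged_c unfolding e_def complex_norm_square[symmetric] by auto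
    thus "ker0 z 0 * \<psi> z (disc_moebius z 0) + ker1 z 0 * F z + ker2 z 0 * B z = H z"
      by (simp add: kernels_deriv_0 H_def)
  qed
  moreover have "cmod (mean3 H c - H 0) \<le> 192 * ((1 + 8 * exp L / R) * M) / (R / 2) ^ 3 * cmod c ^ 3"
  proof (rule mean3_holomorphic)
    have "e \<noteq> 0" using e by auto
    thus "H holomorphic_on ball 0 (R / 2)" unfolding H_def
      using R by (intro holomorphic_intros averaged_B_holomorphic holomorphic_on_subset[OF F]) auto
    fix z :: complex assume z: "z \<in> ball 0 (R / 2)"
    have "cmod (z * B z / e) = cmod z * cmod (B z) / cmod e" by (simp add: norm_mult norm_divide)
    also have "\<dots> \<le> cmod z * cmod (B z) / 1" using e by (intro divide_left_mono) auto
    also have "\<dots> \<le> 1 * (8 * exp L / R * M)"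
      using z R averaged_F'_bound[OF z] by (simp only: div_by_1, intro mult_mono) auto
    finally have "cmod (z * B z / e) \<le> 8 * exp L / R * M" by simp
    thus "cmod (H z) \<le> (1 + 8 * exp L / R) * M"
      unfolding H_def using FM[of z] z R norm_triangle_ineq[of "F z" "z * B z / e"] by (simp add: algebra_simps)
  qed (rule averaged_c)
  ultimately show ?thesis by (simp add: H_def power_divide mult_ac)
qed

text \<open>The derivative is the mean of (2 * cnj z * F z + B z) / (1 + r^2). The mean of
  \<open>cnj z\<close> is 0, which removes the constant term of F, and z * cnj z = r^2 turns its
  linear term into r^2 F'(0): this is the source of the decisive 2 r^2. The mean of B is B 0 =
  \<beta> F'(0) up to a cubic error.\<close>

lemma averaged_disc_deriv_0:
  "cmod (deriv G 0 - (2 * (cmod c)\<^sup>2 + \<beta>) / (1 + (cmod c)\<^sup>2) * deriv F 0)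
    \<le> (1536 * (8 * exp L / R) / R ^ 3 + 64 / R\<^sup>2) * M * cmod c ^ 3"
proof -
  define e where "e = complex_of_real (1 + (cmod c)\<^sup>2)"
  have e: "1 \<le> cmod e" unfolding e_def norm_of_real by simp
  have e0: "e \<noteq> 0" using e by auto
  define d where "d z = (2 * (cnj z * F z) + B z) / e" for z
  have tm: "((\<lambda>\<zeta>. ker0 z \<zeta> * \<psi> z (disc_moebius z \<zeta>) + ker1 z \<zeta> * F z + ker2 z \<zeta> * B z)
      has_field_derivative d z) (at 0)" if zo: "z \<in> orbit3 c" for z
  proof -
    note z = orbit3_norm[OF zo]
    have z1: "cmod z < 1" and ez: "e = 1 + z * cnj z"
      using z averaged_c unfolding e_def complex_norm_square[symmetric] by auto
    have "(\<psi> z \<circ> disc_moebius z) holomorphic_on cball 0 1"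
      using disc_moebius_le[OF z1] \<tau>
      by (intro holomorphic_on_compose_gen[OF _ \<psi>[OF zo]] averaging_kernels_holomorphic z1) fastforce
    hence "(\<lambda>\<zeta>. \<psi> z (disc_moebius z \<zeta>)) holomorphic_on ball 0 1"
      unfolding o_def by (rule holomorphic_on_subset) auto
    then obtain D where D: "((\<lambda>\<zeta>. \<psi> z (disc_moebius z \<zeta>)) has_field_derivative D) (at 0)"
      using holomorphic_derivI[of _ "ball 0 1" 0] by auto
    show ?thesis
      by (rule DERIV_cong[OF DERIV_add[OF DERIV_add[OF DERIV_mult[OF kernels_deriv_0(2)[OF z1] D]
        DERIV_cmult_right[OF kernels_deriv_0(4)[OF z1]]] DERIV_cmult_right[OF kernels_deriv_0(6)[OF z1]]]])
        (use e0 in \<open>simp add: d_def ez kernels_deriv_0[OF z1] add_divide_distrib\<close>)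
  qed
  have "(G has_field_derivative mean3 d c) (at 0)"
    unfolding G_eq averaged_disc_def[abs_def] mean3_def
    by (intro DERIV_cdivide DERIV_add tm) (simp_all add: orbit3_def)
  hence G: "deriv G 0 = mean3 d c" by (rule DERIV_imp_deriv)
  have B0: "B 0 = \<beta> * deriv F 0" unfolding B_eq by simp
  have "mean3 d c = (1 / e) * (2 * mean3 (\<lambda>z. cnj z * F z) c + mean3 B c)"
    unfolding mean3_cmult[symmetric] mean3_add[symmetric] d_def by simp
  moreover have "(2 * (cmod c)\<^sup>2 + \<beta>) / (1 + (cmod c)\<^sup>2) * deriv F 0
      = (1 / e) * (2 * (of_real ((cmod c)\<^sup>2) * deriv F 0) + \<beta> * deriv F 0)"
  proof -
    have "(2 * x + y) / w * D = (1 / w) * (2 * (x * D) + y * D)" for x y w D :: complex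
      by (cases "w = 0") (auto simp: field_simps)
    from this[of "of_real ((cmod c)\<^sup>2)" \<beta> e] show ?thesis by (simp add: e_def)
  qed
  ultimately have "deriv G 0 - (2 * (cmod c)\<^sup>2 + \<beta>) / (1 + (cmod c)\<^sup>2) * deriv F 0
      = (1 / e) * (2 * (mean3 (\<lambda>z. cnj z * F z) c - of_real ((cmod c)\<^sup>2) * deriv F 0) + (mean3 B c - B 0))"
    unfolding G B0 by (simp add: algebra_simps)
  moreover have "cmod (1 / e * x) \<le> cmod x" for x
    using divide_left_mono[of 1 "cmod e" "cmod x"] e e0 by (simp add: norm_mult norm_divide)
  ultimately have "cmod (deriv G 0 - (2 * (cmod c)\<^sup>2 + \<beta>) / (1 + (cmod c)\<^sup>2) * deriv F 0)
      \<le> cmod (2 * (mean3 (\<lambda>z. cnj z * F z) c - of_real ((cmod c)\<^sup>2) * deriv F 0) + (mean3 B c - B 0))"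
    by simp
  also have "\<dots> \<le> 2 * cmod (mean3 (\<lambda>z. cnj z * F z) c - of_real ((cmod c)\<^sup>2) * deriv F 0) + cmod (mean3 B c - B 0)"
    using norm_triangle_ineq[of "2 * (mean3 (\<lambda>z. cnj z * F z) c - of_real ((cmod c)\<^sup>2) * deriv F 0)" "mean3 B c - B 0"]
    by (simp only: norm_mult norm_numeral)
  finally have "cmod (deriv G 0 - (2 * (cmod c)\<^sup>2 + \<beta>) / (1 + (cmod c)\<^sup>2) * deriv F 0)
      \<le> 2 * cmod (mean3 (\<lambda>z. cnj z * F z) c - of_real ((cmod c)\<^sup>2) * deriv F 0) + cmod (mean3 B c - B 0)" .
  moreover have "cmod (mean3 B c - B 0) \<le> 192 * (8 * exp L / R * M) / (R / 2) ^ 3 * cmod c ^ 3"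
    by (rule mean3_holomorphic[OF averaged_B_holomorphic averaged_F'_bound(2) averaged_c(2)])
  moreover have "cmod (mean3 (\<lambda>z. cnj z * F z) c - of_real ((cmod c)\<^sup>2) * deriv F 0) \<le> 32 * M / R\<^sup>2 * cmod c ^ 3"
  proof -
    have "mean3 (\<lambda>z. cnj z * F z) c - of_real ((cmod c)\<^sup>2) * deriv F 0
        = mean3 (\<lambda>z. cnj z * F z - (cnj z * F 0 + of_real ((cmod c)\<^sup>2) * deriv F 0)) c"
    proof -
      have "mean3 cnj c = cnj (mean3 (\<lambda>z. z) c)"
        unfolding mean3_def using root3_cubed by simp
      hence "mean3 cnj c = 0" by (simp add: mean3_ident)
      thus ?thesis unfolding mean3_diff mean3_add mean3_const
        using mean3_cmult[of "F 0" cnj c] by (simp add: mult.commute)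
    qed
    also have "cmod \<dots> \<le> 32 * M / R\<^sup>2 * cmod c ^ 3"
    proof (rule norm_mean3_le)
      fix z assume zo: "z \<in> orbit3 c"
      note z = orbit3_norm[OF zo]
      have "of_real ((cmod c)\<^sup>2) = z * cnj z" using z by (metis complex_norm_square)
      hence "cnj z * F z - (cnj z * F 0 + of_real ((cmod c)\<^sup>2) * deriv F 0)
          = cnj z * (F z - (\<Sum>i\<le>1. (deriv ^^ i) F 0 * (z - 0) ^ i / fact i))"
        by (simp add: algebra_simps)
      also have "cmod \<dots> \<le> cmod c * (real (Suc 1) * M * (4 / R) ^ Suc 1 * cmod (z - 0) ^ Suc 1)"
        unfolding norm_mult complex_mod_cnj z
        using c z R by (intro mult_left_mono holomorphic_taylor_bound[OF F R(1) FM]) auto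
      also have "\<dots> = 32 * M / R\<^sup>2 * cmod c ^ 3"
        using z by (simp add: power2_eq_square power3_eq_cube)
      finally show "cmod (cnj z * F z - (cnj z * F 0 + of_real ((cmod c)\<^sup>2) * deriv F 0))
        \<le> 32 * M / R\<^sup>2 * cmod c ^ 3" .
    qed
    finally show ?thesis .
  qed
  ultimately have "cmod (deriv G 0 - (2 * (cmod c)\<^sup>2 + \<beta>) / (1 + (cmod c)\<^sup>2) * deriv F 0)
      \<le> 2 * (32 * M / R\<^sup>2 * cmod c ^ 3) + 192 * (8 * exp L / R * M) / (R / 2) ^ 3 * cmod c ^ 3"
    by linarith
  also have "\<dots> = (1536 * (8 * exp L / R) / R ^ 3 + 64 / R\<^sup>2) * M * cmod c ^ 3"
    by (simp add: power_divide distrib_right distrib_left)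
  finally show ?thesis .
qed

text \<open>By the maximum principle only |\<zeta>| = 1 matters. There G is the mean of W - S, where
  W is the weight times a disc value of modulus at most M, so that its mean is at most M times the
  mean weight, and S collects the principal parts. As a function of z near 0, S is holomorphic with
  S 0 = 0, so its mean is cubic.\<close>

lemma averaged_disc_bound:
  assumes \<zeta>: "cmod \<zeta> < 1"
  shows "cmod (G \<zeta>) \<le> M * (1 + (92160 + 1536 * (3 + 4 * exp L / R) / R ^ 3) * cmod c ^ 3)"
proof (rule maximum_modulus_frontier[where S = "ball 0 1" and f = G and \<xi> = \<zeta>])
  show "G holomorphic_on interior (ball 0 1)"
    using averaged_disc_holomorphic by (rule holomorphic_on_subset) auto
  show "continuous_on (closure (ball 0 1)) G"
    using holomorphic_on_imp_continuous_on[OF averaged_disc_holomorphic] by simp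
  fix \<zeta> :: complex assume "\<zeta> \<in> frontier (ball 0 1)"
  hence \<zeta>: "cmod \<zeta> = 1" by (simp add: frontier_ball sphere_def)
  define r where "r = cmod c"
  have r: "r < 1 / 4" "0 \<le> r" unfolding r_def using averaged_c by auto
  have r2: "r\<^sup>2 < 1" using r by (simp add: abs_square_less_1)
  define e q where "e = complex_of_real (1 + r\<^sup>2)" and "q = complex_of_real (1 - r\<^sup>2)"
  have e: "1 \<le> cmod e" unfolding e_def norm_of_real by simp
  have qle: "cmod q \<le> 1" unfolding q_def norm_of_real using r2 by simp
  have M: "0 \<le> M" using averaged_F'_bound(3)[of 0] R by simp
  define C where "C = (1 - r\<^sup>2) ^ 3 / (1 + r\<^sup>2)"
  have C: "0 < C" "C \<le> 1"
    unfolding C_def using r2 power_le_one[of "1 - r\<^sup>2" 3]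
    by (auto simp: divide_le_eq add_pos_nonneg intro: order_trans)
  \<comment> \<open>\<open>e\<close> and \<open>q\<close> involve z only through |z| = r and are
    frozen on the orbit; this makes \<open>S\<close> holomorphic in z.\<close>
  define S where "S z = (F z * (q * z\<^sup>2 / (\<zeta> - z)\<^sup>2 + 2 * z / (\<zeta> - z)) + B z * (z\<^sup>2 / (\<zeta> - z))) / e" for z
  define W where "W z = C * (\<zeta>\<^sup>2 / ((1 - cnj z * \<zeta>)\<^sup>2 * (\<zeta> - z)\<^sup>2)) *
      (F z + disc_moebius z \<zeta> * B z + (disc_moebius z \<zeta>)\<^sup>2 * \<psi> z (disc_moebius z \<zeta>))" for z
  have "G \<zeta> = mean3 (\<lambda>z. W z - S z) c"
    unfolding G_eq averaged_disc_def
  proof (rule mean3_cong)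
    fix z assume zo: "z \<in> orbit3 c"
    note z = orbit3_norm[OF zo]
    have z1: "cmod z < 1" "\<zeta> \<noteq> z" using z averaged_c \<zeta> by auto
    have zz: "z * cnj z = of_real (r\<^sup>2)" using z unfolding r_def by (metis complex_norm_square)
    have "W z = (1 - z * cnj z) ^ 3 * \<zeta>\<^sup>2 / ((1 + z * cnj z) * (1 - cnj z * \<zeta>)\<^sup>2 * (\<zeta> - z)\<^sup>2) *
        (F z + disc_moebius z \<zeta> * B z + (disc_moebius z \<zeta>)\<^sup>2 * \<psi> z (disc_moebius z \<zeta>))"
      unfolding W_def C_def zz by simp
    moreover have "e = 1 + z * cnj z" "q = 1 - z * cnj z" unfolding e_def q_def zz by simp_all
    ultimately show "ker0 z \<zeta> * \<psi> z (disc_moebius z \<zeta>) + ker1 z \<zeta> * F z + ker2 z \<zeta> * B z = W z - S z"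
      unfolding S_def using kernel_identity[OF _ z1(2) _ refl, of "\<psi> z (disc_moebius z \<zeta>)" "F z" "B z"]
        disc_moebius_denom_nonzero[OF z1(1), of \<zeta>] \<zeta> by simp
  qed
  also have "\<dots> = mean3 W c - mean3 S c" by (rule mean3_diff)
  finally have "cmod (G \<zeta>) \<le> cmod (mean3 W c) + cmod (mean3 S c)"
    using norm_triangle_ineq4 by simp
  moreover have "cmod (mean3 S c) \<le> 1536 * (3 + 4 * exp L / R) / R ^ 3 * M * cmod c ^ 3"
  proof -
    have "cmod (mean3 S c - S 0) \<le> 192 * ((3 + 4 * exp L / R) * M) / (R / 2) ^ 3 * cmod c ^ 3"
    proof (rule mean3_holomorphic)
      have d: "\<zeta> \<noteq> z" if "z \<in> ball 0 (R / 2)" for z using that \<zeta> R by auto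
      have "e \<noteq> 0" using e by auto
      thus "S holomorphic_on ball 0 (R / 2)" unfolding S_def
        using R d by (intro holomorphic_intros averaged_B_holomorphic holomorphic_on_subset[OF F]) auto
      fix z :: complex assume z: "z \<in> ball 0 (R / 2)"
      have zl: "cmod z \<le> 1 / 2" using z R by simp
      define X where "X = z / (\<zeta> - z)"
      have "1 / 2 \<le> cmod (\<zeta> - z)" using norm_triangle_ineq2[of \<zeta> z] \<zeta> zl by simp
      hence X: "cmod X \<le> 1" unfolding X_def norm_divide using zl by (simp add: divide_le_eq)
      have SX: "S z = (F z * (q * X\<^sup>2 + 2 * X) + B z * (z * X)) / e"
        unfolding S_def X_def by (simp add: power_divide power2_eq_square)
      have "cmod (q * X\<^sup>2) \<le> 1 * 1\<^sup>2"
        unfolding norm_mult norm_power using qle X by (intro mult_mono power_mono) auto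
      hence "cmod (q * X\<^sup>2 + 2 * X) \<le> 3"
        using X norm_triangle_ineq[of "q * X\<^sup>2" "2 * X"] by (simp add: norm_mult)
      hence 1: "cmod (F z * (q * X\<^sup>2 + 2 * X)) \<le> M * 3"
        unfolding norm_mult using FM[of z] z R M by (intro mult_mono) auto
      have "cmod (z * X) \<le> (1 / 2) * 1" unfolding norm_mult using zl X by (intro mult_mono) auto
      hence 2: "cmod (B z * (z * X)) \<le> 8 * exp L / R * M * (1 / 2)"
        unfolding norm_mult[of "B z"] using averaged_F'_bound(2)[OF z] M R by (intro mult_mono) auto
      have "cmod (S z) = cmod (F z * (q * X\<^sup>2 + 2 * X) + B z * (z * X)) / cmod e"
        unfolding SX by (simp add: norm_divide)
      also have "\<dots> \<le> cmod (F z * (q * X\<^sup>2 + 2 * X) + B z * (z * X)) / 1"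
        using e by (intro divide_left_mono) auto
      also have "\<dots> \<le> (3 + 4 * exp L / R) * M"
        using 1 2 norm_triangle_ineq[of "F z * (q * X\<^sup>2 + 2 * X)" "B z * (z * X)"] by (simp add: algebra_simps)
      finally show "cmod (S z) \<le> (3 + 4 * exp L / R) * M" .
    qed (rule averaged_c)
    moreover have "S 0 = 0" unfolding S_def by simp
    ultimately show ?thesis by (simp add: power_divide mult_ac)
  qed
  moreover have "cmod (mean3 W c) \<le> M * (1 + 92160 * r ^ 3)"
  proof -
    let ?w = "\<lambda>z. 1 / cmod (1 - cnj z * \<zeta>) ^ 4"
    have le: "cmod (W z) \<le> C * ?w z * M" if zo: "z \<in> orbit3 c" for z
    proof -
      note z = orbit3_norm[OF zo]
      have z1: "cmod z < 1" using z averaged_c by simp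
      have "cmod (\<zeta> - z) = cmod (1 - cnj z * \<zeta>)"
      proof -
        have "\<zeta> * cnj \<zeta> = 1" using \<zeta> by (metis complex_norm_square of_real_1 one_power2)
        hence "\<zeta> - z = \<zeta> * cnj (1 - cnj z * \<zeta>)" by (simp add: algebra_simps)
        thus ?thesis using \<zeta> by (simp add: norm_mult del: complex_cnj_diff complex_cnj_mult)
      qed
      hence A: "cmod (C * (\<zeta>\<^sup>2 / ((1 - cnj z * \<zeta>)\<^sup>2 * (\<zeta> - z)\<^sup>2))) = C * ?w z"
        using C \<zeta> by (simp add: norm_mult norm_divide norm_power flip: power_add)
      have B: "cmod (F z + disc_moebius z \<zeta> * B z + (disc_moebius z \<zeta>)\<^sup>2 * \<psi> z (disc_moebius z \<zeta>)) \<le> M"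
        using disc[OF zo disc_moebius_le[OF z1], of \<zeta>] \<zeta> by simp
      have "cmod (W z) = (C * ?w z) *
          cmod (F z + disc_moebius z \<zeta> * B z + (disc_moebius z \<zeta>)\<^sup>2 * \<psi> z (disc_moebius z \<zeta>))"
        unfolding W_def A[symmetric] by (rule norm_mult)
      also have "\<dots> \<le> (C * ?w z) * M" using B C by (intro mult_left_mono) auto
      finally show ?thesis .
    qed
    have "cmod (W c + W (root3 * c) + W (root3\<^sup>2 * c))
        \<le> C * ?w c * M + C * ?w (root3 * c) * M + C * ?w (root3\<^sup>2 * c) * M"
      by (intro order_trans[OF norm_triangle_ineq] add_mono le) (simp_all add: orbit3_def)
    hence "cmod (mean3 W c) \<le> (C * M) * ((?w c + ?w (root3 * c) + ?w (root3\<^sup>2 * c)) / 3)"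
      unfolding mean3_def by (simp add: norm_divide algebra_simps)
    also have "(?w c + ?w (root3 * c) + ?w (root3\<^sup>2 * c)) / 3 = Re (mean3 (\<lambda>z. of_real (?w z)) c)"
      unfolding mean3_def by simp
    also have "(C * M) * \<dots> \<le> (C * M) * ((1 + r\<^sup>2) / (1 - r\<^sup>2) ^ 3 + 92160 * r ^ 3)"
      using mean3_weight[OF _ r(1) \<zeta>] C M by (intro mult_left_mono) (auto simp: r_def)
    also have "\<dots> = M * (C * ((1 + r\<^sup>2) / (1 - r\<^sup>2) ^ 3) + C * (92160 * r ^ 3))"
      by (simp add: algebra_simps)
    also have "C * ((1 + r\<^sup>2) / (1 - r\<^sup>2) ^ 3) = 1"
    proof -
      have "1 - r\<^sup>2 \<noteq> 0" "1 + r\<^sup>2 \<noteq> 0" using r2 by (auto simp: add_nonneg_eq_0_iff)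
      thus ?thesis unfolding C_def by simp
    qed
    also have "M * (1 + C * (92160 * r ^ 3)) \<le> M * (1 + 1 * (92160 * r ^ 3))"
      using C r M by (intro mult_left_mono add_left_mono mult_right_mono) auto
    finally show ?thesis by simp
  qed
  ultimately show "cmod (G \<zeta>) \<le> M * (1 + (92160 + 1536 * (3 + 4 * exp L / R) / R ^ 3) * cmod c ^ 3)"
    unfolding r_def by (simp add: algebra_simps)
qed (use \<zeta> in auto)

end

text \<open>A common bound for the three error constants; depending on R and L alone, it is the same
  for all c, \<beta> and y.\<close>

definition averaging_const :: "real \<Rightarrow> real \<Rightarrow> real" where
  "averaging_const R L = 92160 + 64 / R\<^sup>2 + 1536 * (3 + 8 * exp L / R) / R ^ 3"

lemma averaging_const_ge:
  assumes "0 < R"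
  shows "92160 + 1536 * (3 + 4 * exp L / R) / R ^ 3 \<le> averaging_const R L"
    "1536 * (1 + 8 * exp L / R) / R ^ 3 \<le> averaging_const R L"
    "1536 * (8 * exp L / R) / R ^ 3 + 64 / R\<^sup>2 \<le> averaging_const R L"
    "0 < averaging_const R L"
proof -
  have mono: "1536 * x / R ^ 3 \<le> 1536 * y / R ^ 3" if "x \<le> y" for x y
    using that assms by (intro divide_right_mono) auto
  have e: "4 * exp L / R \<le> 8 * exp L / R" using assms by (intro divide_right_mono) auto
  have p: "0 \<le> 64 / R\<^sup>2" by simp
  show "92160 + 1536 * (3 + 4 * exp L / R) / R ^ 3 \<le> averaging_const R L"
    unfolding averaging_const_def using mono[of "3 + 4 * exp L / R" "3 + 8 * exp L / R"] e p by linarith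
  show "1536 * (1 + 8 * exp L / R) / R ^ 3 \<le> averaging_const R L"
    unfolding averaging_const_def using mono[of "1 + 8 * exp L / R" "3 + 8 * exp L / R"] p by linarith
  show "1536 * (8 * exp L / R) / R ^ 3 + 64 / R\<^sup>2 \<le> averaging_const R L"
    unfolding averaging_const_def using mono[of "8 * exp L / R" "3 + 8 * exp L / R"] by linarith
  have "0 \<le> 1536 * (3 + 8 * exp L / R) / R ^ 3" using assms by (intro divide_nonneg_nonneg) auto
  thus "0 < averaging_const R L" unfolding averaging_const_def using p by linarith
qed

section \<open>The vector-valued averaged disc\<close>

context dual_banach
begin

text \<open>Two divisions by w. Each singularity is removable for the tested functions, but the
  value at 0 has to be a vector: the first is the derivative of \<phi>, the second that of
  \<open>g\<close>, which the weak criterion supplies once \<open>g\<close> is bounded near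
  0.\<close>

lemma disc_quotient:
  fixes \<phi> :: "complex \<Rightarrow> 'a"
  assumes \<phi>: "\<phi> \<in> holomorphic_maps (ball 0 T) (ball 0 1)" and T: "0 < T"
  obtains \<psi> where "\<And>w. \<phi> w = \<phi> 0 + w *\<^sub>C complex_deriv \<phi> 0 + w\<^sup>2 *\<^sub>C \<psi> w"
    "\<And>y. (\<lambda>w. J (\<psi> w) y) holomorphic_on ball 0 T"
proof -
  let ?b = "complex_deriv \<phi> 0"
  define g where "g w = (if w = 0 then ?b else (1 / w) *\<^sub>C (\<phi> w - \<phi> 0))" for w
  have hol: "(\<lambda>w. J (\<phi> w) y) holomorphic_on ball 0 T" for y by (rule holomorphic_maps_J[OF \<phi>])
  have Jg: "(\<lambda>w. J (g w) y) = (\<lambda>w. if w = 0 then deriv (\<lambda>w. J (\<phi> w) y) 0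
      else (J (\<phi> w) y - J (\<phi> 0) y) / (w - 0))" for y
    using deriv_J[OF \<phi>, of 0] T by (auto simp: g_def J_simps)
  have g_hol: "(\<lambda>w. J (g w) y) holomorphic_on ball 0 T" for y
    unfolding Jg by (rule pole_lemma[OF hol]) (use T in auto)
  have g_bd: "norm (g w) \<le> norm ?b + 32 / T\<^sup>2 * (T / 2)" if w: "w \<in> ball 0 (T / 2)" for w
  proof (cases "w = 0")
    case False
    have est: "norm (\<phi> w - \<phi> 0 - (w - 0) *\<^sub>C ?b) \<le> 32 * 1 / T\<^sup>2 * (cmod (w - 0))\<^sup>2"
      using holomorphic_mapsD(2)[OF \<phi>] w T
      by (intro holomorphic_maps_estimates(2)[OF \<phi> T]) (auto intro!: less_imp_le)
    have "g w = ?b + (1 / w) *\<^sub>C (\<phi> w - \<phi> 0 - w *\<^sub>C ?b)"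
      unfolding g_def using False
      by (intro J_inject) (simp add: J_simps field_simps)
    hence "norm (g w) \<le> norm ?b + norm (\<phi> w - \<phi> 0 - w *\<^sub>C ?b) / cmod w"
      using norm_triangle_ineq[of ?b "(1 / w) *\<^sub>C (\<phi> w - \<phi> 0 - w *\<^sub>C ?b)"]
      by (simp add: norm_scaleC norm_divide)
    also have "norm (\<phi> w - \<phi> 0 - w *\<^sub>C ?b) / cmod w \<le> 32 / T\<^sup>2 * (cmod w)\<^sup>2 / cmod w"
      using est by (intro divide_right_mono) auto
    also have "\<dots> = 32 / T\<^sup>2 * cmod w" using False by (simp add: power2_eq_square)
    also have "\<dots> \<le> 32 / T\<^sup>2 * (T / 2)" using w by (intro mult_left_mono) auto
    finally show ?thesis by simp
  qed (use T in \<open>simp add: g_def\<close>)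
  obtain v where v: "has_complex_derivative g v 0"
  proof -
    have "(\<lambda>w. J (g w) y) holomorphic_on ball 0 (T / 2)" for y
      by (rule holomorphic_on_subset[OF g_hol]) (use T in auto)
    from has_complex_derivative_weakI[OF _ g_bd this] show thesis using that T by auto
  qed
  define \<psi> where "\<psi> w = (if w = 0 then v else (1 / w) *\<^sub>C (g w - g 0))" for w
  show thesis
  proof (rule that)
    show "\<phi> w = \<phi> 0 + w *\<^sub>C ?b + w\<^sup>2 *\<^sub>C \<psi> w" for w
      by (intro J_inject) (auto simp: J_simps \<psi>_def g_def power2_eq_square field_simps)
    have J\<psi>: "(\<lambda>w. J (\<psi> w) y) = (\<lambda>w. if w = 0 then deriv (\<lambda>w. J (g w) y) 0
        else (J (g w) y - J (g 0) y) / (w - 0))" for y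
      using DERIV_imp_deriv[OF has_field_derivative_J[OF v], of y] by (auto simp: \<psi>_def J_simps)
    show "(\<lambda>w. J (\<psi> w) y) holomorphic_on ball 0 T" for y
      unfolding J\<psi> by (rule pole_lemma[OF g_hol]) (use T in auto)
  qed
qed

text \<open>Testing \<open>\<Phi>\<close> against y gives the scalar \<open>averaged_disc\<close>
  with M = \<open>norm y\<close>, so every scalar bound becomes a norm bound. Differentiability of
  \<open>\<Phi>\<close> again follows from the weak criterion.\<close>

lemma averaged_disc_ex:
  fixes F :: "complex \<Rightarrow> 'a" and \<beta> :: real and a c :: complex
  assumes F: "F \<in> holomorphic_maps (ball 0 R) (ball 0 1)" and R: "0 < R" "R \<le> 1"
    and a: "cmod a \<le> L" and \<beta>: "cmod \<beta> \<le> 2" and c: "cmod c < R / 4" and \<tau>: "1 < \<tau>"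
    and discs: "\<And>z. z \<in> orbit3 c \<Longrightarrow> \<exists>\<phi>\<in>holomorphic_maps (ball 0 \<tau>) (ball 0 1).
      \<phi> 0 = F z \<and> complex_deriv \<phi> 0 = (\<beta> * exp (- a * z)) *\<^sub>C complex_deriv F z"
  obtains \<Phi> where "\<And>z. z \<in> ball 0 1 \<Longrightarrow> \<exists>v. has_complex_derivative \<Phi> v z"
    "\<And>z. z \<in> ball 0 1 \<Longrightarrow> norm (\<Phi> z) \<le> 1 + averaging_const R L * cmod c ^ 3"
    "norm (\<Phi> 0 - F 0) \<le> averaging_const R L * cmod c ^ 3"
    "norm (complex_deriv \<Phi> 0 - ((2 * (cmod c)\<^sup>2 + \<beta>) / (1 + (cmod c)\<^sup>2)) *\<^sub>R complex_deriv F 0)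
      \<le> averaging_const R L * cmod c ^ 3"
proof -
  define \<mu> where "\<mu> = (2 * (cmod c)\<^sup>2 + \<beta>) / (1 + (cmod c)\<^sup>2)"
  define K where "K = averaging_const R L"
  let ?r3 = "cmod c ^ 3"
  define Q where "Q z \<psi> \<longleftrightarrow> (\<forall>y. (\<lambda>w. J (\<psi> w) y) holomorphic_on ball 0 \<tau>) \<and>
      (\<forall>w. cmod w \<le> 1 \<longrightarrow> norm (F z + w *\<^sub>C (\<beta> * exp (- a * z)) *\<^sub>C complex_deriv F z + w\<^sup>2 *\<^sub>C \<psi> w) \<le> 1)"
    for z :: complex and \<psi>
  have "\<exists>\<psi>. Q z \<psi>" if "z \<in> orbit3 c" for z
  proof -
    from discs[OF that] obtain \<phi> where \<phi>: "\<phi> \<in> holomorphic_maps (ball 0 \<tau>) (ball 0 1)"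
      "\<phi> 0 = F z" "complex_deriv \<phi> 0 = (\<beta> * exp (- a * z)) *\<^sub>C complex_deriv F z" by blast
    obtain \<psi> where \<psi>: "\<And>w. \<phi> w = \<phi> 0 + w *\<^sub>C complex_deriv \<phi> 0 + w\<^sup>2 *\<^sub>C \<psi> w"
      "\<And>y. (\<lambda>w. J (\<psi> w) y) holomorphic_on ball 0 \<tau>"
      using disc_quotient[OF \<phi>(1)] \<tau> by auto
    have "norm (F z + w *\<^sub>C (\<beta> * exp (- a * z)) *\<^sub>C complex_deriv F z + w\<^sup>2 *\<^sub>C \<psi> w) \<le> 1"
      if "cmod w \<le> 1" for w
    proof -
      have "norm (\<phi> w) \<le> 1" using holomorphic_mapsD(2)[OF \<phi>(1), of w] that \<tau> by simp
      thus ?thesis using \<psi>(1)[of w] unfolding \<phi>(2,3) by (simp only:)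
    qed
    with \<psi>(2) show ?thesis unfolding Q_def by blast
  qed
  then obtain \<psi> where "\<And>z. z \<in> orbit3 c \<Longrightarrow> Q z (\<psi> z)" by metis
  hence \<psi>_hol: "\<And>z y. z \<in> orbit3 c \<Longrightarrow> (\<lambda>w. J (\<psi> z w) y) holomorphic_on ball 0 \<tau>"
    and \<psi>_le: "\<And>z w. z \<in> orbit3 c \<Longrightarrow> cmod w \<le> 1 \<Longrightarrow>
      norm (F z + w *\<^sub>C (\<beta> * exp (- a * z)) *\<^sub>C complex_deriv F z + w\<^sup>2 *\<^sub>C \<psi> z w) \<le> 1"
    unfolding Q_def by blast+
  define P where "P z \<zeta> = ker0 z \<zeta> *\<^sub>C \<psi> z (disc_moebius z \<zeta>) + ker1 z \<zeta> *\<^sub>C F z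
      + ker2 z \<zeta> *\<^sub>C (\<beta> * exp (- a * z)) *\<^sub>C complex_deriv F z" for z \<zeta> :: complex
  define \<Phi> where "\<Phi> \<zeta> = (1 / 3) *\<^sub>C (P c \<zeta> + P (root3 * c) \<zeta> + P (root3\<^sup>2 * c) \<zeta>)" for \<zeta>
  let ?F = "\<lambda>y z. J (F z) y"
  let ?G = "\<lambda>y. averaged_disc (\<lambda>z w. J (\<psi> z w) y) (?F y) (\<lambda>z. \<beta> * exp (- a * z) * deriv (?F y) z) c"
  have dF: "deriv (?F y) z = J (complex_deriv F z) y" if "z \<in> ball 0 R" for y z
    by (rule deriv_J[OF F that])
  have orbit_R: "z \<in> ball 0 R" if "z \<in> orbit3 c" for z
    using orbit3_norm[OF that] c R by simp
  have J\<Phi>: "(\<lambda>\<zeta>. J (\<Phi> \<zeta>) y) = ?G y" for y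
  proof
    fix \<zeta>
    have "J (\<Phi> \<zeta>) y = mean3 (\<lambda>z. J (P z \<zeta>) y) c"
      unfolding \<Phi>_def mean3_def by (simp add: J_simps)
    also have "\<dots> = ?G y \<zeta>"
      unfolding averaged_disc_def
      by (rule mean3_cong) (simp add: P_def J_simps dF[OF orbit_R] mult_ac)
    finally show "J (\<Phi> \<zeta>) y = ?G y \<zeta>" .
  qed
  have FM: "cmod (?F y z) \<le> norm y" if "z \<in> ball 0 R" for y z
    using J_le[of "F z" y] holomorphic_mapsD(2)[OF F that]
    by (smt (verit) mem_ball_0 mult_left_le_one_le norm_ge_zero)
  have disc: "cmod (?F y z + w * (\<beta> * exp (- a * z) * deriv (?F y) z) + w\<^sup>2 * J (\<psi> z w) y) \<le> norm y"
    if "z \<in> orbit3 c" "cmod w \<le> 1" for y z w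
  proof -
    have "cmod (J (F z + w *\<^sub>C (\<beta> * exp (- a * z)) *\<^sub>C complex_deriv F z + w\<^sup>2 *\<^sub>C \<psi> z w) y) \<le> 1 * norm y"
      using J_le \<psi>_le[OF that] by (meson mult_right_mono norm_ge_zero order_trans)
    thus ?thesis by (simp add: J_simps dF[OF orbit_R] that)
  qed
  note avg = refl refl R a \<beta> c holomorphic_maps_J[OF F] FM \<tau> \<psi>_hol disc
  note Kge = averaging_const_ge[OF R(1), of L, folded K_def]
  have le: "x * norm y * ?r3 \<le> K * ?r3 * norm y" if "x \<le> K" for x and y :: 'b
    using that by (simp add: mult_right_mono mult_ac)
  have \<Phi>_le: "norm (\<Phi> \<zeta>) \<le> 1 + K * ?r3" if \<zeta>: "\<zeta> \<in> ball 0 1" for \<zeta>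
  proof (rule norm_le_J)
    fix y
    have "cmod (?G y \<zeta>) \<le> norm y * (1 + (92160 + 1536 * (3 + 4 * exp L / R) / R ^ 3) * ?r3)"
      by (rule averaged_disc_bound[OF avg]) (use \<zeta> in auto)
    also have "\<dots> \<le> norm y * (1 + K * ?r3)"
      using Kge(1) by (intro mult_left_mono add_left_mono mult_right_mono) auto
    finally show "cmod (J (\<Phi> \<zeta>) y) \<le> (1 + K * ?r3) * norm y"
      using fun_cong[OF J\<Phi>[of y], of \<zeta>] by (simp add: mult_ac)
  qed (use Kge(4) in simp)
  have \<Phi>_hol: "(\<lambda>\<zeta>. J (\<Phi> \<zeta>) y) holomorphic_on cball 0 1" for y
    unfolding J\<Phi> by (rule averaged_disc_holomorphic[OF avg])
  have der: "\<exists>v. has_complex_derivative \<Phi> v z" if z: "z \<in> ball 0 1" for z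
  proof -
    have sub: "ball z (1 - cmod z) \<subseteq> ball 0 1" by (rule ball_subset_unit_disc)
    have "(\<lambda>\<zeta>. J (\<Phi> \<zeta>) y) holomorphic_on ball z (1 - cmod z)" for y
      by (rule holomorphic_on_subset[OF \<Phi>_hol]) (use sub in auto)
    from has_complex_derivative_weakI[OF _ \<Phi>_le[OF subsetD[OF sub]] this] z
    show ?thesis by auto
  qed
  have \<Phi>_0: "norm (\<Phi> 0 - F 0) \<le> K * ?r3"
  proof (rule norm_le_J)
    fix y
    have "cmod (?G y 0 - ?F y 0) \<le> 1536 * (1 + 8 * exp L / R) / R ^ 3 * norm y * ?r3"
      by (rule averaged_disc_0[OF avg])
    also have "\<dots> \<le> K * ?r3 * norm y" by (rule le[OF Kge(2)])
    finally show "cmod (J (\<Phi> 0 - F 0) y) \<le> K * ?r3 * norm y"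
      using fun_cong[OF J\<Phi>[of y], of 0] by (simp add: J_simps)
  qed (use Kge(4) in simp)
  have \<Phi>_deriv: "norm (complex_deriv \<Phi> 0 - of_real \<mu> *\<^sub>C complex_deriv F 0) \<le> K * ?r3"
  proof (rule norm_le_J)
    fix y
    obtain v where v: "has_complex_derivative \<Phi> v 0" using der[of 0] by auto
    have "deriv (\<lambda>\<zeta>. J (\<Phi> \<zeta>) y) 0 = J (complex_deriv \<Phi> 0) y"
      using DERIV_imp_deriv[OF has_field_derivative_J[OF v]] complex_deriv_eqI[OF v] by simp
    hence "deriv (?G y) 0 = J (complex_deriv \<Phi> 0) y" unfolding J\<Phi> .
    hence "J (complex_deriv \<Phi> 0 - of_real \<mu> *\<^sub>C complex_deriv F 0) y
        = deriv (?G y) 0 - of_real \<mu> * deriv (?F y) 0"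
      using R dF[of 0 y] by (simp only: J_simps centre_in_ball)
    also have "cmod \<dots> \<le> (1536 * (8 * exp L / R) / R ^ 3 + 64 / R\<^sup>2) * norm y * ?r3"
      using averaged_disc_deriv_0[OF avg]
      by (simp only: \<mu>_def of_real_divide of_real_add of_real_mult of_real_power of_real_1 of_real_numeral)
    also have "\<dots> \<le> K * ?r3 * norm y" by (rule le[OF Kge(3)])
    finally show "cmod (J (complex_deriv \<Phi> 0 - of_real \<mu> *\<^sub>C complex_deriv F 0) y) \<le> K * ?r3 * norm y" .
  qed (use Kge(4) in simp)
  show thesis
    by (rule that[of \<Phi>, OF der \<Phi>_le[unfolded K_def] \<Phi>_0[unfolded K_def]
      \<Phi>_deriv[unfolded K_def \<mu>_def scaleC_of_real]])
qed

end

section \<open>The sub-mean value inequality\<close>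

text \<open>A real function on three points has a constant mode and one conjugate pair of Fourier
  modes; \<open>a * c\<close> is 2/3 of the unnormalised first coefficient, the conjugates of
  \<open>root3\<close> being its inverse powers. The division by c is harmless only for B =
  O(|c|).\<close>

lemma orbit3_interpolation:
  assumes c: "c \<noteq> 0" and u: "\<And>z. z \<in> orbit3 c \<Longrightarrow> \<bar>u z\<bar> \<le> B"
  obtains a where "cmod a \<le> 2 * B / cmod c"
    "\<And>z. z \<in> orbit3 c \<Longrightarrow> Re (a * z) = u z - (u c + u (root3 * c) + u (root3\<^sup>2 * c)) / 3"
proof -
  define a where "a = of_real (2 / 3) *
    (of_real (u c) + of_real (u (root3 * c)) * cnj root3 + of_real (u (root3\<^sup>2 * c)) * cnj (root3\<^sup>2)) / c"
  have "cmod (of_real (u c) + of_real (u (root3 * c)) * cnj root3 + of_real (u (root3\<^sup>2 * c)) * cnj (root3\<^sup>2))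
      \<le> \<bar>u c\<bar> + \<bar>u (root3 * c)\<bar> + \<bar>u (root3\<^sup>2 * c)\<bar>"
    by (intro order_trans[OF norm_triangle_ineq] add_mono) (simp_all add: norm_mult norm_power)
  also have "\<dots> \<le> 3 * B"
    using u[of c] u[of "root3 * c"] u[of "root3\<^sup>2 * c"] by (simp add: orbit3_def)
  finally have "cmod a \<le> 2 / 3 * (3 * B) / cmod c"
    unfolding a_def norm_divide norm_mult norm_of_real by (intro divide_right_mono mult_left_mono) auto
  hence 1: "cmod a \<le> 2 * B / cmod c" by simp
  have 2: "Re (a * z) = u z - (u c + u (root3 * c) + u (root3\<^sup>2 * c)) / 3" if "z \<in> orbit3 c" for z
  proof -
    have "\<exists>x\<in>{1, root3, root3\<^sup>2}. z = x * c"
      using that unfolding orbit3_def by auto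
    then obtain x where x: "x \<in> {1, root3, root3\<^sup>2}" "z = x * c" by blast
    have az: "a * z = of_real (2 / 3) * (of_real (u c) + of_real (u (root3 * c)) * cnj root3
        + of_real (u (root3\<^sup>2 * c)) * cnj (root3\<^sup>2)) * x"
      unfolding a_def x(2) using c by simp
    have sq: "root3\<^sup>2 = Complex (- 1 / 2) (- sqrt 3 / 2)"
      unfolding root3_eq by (simp add: complex_eq_iff power2_eq_square)
    define u0 u1 u2 where "u0 = u c" and "u1 = u (root3 * c)" and "u2 = u (root3\<^sup>2 * c)"
    have "Re (a * z) = u z - (u0 + u1 + u2) / 3"
    proof -
      have uz: "u z = (if x = 1 then u0 else if x = root3 then u1 else u2)"
        using x unfolding u0_def u1_def u2_def by auto
      have ne: "root3 \<noteq> 1" "root3\<^sup>2 \<noteq> 1" "root3\<^sup>2 \<noteq> root3"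
        unfolding sq unfolding root3_eq by (simp_all add: complex_eq_iff)
      show ?thesis
        using x(1) unfolding az uz u0_def[symmetric] u1_def[symmetric] u2_def[symmetric]
        using ne by (auto simp: sq) (auto simp: root3_eq field_simps)
    qed
    thus ?thesis unfolding u0_def u1_def u2_def .
  qed
  show thesis using that[OF 1 2] .
qed

context dual_banach
begin

lemma log_kobayashi_metric_mean3:
  fixes F :: "complex \<Rightarrow> 'a"
  defines "u \<equiv> \<lambda>z. ln (kobayashi_metric (ball 0 1) (F z) (complex_deriv F z))"
  assumes F: "F \<in> holomorphic_maps (ball 0 R0) (ball 0 1)" and R0: "0 < R0"
    and k1: "kobayashi_metric (ball 0 1) (F 0) (complex_deriv F 0) = 1" and v: "complex_deriv F 0 \<noteq> 0"
  obtains \<rho> K where "0 < \<rho>" "\<And>c. c \<noteq> 0 \<Longrightarrow> cmod c < \<rho> \<Longrightarrow>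
    (cmod c)\<^sup>2 - K * cmod c ^ 3 \<le> (u c + u (root3 * c) + u (root3\<^sup>2 * c)) / 3"
proof -
  let ?k = "\<lambda>z. kobayashi_metric (ball 0 1) (F z) (complex_deriv F z)"
  obtain \<rho>0 L0 where \<rho>0: "0 < \<rho>0" "\<rho>0 \<le> R0" "0 \<le> L0" and nz: "\<And>z. cmod z < \<rho>0 \<Longrightarrow> complex_deriv F z \<noteq> 0"
    and lip: "\<And>z w. cmod z < \<rho>0 \<Longrightarrow> cmod w < \<rho>0 \<Longrightarrow> \<bar>u z - u w\<bar> \<le> L0 * cmod (z - w)"
    using kobayashi_metric_log_lipschitz[OF F R0 v] unfolding u_def by metis
  define R where "R = min \<rho>0 1"
  have R: "0 < R" "R \<le> 1" "R \<le> \<rho>0" unfolding R_def using \<rho>0 by auto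
  have FR: "F \<in> holomorphic_maps (ball 0 R) (ball 0 1)"
  proof -
    have "ball (0::complex) R \<subseteq> ball 0 R0" using R \<rho>0 by auto
    thus ?thesis using F unfolding holomorphic_maps_def by blast
  qed
  have F1: "norm (F z) < 1" if "cmod z < R" for z
    using holomorphic_mapsD(2)[OF FR, of z] that by simp
  define d where "d = 1 - norm (F 0)"
  have d: "0 < d" unfolding d_def using F1[of 0] R by simp
  define L where "L = 2 * L0"
  define K0 where "K0 = averaging_const R L"
  have K0: "0 < K0" unfolding K0_def using averaging_const_ge(4) R by blast
  \<comment> \<open>R/4 is the range of the averaging estimates; the second bound forces |m| \<le>
    1/2, hence \<open>exp (- m)\<close> \<le> 2, as required of \<beta>.\<close>
  define \<rho> where "\<rho> = min (R / 4) (1 / (2 * (L0 + 1)))"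
  have \<rho>: "0 < \<rho>" unfolding \<rho>_def using R \<rho>0 by simp
  \<comment> \<open>12 = 3 * 2 * 2: the perturbation loss is 3 \<epsilon> / d with \<epsilon> = 2 K0
    r^3, multiplied by 1 + r^2 \<le> 2.\<close>
  define K where "K = 12 * K0 / d"
  show thesis
  proof (rule that[OF \<rho>])
    fix c :: complex assume c0: "c \<noteq> 0" and c: "cmod c < \<rho>"
    define r where "r = cmod c"
    have r: "0 < r" "r < R / 4" "r < 1 / (2 * (L0 + 1))" using c c0 unfolding r_def \<rho>_def by auto
    define m where "m = (u c + u (root3 * c) + u (root3\<^sup>2 * c)) / 3"
    have u0: "u 0 = 0" unfolding u_def using k1 by simp
    have orbit: "cmod z = r" "cmod z < R" "cmod z < \<rho>0" if "z \<in> orbit3 c" for z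
      using orbit3_norm[OF that] r R unfolding r_def by auto
    have ub: "\<bar>u z\<bar> \<le> L0 * r" if z: "z \<in> orbit3 c" for z
      using lip[of z 0] orbit[OF z] \<rho>0 u0 by simp
    obtain a where a: "cmod a \<le> 2 * (L0 * r) / cmod c"
      and az: "\<And>z. z \<in> orbit3 c \<Longrightarrow> Re (a * z) = u z - m"
      using orbit3_interpolation[of c u "L0 * r", OF c0 ub] unfolding m_def by blast
    have aL: "cmod a \<le> L" using a r unfolding L_def r_def by simp
    have m_abs: "\<bar>m\<bar> \<le> 1 / 2"
    proof -
      have "\<bar>m\<bar> \<le> L0 * r"
        using ub[of c] ub[of "root3 * c"] ub[of "root3\<^sup>2 * c"] unfolding m_def by (simp add: orbit3_def abs_le_iff)
      also have "\<dots> \<le> (L0 + 1) * r" using r by simp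
      also have "\<dots> \<le> (L0 + 1) * (1 / (2 * (L0 + 1)))" using r \<rho>0 by (intro mult_left_mono) auto
      also have "\<dots> = 1 / 2" using \<rho>0 by simp
      finally show ?thesis .
    qed
    \<comment> \<open>The slack s lets the discs extend to radius 1/s > 1; letting s tend to 1
      removes it at the end.\<close>
    have main: "s * exp (- m) \<le> 1 - r\<^sup>2 + K * r ^ 3" if s: "0 < s" "s < 1" for s
    proof -
      define \<beta> where "\<beta> = s * exp (- m)"
      have \<beta>0: "0 < \<beta>" unfolding \<beta>_def using s by simp
      have "exp (- m) \<le> 2"
      proof -
        have "exp (- m) \<le> exp (1 / 2)" using m_abs by simp
        also have "exp (1 / 2 :: real) \<le> 1 + 1 / 2 + (1 / 2)\<^sup>2" by (rule exp_bound) auto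
        also have "\<dots> \<le> 2" by (simp add: power2_eq_square)
        finally show ?thesis .
      qed
      hence "s * exp (- m) \<le> 1 * 2" using s by (intro mult_mono) auto
      hence \<beta>: "cmod (of_real \<beta>) \<le> 2" unfolding norm_of_real using \<beta>0 unfolding \<beta>_def by simp
      have discs: "\<exists>\<phi>\<in>holomorphic_maps (ball 0 (1 / s)) (ball 0 1).
          \<phi> 0 = F z \<and> complex_deriv \<phi> 0 = (\<beta> * exp (- a * z)) *\<^sub>C complex_deriv F z"
        if z: "z \<in> orbit3 c" for z
      proof -
        obtain \<phi> where k: "0 < ?k z" and \<phi>: "\<phi> \<in> holomorphic_maps (ball 0 1) (ball 0 1)" "\<phi> 0 = F z"
          "?k z *\<^sub>R complex_deriv \<phi> 0 = complex_deriv F z"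
          using extremal_disc_ex[OF F1 nz] orbit[OF z] by blast
        \<comment> \<open>\<open>ln k\<close> at z is u z = m + Re (a * z), so the moduli cancel to
          |\<kappa>| = s: the extremal disc precomposed with multiplication by \<kappa> has the
          prescribed holomorphic direction factor.\<close>
        define \<kappa> where "\<kappa> = ?k z * \<beta> * exp (- a * z)"
        have "?k z = exp (u z)" unfolding u_def using k by simp
        hence "cmod \<kappa> = exp (u z) * \<beta> * exp (- Re (a * z))"
          unfolding \<kappa>_def norm_mult norm_of_real using \<beta>0 by simp
        also have "\<dots> = s" unfolding az[OF z] \<beta>_def by (simp flip: exp_add)
        finally have \<kappa>: "cmod \<kappa> = s" .
        have in_ball: "\<kappa> * w \<in> ball 0 1" if "w \<in> ball 0 (1 / s)" for w
          using that s \<kappa> by (simp add: norm_mult field_simps)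
        have der: "has_complex_derivative (\<lambda>w. \<phi> (\<kappa> * w)) (\<kappa> *\<^sub>C complex_deriv \<phi> (\<kappa> * w)) w"
          if "w \<in> ball 0 (1 / s)" for w
          by (intro has_complex_derivative_chain[where g = "\<lambda>w. \<kappa> * w"] holomorphic_mapsD(1)[OF \<phi>(1)] in_ball that)
            (auto intro!: derivative_eq_intros)
        have "(\<lambda>w. \<phi> (\<kappa> * w)) \<in> holomorphic_maps (ball 0 (1 / s)) (ball 0 1)"
          unfolding holomorphic_maps_def
        proof (intro CollectI conjI ballI image_subsetI)
          fix w :: complex assume w: "w \<in> ball 0 (1 / s)"
          show "\<exists>v. has_complex_derivative (\<lambda>w. \<phi> (\<kappa> * w)) v w" using der[OF w] by blast
          show "\<phi> (\<kappa> * w) \<in> ball 0 1" by (rule holomorphic_mapsD(2)[OF \<phi>(1) in_ball[OF w]])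
        qed
        moreover have "complex_deriv (\<lambda>w. \<phi> (\<kappa> * w)) 0 = \<kappa> *\<^sub>C complex_deriv \<phi> 0"
          using complex_deriv_eqI[OF der[of 0]] s by simp
        moreover have "\<dots> = (\<beta> * exp (- a * z)) *\<^sub>C (?k z *\<^sub>R complex_deriv \<phi> 0)"
          unfolding scaleC_of_real[symmetric] scaleC_scaleC \<kappa>_def by (simp add: mult_ac)
        moreover have "\<dots> = (\<beta> * exp (- a * z)) *\<^sub>C complex_deriv F z" unfolding \<phi>(3) ..
        ultimately show ?thesis using \<phi>(2) by (intro bexI[of _ "\<lambda>w. \<phi> (\<kappa> * w)"]) auto
      qed
      obtain \<Phi> where \<Phi>: "\<And>z. z \<in> ball 0 1 \<Longrightarrow> \<exists>v. has_complex_derivative \<Phi> v z"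
        "\<And>z. z \<in> ball 0 1 \<Longrightarrow> norm (\<Phi> z) \<le> 1 + K0 * r ^ 3"
        "norm (\<Phi> 0 - F 0) \<le> K0 * r ^ 3"
        "norm (complex_deriv \<Phi> 0 - ((2 * r\<^sup>2 + \<beta>) / (1 + r\<^sup>2)) *\<^sub>R complex_deriv F 0) \<le> K0 * r ^ 3"
        using averaged_disc_ex[OF FR R(1,2) aL \<beta> _ _ discs] r s unfolding r_def K0_def by auto
      \<comment> \<open>Doubling the error bound makes the inclusion in the open ball of radius 1 +
        \<epsilon> strict.\<close>
      define \<epsilon> where "\<epsilon> = 2 * K0 * r ^ 3"
      have \<epsilon>: "K0 * r ^ 3 < \<epsilon>" "0 < \<epsilon>" unfolding \<epsilon>_def using K0 r by auto
      have "\<Phi> \<in> holomorphic_maps (ball 0 1) (ball 0 (1 + \<epsilon>))"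
        unfolding holomorphic_maps_def using \<Phi>(1,2) \<epsilon> by force
      moreover have "norm (\<Phi> 0 - F 0) \<le> \<epsilon>"
        "norm (complex_deriv \<Phi> 0 - ((2 * r\<^sup>2 + \<beta>) / (1 + r\<^sup>2)) *\<^sub>R complex_deriv F 0) \<le> \<epsilon>"
        using \<Phi>(3,4) \<epsilon>(1) by linarith+
      moreover have "0 < (2 * r\<^sup>2 + \<beta>) / (1 + r\<^sup>2)"
        using \<beta>0 by (intro divide_pos_pos add_nonneg_pos add_pos_nonneg) auto
      ultimately have "kobayashi_metric (ball 0 1) (F 0) (complex_deriv F 0)
          \<le> (1 + 3 * \<epsilon> / (1 - norm (F 0))) / ((2 * r\<^sup>2 + \<beta>) / (1 + r\<^sup>2))"
        using \<epsilon>(2) F1[of 0] R by (intro kobayashi_metric_perturb) simp_all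
      hence "1 \<le> (1 + 3 * \<epsilon> / d) * (1 + r\<^sup>2) / (2 * r\<^sup>2 + \<beta>)" unfolding k1 d_def by simp
      moreover have pos: "0 < 2 * r\<^sup>2 + \<beta>" using \<beta>0 by (simp add: add_nonneg_pos)
      ultimately have "2 * r\<^sup>2 + \<beta> \<le> (1 + 3 * \<epsilon> / d) * (1 + r\<^sup>2)" by (simp add: pos_le_divide_eq)
      also have "\<dots> = 1 + r\<^sup>2 + 3 * \<epsilon> / d * (1 + r\<^sup>2)" by (simp add: algebra_simps)
      also have "\<dots> \<le> 1 + r\<^sup>2 + 3 * \<epsilon> / d * 2"
      proof (intro add_left_mono mult_left_mono)
        have "r\<^sup>2 \<le> 1" using r R by (simp add: abs_square_le_1)
        thus "1 + r\<^sup>2 \<le> 2" by simp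
      qed (use \<epsilon> d in simp)
      also have "3 * \<epsilon> / d * 2 = K * r ^ 3" unfolding K_def \<epsilon>_def by simp
      finally show ?thesis unfolding \<beta>_def by simp
    qed
    have "exp (- m) \<le> 1 - r\<^sup>2 + K * r ^ 3" by (rule field_le_mult_one_interval[OF main])
    moreover have "1 + (- m) \<le> exp (- m)" by (rule exp_ge_add_one_self)
    ultimately show "(cmod c)\<^sup>2 - K * cmod c ^ 3 \<le> (u c + u (root3 * c) + u (root3\<^sup>2 * c)) / 3"
      unfolding r_def m_def by linarith
  qed
qed

end

section \<open>The generalised Laplacian\<close>

lemma ereal_integral_ereal:
  assumes g: "integrable M g"
  shows "ereal_integral M (\<lambda>x. ereal (g x)) = ereal (integral\<^sup>L M g)"
proof -
  have fin: "(\<integral>\<^sup>+ x. ennreal (g x) \<partial>M) \<noteq> \<infinity>" "(\<integral>\<^sup>+ x. ennreal (- g x) \<partial>M) \<noteq> \<infinity>"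
    using g unfolding real_integrable_def by auto
  have "enn2ereal A = ereal (enn2real A)" if "A \<noteq> \<infinity>" for A
    using that by (cases A) auto
  thus ?thesis
    unfolding ereal_integral_def real_lebesgue_integral_def[OF g] using fin by simp
qed

lemma ereal_integral_continuous:
  assumes "continuous_on {0..2 * pi} g"
  shows "ereal_integral (restrict_space lborel {0..2 * pi}) (\<lambda>\<theta>. ereal (g \<theta>)) = ereal (integral {0..2 * pi} g)"
proof -
  have S: "set_integrable lborel {0..2 * pi} g"
    by (rule borel_integrable_atLeastAtMost'[OF assms])
  have "integrable (restrict_space lborel {0..2 * pi}) g"
    using S by (subst integrable_restrict_space) (auto simp: set_integrable_def)
  moreover have "integral\<^sup>L (restrict_space lborel {0..2 * pi}) g = integral {0..2 * pi} g"
    using set_borel_integral_eq_integral(2)[OF S]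
    by (subst integral_restrict_space) (auto simp: set_lebesgue_integral_def)
  ultimately show ?thesis using ereal_integral_ereal by metis
qed

text \<open>Rotating the three arcs of angle 2 pi / 3 onto the first turns the integrand into a sum
  over an orbit, where the hypothesis applies pointwise.\<close>

lemma integral_circle_thirds:
  fixes g :: "complex \<Rightarrow> real"
  assumes cont: "continuous_on (sphere 0 r) g" and r: "0 < r"
    and le: "\<And>c. cmod c = r \<Longrightarrow> m \<le> (g c + g (root3 * c) + g (root3\<^sup>2 * c)) / 3"
  shows "2 * pi * m \<le> integral {0..2 * pi} (\<lambda>\<theta>. g (of_real r * cis \<theta>))"
proof -
  define h where "h \<theta> = g (of_real r * cis \<theta>)" for \<theta>
  have h: "continuous_on A h" for A
    unfolding h_def
    by (rule continuous_on_compose2[OF cont]) (use r in \<open>auto intro!: continuous_intros simp: norm_mult\<close>)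
  hence int: "h integrable_on {x..y}" for x y by (intro integrable_continuous_real)
  define p where "p = 2 * pi / 3"
  have p: "0 < p" "2 * pi = 3 * p" unfolding p_def by auto
  have shift: "integral {0..p} (\<lambda>\<theta>. h (\<theta> + s)) = integral {s..p + s} h" for s
    using integral_shift[of 0 s p h] h by (simp add: o_def)
  have hs: "(\<lambda>\<theta>. h (\<theta> + s)) integrable_on {0..p}" for s
    by (intro integrable_continuous_real continuous_on_compose2[OF h[of UNIV]] continuous_intros) auto
  have "3 * m * p = integral {0..p} (\<lambda>\<theta>. 3 * m)" using p by simp
  also have "\<dots> \<le> integral {0..p} (\<lambda>\<theta>. h (\<theta> + 0) + h (\<theta> + p) + h (\<theta> + 2 * p))"
  proof (intro integral_le integrable_add hs integrable_const_ivl)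
    fix \<theta>
    have "cis (\<theta> + p) = root3 * cis \<theta>" "cis (\<theta> + 2 * p) = root3\<^sup>2 * cis \<theta>"
      unfolding root3_def p_def power2_eq_square cis_mult by (rule arg_cong[where f = cis], simp)+
    thus "3 * m \<le> h (\<theta> + 0) + h (\<theta> + p) + h (\<theta> + 2 * p)"
      using le[of "of_real r * cis \<theta>"] r unfolding h_def by (simp add: norm_mult mult_ac)
  qed
  also have "\<dots> = integral {0..p} h + integral {p..2 * p} h + integral {2 * p..3 * p} h"
    using hs[of 0] hs[of p] hs[of "2 * p"]
    by (simp add: integral_add integrable_add shift)
  also have "\<dots> = integral {0..3 * p} h"
    using p Henstock_Kurzweil_Integration.integral_combine[OF _ _ int, of 0 p "2 * p"] Henstock_Kurzweil_Integration.integral_combine[OF _ _ int, of 0 "2 * p" "3 * p"] by simp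
  finally have "2 * pi * m \<le> integral {0..2 * pi} h" unfolding p(2) by (simp add: mult_ac)
  thus ?thesis unfolding h_def[abs_def] .
qed

lemma ereal_Liminf_at_right_ge:
  assumes "0 < \<rho>" "\<And>r. 0 < r \<Longrightarrow> r < \<rho> \<Longrightarrow> h r \<le> f r" "(h \<longlongrightarrow> l) (at_right (0::real))"
  shows "ereal l \<le> Liminf (at_right 0) (\<lambda>r. ereal (f r))"
proof -
  have "ereal l = Liminf (at_right 0) (\<lambda>r. ereal (h r))"
    using assms(3) by (intro lim_imp_Liminf[symmetric]) auto
  also have "\<dots> \<le> Liminf (at_right 0) (\<lambda>r. ereal (f r))"
    using eventually_at_right_real[OF assms(1)] assms(2) by (intro Liminf_mono) (auto elim!: eventually_mono)
  finally show ?thesis .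
qed

lemma ereal_Liminf_at_right_le:
  assumes "0 < \<rho>" "\<And>r. 0 < r \<Longrightarrow> r < \<rho> \<Longrightarrow> f r \<le> h r" "(h \<longlongrightarrow> l) (at_right (0::real))"
  shows "Liminf (at_right 0) (\<lambda>r. ereal (f r)) \<le> ereal l"
proof -
  have "Liminf (at_right 0) (\<lambda>r. ereal (f r)) \<le> Liminf (at_right 0) (\<lambda>r. ereal (h r))"
    using eventually_at_right_real[OF assms(1)] assms(2) by (intro Liminf_mono) (auto elim!: eventually_mono)
  also have "\<dots> = ereal l"
    using assms(3) by (intro lim_imp_Liminf) auto
  finally show ?thesis .
qed

context dual_banach
begin

abbreviation log_speed :: "(complex \<Rightarrow> 'a) \<Rightarrow> complex \<Rightarrow> real" where
  "log_speed f z \<equiv> ln (kobayashi_metric (ball 0 1) (f z) (complex_deriv f z))"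

text \<open>Near 0 the metric is positive and its logarithm continuous, so the extended-real
  integral is an ordinary one and the Laplacian is a liminf of real quotients.\<close>

lemma gen_laplacian_log_speed:
  fixes f :: "complex \<Rightarrow> 'a"
  assumes f: "f \<in> holomorphic_maps (ball 0 R) (ball 0 1)" and R: "0 < R" and v: "complex_deriv f 0 \<noteq> 0"
  obtains \<rho> where "0 < \<rho>" "\<rho> \<le> R" "\<And>z. cmod z < \<rho> \<Longrightarrow> complex_deriv f z \<noteq> 0"
    "\<And>r. 0 < r \<Longrightarrow> r < \<rho> \<Longrightarrow> continuous_on (sphere 0 r) (log_speed f)"
    "gen_laplacian (\<lambda>z. log_ext ((kobayashi_metric (ball 0 1) (f z) (complex_deriv f z))\<^sup>2)) 0 =
      4 * Liminf (at_right 0) (\<lambda>r. ereal (1 / r\<^sup>2 *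
        (1 / (2 * pi) * integral {0..2 * pi} (\<lambda>\<theta>. 2 * log_speed f (of_real r * cis \<theta>)) - 2 * log_speed f 0)))"
proof -
  let ?k = "\<lambda>z. kobayashi_metric (ball 0 1) (f z) (complex_deriv f z)"
  obtain \<rho> L where \<rho>: "0 < \<rho>" "\<rho> \<le> R" "0 \<le> L" and nz: "\<And>z. cmod z < \<rho> \<Longrightarrow> complex_deriv f z \<noteq> 0"
    and lip: "\<And>z w. cmod z < \<rho> \<Longrightarrow> cmod w < \<rho> \<Longrightarrow> \<bar>log_speed f z - log_speed f w\<bar> \<le> L * cmod (z - w)"
    using kobayashi_metric_log_lipschitz[OF f R v] by metis
  have cont: "continuous_on (ball 0 \<rho>) (log_speed f)"
  proof -
    have "L-lipschitz_on (ball 0 \<rho>) (log_speed f)"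
      using lip \<rho> by (intro lipschitz_onI) (auto simp: dist_norm)
    thus ?thesis by (rule lipschitz_on_continuous_on)
  qed
  have cont_r: "continuous_on (sphere 0 r) (log_speed f)" if "r < \<rho>" for r
    using cont by (rule continuous_on_subset) (use that in auto)
  have log: "log_ext ((?k z)\<^sup>2) = ereal (2 * log_speed f z)" if z: "cmod z < \<rho>" for z
  proof -
    have "norm (f z) < 1" using holomorphic_mapsD(2)[OF f, of z] z \<rho> by simp
    hence "0 < ?k z" using extremal_disc_ex nz[OF z] by metis
    thus ?thesis unfolding log_ext_def by (simp add: ln_realpow)
  qed
  have "ereal (1 / r\<^sup>2) * (ereal (1 / (2 * pi)) *
        ereal_integral (restrict_space lborel {0..2 * pi})
          (\<lambda>\<theta>. log_ext ((?k (0 + complex_of_real r * cis \<theta>))\<^sup>2)) - log_ext ((?k 0)\<^sup>2))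
      = ereal (1 / r\<^sup>2 * (1 / (2 * pi) * integral {0..2 * pi} (\<lambda>\<theta>. 2 * log_speed f (of_real r * cis \<theta>)) - 2 * log_speed f 0))"
    if r: "0 < r" "r < \<rho>" for r
  proof -
    have "continuous_on {0..2 * pi} (\<lambda>\<theta>. 2 * log_speed f (of_real r * cis \<theta>))"
      by (intro continuous_on_mult_left continuous_on_compose2[OF cont_r[OF r(2)]])
        (use r in \<open>auto intro!: continuous_intros simp: norm_mult\<close>)
    from ereal_integral_continuous[OF this]
    have "ereal_integral (restrict_space lborel {0..2 * pi}) (\<lambda>\<theta>. log_ext ((?k (0 + complex_of_real r * cis \<theta>))\<^sup>2))
        = ereal (integral {0..2 * pi} (\<lambda>\<theta>. 2 * log_speed f (of_real r * cis \<theta>)))"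
      using r by (subst log) (auto simp: norm_mult)
    thus ?thesis using log[of 0] \<rho> by simp
  qed
  hence "eventually (\<lambda>r. ereal (1 / r\<^sup>2) * (ereal (1 / (2 * pi)) *
        ereal_integral (restrict_space lborel {0..2 * pi})
          (\<lambda>\<theta>. log_ext ((?k (0 + complex_of_real r * cis \<theta>))\<^sup>2)) - log_ext ((?k 0)\<^sup>2))
      = ereal (1 / r\<^sup>2 * (1 / (2 * pi) * integral {0..2 * pi} (\<lambda>\<theta>. 2 * log_speed f (of_real r * cis \<theta>)) - 2 * log_speed f 0)))
      (at_right 0)"
    using eventually_at_right_real[OF \<rho>(1)] by (auto elim!: eventually_mono)
  from Liminf_eq[OF this] show thesis
    using that[OF \<rho>(1,2) nz cont_r] unfolding gen_laplacian_def by simp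
qed

text \<open>Composing with z / k normalises the speed at 0 to 1. Undoing this adds
  \<open>ln k\<close> and replaces r by k r, so the mean of 2 * \<open>log_speed\<close> exceeds its
  value at 0 by at least 2 (k r)^2 - O(r^3); the factor 4 of the Laplacian yields 8 k^2.\<close>

lemma gen_laplacian_log_speed_ge:
  fixes f :: "complex \<Rightarrow> 'a"
  assumes f: "f \<in> holomorphic_maps (ball 0 R) (ball 0 1)" and R: "0 < R" and v: "complex_deriv f 0 \<noteq> 0"
  shows "ereal (8 * (kobayashi_metric (ball 0 1) (f 0) (complex_deriv f 0))\<^sup>2)
    \<le> gen_laplacian (\<lambda>z. log_ext ((kobayashi_metric (ball 0 1) (f z) (complex_deriv f z))\<^sup>2)) 0"
proof -
  let ?k = "\<lambda>z. kobayashi_metric (ball 0 1) (f z) (complex_deriv f z)"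
  define k where "k = ?k 0"
  have f1: "norm (f z) < 1" if "cmod z < R" for z
    using holomorphic_mapsD(2)[OF f, of z] that by simp
  have k: "0 < k" unfolding k_def
    by (rule extremal_disc_ex[of "f 0" "complex_deriv f 0"]) (use f1[of 0] R v in auto)
  obtain \<rho>1 where \<rho>1: "0 < \<rho>1" "\<rho>1 \<le> R" and nz: "\<And>z. cmod z < \<rho>1 \<Longrightarrow> complex_deriv f z \<noteq> 0"
    and cont: "\<And>r. 0 < r \<Longrightarrow> r < \<rho>1 \<Longrightarrow> continuous_on (sphere 0 r) (log_speed f)"
    and lap: "gen_laplacian (\<lambda>z. log_ext ((?k z)\<^sup>2)) 0 =
      4 * Liminf (at_right 0) (\<lambda>r. ereal (1 / r\<^sup>2 *
        (1 / (2 * pi) * integral {0..2 * pi} (\<lambda>\<theta>. 2 * log_speed f (of_real r * cis \<theta>)) - 2 * log_speed f 0)))"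
    by (rule gen_laplacian_log_speed[OF f R v]) blast
  define F where "F z = f (of_real (1 / k) * z)" for z
  have in_ball: "of_real (1 / k) * z \<in> ball 0 R" if "z \<in> ball 0 (R * k)" for z :: complex
    using that k by (simp add: norm_mult norm_divide field_simps)
  have der: "has_complex_derivative F (of_real (1 / k) *\<^sub>C complex_deriv f (of_real (1 / k) * z)) z"
    if "z \<in> ball 0 (R * k)" for z
    unfolding F_def
    by (intro has_complex_derivative_chain[where g = "\<lambda>w. of_real (1 / k) * w"] holomorphic_mapsD(1)[OF f] in_ball that)
      (rule DERIV_cmult_Id)
  have F: "F \<in> holomorphic_maps (ball 0 (R * k)) (ball 0 1)"
    unfolding holomorphic_maps_def
  proof (intro CollectI conjI ballI image_subsetI)
    fix z :: complex assume z: "z \<in> ball 0 (R * k)"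
    show "\<exists>v. has_complex_derivative F v z" using der[OF z] by blast
    show "F z \<in> ball 0 1" unfolding F_def by (rule holomorphic_mapsD(2)[OF f in_ball[OF z]])
  qed
  have dF: "complex_deriv F z = (1 / k) *\<^sub>R complex_deriv f (of_real (1 / k) * z)" if "z \<in> ball 0 (R * k)" for z
    using complex_deriv_eqI[OF der[OF that]] by (simp only: scaleC_of_real)
  have kF: "kobayashi_metric (ball 0 1) (F z) (complex_deriv F z) = ?k (of_real (1 / k) * z) / k"
    if z: "cmod z < \<rho>1 * k" for z
  proof -
    have "cmod (of_real (1 / k) * z) < \<rho>1" using z k by (simp add: norm_mult norm_divide field_simps)
    moreover have "z \<in> ball 0 (R * k)" using z \<rho>1 k by (simp add: less_le_trans mult_right_mono)
    ultimately show ?thesis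
      using kobayashi_metric_scaleR[OF f1 nz, of "of_real (1 / k) * z" "of_real (1 / k) * z" "1 / k"] \<rho>1 k
      by (simp add: dF F_def)
  qed
  have kpos: "0 < ?k z" if "cmod z < \<rho>1" for z
    using extremal_disc_ex[OF f1 nz[OF that]] that \<rho>1 by (meson less_le_trans)
  obtain \<rho>2 K where \<rho>2: "0 < \<rho>2" and mean: "\<And>c. c \<noteq> 0 \<Longrightarrow> cmod c < \<rho>2 \<Longrightarrow>
    (cmod c)\<^sup>2 - K * cmod c ^ 3 \<le> (log_speed F c + log_speed F (root3 * c) + log_speed F (root3\<^sup>2 * c)) / 3"
  proof (rule log_kobayashi_metric_mean3[OF F])
    show "0 < R * k" using R k by simp
    show "kobayashi_metric (ball 0 1) (F 0) (complex_deriv F 0) = 1"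
      using kF[of 0] \<rho>1 k unfolding k_def by simp
    show "complex_deriv F 0 \<noteq> 0" using dF[of 0] R k v by simp
  qed blast
  define \<rho> where "\<rho> = min \<rho>1 (\<rho>2 / k)"
  have \<rho>: "0 < \<rho>" unfolding \<rho>_def using \<rho>1 \<rho>2 k by simp
  have U: "log_speed f z = ln k + log_speed F (of_real k * z)" if z: "cmod z < \<rho>1" for z
  proof -
    have "kobayashi_metric (ball 0 1) (F (of_real k * z)) (complex_deriv F (of_real k * z)) = ?k z / k"
      using kF[of "of_real k * z"] z k by (simp add: norm_mult mult.commute)
    thus ?thesis using kpos[OF z] k by (simp add: ln_div)
  qed
  have "ereal (2 * k\<^sup>2) \<le> Liminf (at_right 0) (\<lambda>r. ereal (1 / r\<^sup>2 *
        (1 / (2 * pi) * integral {0..2 * pi} (\<lambda>\<theta>. 2 * log_speed f (of_real r * cis \<theta>)) - 2 * log_speed f 0)))"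
  proof (rule ereal_Liminf_at_right_ge[OF \<rho>])
    fix r :: real assume r: "0 < r" "r < \<rho>"
    have "2 * pi * (2 * (ln k + ((k * r)\<^sup>2 - K * (k * r) ^ 3)))
        \<le> integral {0..2 * pi} (\<lambda>\<theta>. 2 * log_speed f (of_real r * cis \<theta>))"
    proof (rule integral_circle_thirds)
      show "continuous_on (sphere 0 r) (\<lambda>z. 2 * log_speed f z)"
        using r by (intro continuous_on_mult_left cont) (auto simp: \<rho>_def)
      fix c :: complex assume c: "cmod c = r"
      have "r * k < \<rho>2" using r k unfolding \<rho>_def by (simp add: field_simps)
      hence "(k * r)\<^sup>2 - K * (k * r) ^ 3 \<le>
          (log_speed F (of_real k * c) + log_speed F (root3 * (of_real k * c)) + log_speed F (root3\<^sup>2 * (of_real k * c))) / 3"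
        using mean[of "of_real k * c"] c k r by (auto simp: norm_mult mult.commute)
      moreover have "log_speed f z = ln k + log_speed F (of_real k * z)" if "z \<in> orbit3 c" for z
        using orbit3_norm[OF that] c r by (intro U) (simp add: \<rho>_def)
      hence "log_speed f c = ln k + log_speed F (of_real k * c)"
        "log_speed f (root3 * c) = ln k + log_speed F (root3 * (of_real k * c))"
        "log_speed f (root3\<^sup>2 * c) = ln k + log_speed F (root3\<^sup>2 * (of_real k * c))"
        by (simp_all add: orbit3_def mult.left_commute)
      ultimately show "2 * (ln k + ((k * r)\<^sup>2 - K * (k * r) ^ 3))
          \<le> (2 * log_speed f c + 2 * log_speed f (root3 * c) + 2 * log_speed f (root3\<^sup>2 * c)) / 3"
        by (simp add: field_simps)
    qed (use r in simp)
    hence "2 * (ln k + ((k * r)\<^sup>2 - K * (k * r) ^ 3))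
        \<le> 1 / (2 * pi) * integral {0..2 * pi} (\<lambda>\<theta>. 2 * log_speed f (of_real r * cis \<theta>))"
      by (simp add: field_simps)
    hence "1 / r\<^sup>2 * (2 * ((k * r)\<^sup>2 - K * (k * r) ^ 3)) \<le> 1 / r\<^sup>2 *
        (1 / (2 * pi) * integral {0..2 * pi} (\<lambda>\<theta>. 2 * log_speed f (of_real r * cis \<theta>)) - 2 * log_speed f 0)"
      unfolding k_def[symmetric] by (intro mult_left_mono) auto
    moreover have "1 / r\<^sup>2 * (2 * ((k * r)\<^sup>2 - K * (k * r) ^ 3)) = 2 * k\<^sup>2 - 2 * K * k ^ 3 * r"
      using r by (simp add: field_simps power2_eq_square power3_eq_cube)
    ultimately show "2 * k\<^sup>2 - 2 * K * k ^ 3 * r \<le> 1 / r\<^sup>2 *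
        (1 / (2 * pi) * integral {0..2 * pi} (\<lambda>\<theta>. 2 * log_speed f (of_real r * cis \<theta>)) - 2 * log_speed f 0)"
      by simp
  next
    have "((\<lambda>r. 2 * k\<^sup>2 - 2 * K * k ^ 3 * r) \<longlongrightarrow> 2 * k\<^sup>2 - 2 * K * k ^ 3 * 0) (at_right 0)"
      by (intro tendsto_intros)
    thus "((\<lambda>r. 2 * k\<^sup>2 - 2 * K * k ^ 3 * r) \<longlongrightarrow> 2 * k\<^sup>2) (at_right 0)" by simp
  qed
  hence "4 * ereal (2 * k\<^sup>2) \<le> gen_laplacian (\<lambda>z. log_ext ((?k z)\<^sup>2)) 0"
    unfolding lap by (intro ereal_mult_left_mono) auto
  thus ?thesis unfolding k_def by simp
qed

text \<open>Run the extremal disc at speed k. Re-centring bounds \<open>log_speed\<close> by ln k -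
  ln (1 - (k |z|)^2), with equality at 0, and an upper bound off the centre is enough to bound the
  mean from above.\<close>

lemma gen_laplacian_log_speed_extremal:
  fixes x v :: 'a
  assumes x: "norm x < 1" and v: "v \<noteq> 0"
  obtains f R where "0 < R" "f \<in> holomorphic_maps (ball 0 R) (ball 0 1)" "f 0 = x" "complex_deriv f 0 = v"
    "gen_laplacian (\<lambda>z. log_ext ((kobayashi_metric (ball 0 1) (f z) (complex_deriv f z))\<^sup>2)) 0
      \<le> ereal (8 * (kobayashi_metric (ball 0 1) x v)\<^sup>2)"
proof -
  define k where "k = kobayashi_metric (ball 0 1) x v"
  obtain \<phi> where k: "0 < k" and \<phi>: "\<phi> \<in> holomorphic_maps (ball 0 1) (ball 0 1)" "\<phi> 0 = x"
    "k *\<^sub>R complex_deriv \<phi> 0 = v"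
    using extremal_disc_ex[OF x v] unfolding k_def .
  define f where "f z = \<phi> (of_real k * z)" for z
  let ?k = "\<lambda>z. kobayashi_metric (ball 0 1) (f z) (complex_deriv f z)"
  have in_ball: "of_real k * z \<in> ball 0 1" if "z \<in> ball 0 (1 / k)" for z :: complex
    using that k by (simp add: norm_mult field_simps)
  have der: "has_complex_derivative f (of_real k *\<^sub>C complex_deriv \<phi> (of_real k * z)) z"
    if "z \<in> ball 0 (1 / k)" for z
    unfolding f_def
    by (intro has_complex_derivative_chain[where g = "\<lambda>w. of_real k * w"] holomorphic_mapsD(1)[OF \<phi>(1)] in_ball that)
      (rule DERIV_cmult_Id)
  have f: "f \<in> holomorphic_maps (ball 0 (1 / k)) (ball 0 1)"
    unfolding holomorphic_maps_def
  proof (intro CollectI conjI ballI image_subsetI)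
    fix z :: complex assume z: "z \<in> ball 0 (1 / k)"
    show "\<exists>v. has_complex_derivative f v z" using der[OF z] by blast
    show "f z \<in> ball 0 1" unfolding f_def by (rule holomorphic_mapsD(2)[OF \<phi>(1) in_ball[OF z]])
  qed
  have df: "complex_deriv f z = k *\<^sub>R complex_deriv \<phi> (of_real k * z)" if "z \<in> ball 0 (1 / k)" for z
    using complex_deriv_eqI[OF der[OF that]] by (simp only: scaleC_of_real)
  have f0: "f 0 = x" "complex_deriv f 0 = v" using \<phi>(2,3) df[of 0] k by (auto simp: f_def)
  have R: "0 < 1 / k" using k by simp
  have v0: "complex_deriv f 0 \<noteq> 0" using f0 v by simp
  obtain \<rho> where \<rho>: "0 < \<rho>" "\<rho> \<le> 1 / k" and nz: "\<And>z. cmod z < \<rho> \<Longrightarrow> complex_deriv f z \<noteq> 0"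
    and cont: "\<And>r. 0 < r \<Longrightarrow> r < \<rho> \<Longrightarrow> continuous_on (sphere 0 r) (log_speed f)"
    and lap: "gen_laplacian (\<lambda>z. log_ext ((?k z)\<^sup>2)) 0 =
      4 * Liminf (at_right 0) (\<lambda>r. ereal (1 / r\<^sup>2 *
        (1 / (2 * pi) * integral {0..2 * pi} (\<lambda>\<theta>. 2 * log_speed f (of_real r * cis \<theta>)) - 2 * log_speed f 0)))"
    by (rule gen_laplacian_log_speed[OF f R v0]) blast
  have kr: "(k * r)\<^sup>2 < 1" if r: "0 < r" "r < \<rho>" for r
  proof -
    have "k * r < 1" using r \<rho> k by (smt (verit) less_divide_eq mult.commute)
    thus ?thesis using r k by (simp add: abs_square_less_1)
  qed
  have U: "log_speed f z \<le> ln k + (k * cmod z)\<^sup>2 / (1 - (k * cmod z)\<^sup>2)" if z: "0 < cmod z" "cmod z < \<rho>" for z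
  proof -
    define w where "w = of_real k * z"
    have zb: "z \<in> ball 0 (1 / k)" using z \<rho> by simp
    have w: "cmod w < 1" "cmod w = k * cmod z" using in_ball[OF zb] k unfolding w_def by (auto simp: norm_mult)
    have nz': "complex_deriv \<phi> w \<noteq> 0" using nz[OF z(2)] df[OF zb] unfolding w_def by auto
    have \<phi>w: "norm (\<phi> w) < 1" using holomorphic_mapsD(2)[OF \<phi>(1), of w] w by simp
    have "?k z = k * kobayashi_metric (ball 0 1) (\<phi> w) (complex_deriv \<phi> w)"
      using kobayashi_metric_scaleR[OF \<phi>w nz' k] df[OF zb] by (simp add: f_def w_def)
    moreover have "kobayashi_metric (ball 0 1) (\<phi> w) (complex_deriv \<phi> w) \<le> 1 / (1 - (cmod w)\<^sup>2)"
      by (rule kobayashi_metric_moebius[OF \<phi>(1) w(1)])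
    moreover have kw: "0 < kobayashi_metric (ball 0 1) (\<phi> w) (complex_deriv \<phi> w)"
      using extremal_disc_ex[OF \<phi>w nz'] by blast
    ultimately have "log_speed f z \<le> ln k + ln (1 / (1 - (cmod w)\<^sup>2))"
      using k w(1) by (simp add: ln_mult abs_square_less_1)
    also have "ln (1 / (1 - (cmod w)\<^sup>2)) \<le> 1 / (1 - (cmod w)\<^sup>2) - 1"
      using w(1) by (intro ln_le_minus_one) (simp add: abs_square_less_1)
    also have "\<dots> = (cmod w)\<^sup>2 / (1 - (cmod w)\<^sup>2)"
      using kr[OF z] by (simp add: w field_simps)
    finally show ?thesis unfolding w(2) by simp
  qed
  have "Liminf (at_right 0) (\<lambda>r. ereal (1 / r\<^sup>2 *
        (1 / (2 * pi) * integral {0..2 * pi} (\<lambda>\<theta>. 2 * log_speed f (of_real r * cis \<theta>)) - 2 * log_speed f 0)))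
      \<le> ereal (2 * k\<^sup>2)"
  proof (rule ereal_Liminf_at_right_le[OF \<rho>(1)])
    fix r :: real assume r: "0 < r" "r < \<rho>"
    define B where "B = 2 * (ln k + (k * r)\<^sup>2 / (1 - (k * r)\<^sup>2))"
    have "integral {0..2 * pi} (\<lambda>\<theta>. 2 * log_speed f (of_real r * cis \<theta>)) \<le> integral {0..2 * pi} (\<lambda>\<theta>. B)"
    proof (rule integral_le)
      show "(\<lambda>\<theta>. 2 * log_speed f (of_real r * cis \<theta>)) integrable_on {0..2 * pi}"
        by (intro integrable_continuous_real continuous_on_mult_left continuous_on_compose2[OF cont[OF r]])
          (use r in \<open>auto intro!: continuous_intros simp: norm_mult\<close>)
      show "2 * log_speed f (of_real r * cis \<theta>) \<le> B" for \<theta>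
        using U[of "of_real r * cis \<theta>"] r unfolding B_def by (simp add: norm_mult)
    qed auto
    hence "1 / (2 * pi) * integral {0..2 * pi} (\<lambda>\<theta>. 2 * log_speed f (of_real r * cis \<theta>)) \<le> B"
      by (simp add: field_simps)
    moreover have "log_speed f 0 = ln k" by (simp add: f0 k_def)
    ultimately have "1 / r\<^sup>2 * (1 / (2 * pi) * integral {0..2 * pi} (\<lambda>\<theta>. 2 * log_speed f (of_real r * cis \<theta>)) - 2 * log_speed f 0)
        \<le> 1 / r\<^sup>2 * (2 * ((k * r)\<^sup>2 / (1 - (k * r)\<^sup>2)))"
      unfolding B_def by (intro mult_left_mono) auto
    also have "\<dots> = 2 * k\<^sup>2 / (1 - (k * r)\<^sup>2)" using r by (simp add: power_mult_distrib)
    finally show "1 / r\<^sup>2 * (1 / (2 * pi) * integral {0..2 * pi} (\<lambda>\<theta>. 2 * log_speed f (of_real r * cis \<theta>)) - 2 * log_speed f 0)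
        \<le> 2 * k\<^sup>2 / (1 - (k * r)\<^sup>2)" .
  next
    have "((\<lambda>r. 2 * k\<^sup>2 / (1 - (k * r)\<^sup>2)) \<longlongrightarrow> 2 * k\<^sup>2 / (1 - (k * 0)\<^sup>2)) (at_right 0)"
      by (intro tendsto_intros) auto
    thus "((\<lambda>r. 2 * k\<^sup>2 / (1 - (k * r)\<^sup>2)) \<longlongrightarrow> 2 * k\<^sup>2) (at_right 0)" by simp
  qed
  hence "gen_laplacian (\<lambda>z. log_ext ((?k z)\<^sup>2)) 0 \<le> 4 * ereal (2 * k\<^sup>2)"
    unfolding lap by (intro ereal_mult_left_mono) auto
  hence "gen_laplacian (\<lambda>z. log_ext ((?k z)\<^sup>2)) 0 \<le> ereal (8 * (kobayashi_metric (ball 0 1) x v)\<^sup>2)"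
    unfolding k_def by simp
  from that[OF R f f0 this] show thesis .
qed

section \<open>The value of the curvature\<close>

theorem kobayashi_curvature_unit_ball:
  fixes x v :: 'a
  assumes x: "norm x < 1" and v: "v \<noteq> 0"
  shows "kobayashi_curvature (ball 0 1) x v = -4"
proof -
  define k where "k = kobayashi_metric (ball 0 1) x v"
  have k: "0 < k" using extremal_disc_ex[OF x v] unfolding k_def by blast
  \<comment> \<open>The quotient 8 k^2 / (-2 k^2) is -4, and the negative denominator reverses the
    inequalities. The case split on g covers infinite values of the Laplacian.\<close>
  have le: "g / ereal (- 2 * k\<^sup>2) \<le> -4" if "ereal (8 * k\<^sup>2) \<le> g" for g
    using that k by (cases g) (auto simp: field_simps)
  have ge: "-4 \<le> g / ereal (- 2 * k\<^sup>2)" if "g \<le> ereal (8 * k\<^sup>2)" for g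
    using that k by (cases g) (auto simp: field_simps)
  show ?thesis
  proof (rule antisym)
    show "kobayashi_curvature (ball 0 1) x v \<le> -4"
      unfolding kobayashi_curvature_def
    proof (rule Sup_least, clarify)
      fix f :: "complex \<Rightarrow> 'a" and r :: real
      assume f: "0 < r" "f \<in> holomorphic_maps (ball 0 r) (ball 0 1)" "x = f 0" "v = complex_deriv f 0"
      have "ereal (8 * k\<^sup>2) \<le> gen_laplacian (\<lambda>z. log_ext ((kobayashi_metric (ball 0 1) (f z) (complex_deriv f z))\<^sup>2)) 0"
        using gen_laplacian_log_speed_ge[OF f(2,1)] v f(3,4) unfolding k_def by simp
      from le[OF this] show "gen_laplacian (\<lambda>z. log_ext ((kobayashi_metric (ball 0 1) (f z) (complex_deriv f z))\<^sup>2)) 0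
          / ereal (- 2 * (kobayashi_metric (ball 0 1) (f 0) (complex_deriv f 0))\<^sup>2) \<le> -4"
        unfolding k_def f(3,4) .
    qed
    obtain f R where f: "0 < R" "f \<in> holomorphic_maps (ball 0 R) (ball 0 1)" "f 0 = x" "complex_deriv f 0 = v"
      and lap: "gen_laplacian (\<lambda>z. log_ext ((kobayashi_metric (ball 0 1) (f z) (complex_deriv f z))\<^sup>2)) 0
        \<le> ereal (8 * k\<^sup>2)"
      using gen_laplacian_log_speed_extremal[OF x v] unfolding k_def .
    show "-4 \<le> kobayashi_curvature (ball 0 1) x v"
      unfolding kobayashi_curvature_def
      by (rule order_trans[OF ge[OF lap]], rule Sup_upper) (use f k_def in blast)
  qed
qed

end

theorem corollary6p8:
  fixes J :: "'a::complex_banach \<Rightarrow> 'b::complex_banach \<Rightarrow> complex"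
  assumes "dual_isometry J"
  shows "\<forall>x\<in>ball (0::'a) 1. \<forall>v. v \<noteq> 0 \<longrightarrow> kobayashi_curvature (ball 0 1) x v = -4"
proof -
  interpret dual_banach J by standard (rule assms)
  show ?thesis using kobayashi_curvature_unit_ball by simp
qed

end
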